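(* Let $\mathcal{H}\in C^1(\mathbb{S}^2)$ with $\mathcal{H}>0$, and let $M$ be a compact $\mathcal{H}$-graph on a plane $\Pi\subset\mathbb{R}^3$. Suppose that the boundary of $M$ is contained in $\Pi$. If $h$ is the height of $M$ with respect to $\Pi$, then $$h\leq\frac{\mathcal{H}_{\max}\,\mathrm{area}(M)}{2\pi},$$ where $\mathcal{H}_{\max}=\max\{\mathcal{H}(x):x\in\mathbb{S}^2\}$.
   Context: $\mathbb{S}^2$ is the unit sphere of $\mathbb{R}^3$. Surfaces are smooth, connected and oriented, possibly with boundary, with Gauss map (unit normal field) $N:M\to\mathbb{S}^2$. The mean curvature $H_M$ is the average of the principal curvatures with respect to $N$, with the sign convention that the graph of $u$ oriented by $N=(-Du,1)/\sqrt{1+|Du|^2}$ has $2H_M=\mathrm{div}\big(Du/\sqrt{1+|Du|^2}\big)$ (so a unit sphere with inward normal has $H_M=1$). Given $\mathcal{H}\in C^1(\mathbb{S}^2)$, an $\mathcal{H}$-surface is a surface $M$ such that $H_M(p)=\mathcal{H}(N_p)$ for all $p\in M$. A compact $\mathcal{H}$-graph on $\Pi$ is an $\mathcal{H}$-surface which is the graph (in the direction orthogonal to $\Pi$) of a function defined on the closure of a bounded domain of $\Pi$. The height of $M$ with respect to $\Pi$ is the maximum of the distances from points of $M$ to $\Pi$. *)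

theory Defs
  imports "HOL-Analysis.Analysis"
begin

text \<open>
  \<open>Ck_on k S f\<close> is meant for open \<open>S\<close>. Since all partial derivatives of order at most \<open>k\<close> are
  required to be continuous, in finite dimension this is the usual class $C^k$.
\<close>

primrec Ck_on ::
  "nat \<Rightarrow> 'a::euclidean_space set \<Rightarrow> ('a \<Rightarrow> 'b::real_normed_vector) \<Rightarrow> bool" where
  "Ck_on 0 S f \<longleftrightarrow> continuous_on S f"
| "Ck_on (Suc k) S f \<longleftrightarrow>
     (\<forall>x\<in>S. f differentiable (at x)) \<and>
     (\<forall>v. Ck_on k S (\<lambda>x. frechet_derivative f (at x) v))"

definition smooth_on :: "'a::euclidean_space set \<Rightarrow> ('a \<Rightarrow> 'b::real_normed_vector) \<Rightarrow> bool" where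
  "smooth_on S f \<longleftrightarrow> (\<forall>k. Ck_on k S f)"

text \<open>A function on the sphere is of class $C^1$ if it is the restriction of a $C^1$ function
  on a neighbourhood of the sphere; the values of \<open>H\<close> off the sphere are irrelevant.\<close>

definition C1_on_sphere :: "(real^3 \<Rightarrow> real) \<Rightarrow> bool" where
  "C1_on_sphere H \<longleftrightarrow>
     (\<exists>W G. open W \<and> sphere 0 1 \<subseteq> W \<and> Ck_on 1 W G \<and> (\<forall>x\<in>sphere 0 1. G x = H x))"

definition half_plane :: "(real^2) set" where
  "half_plane = {x. 0 \<le> x $ 2}"

text \<open>
  A local parametrization of \<open>M\<close> is defined and smooth on an open set \<open>U\<close> of the plane, but only
  \<open>U \<inter> half_plane\<close> parametrizes (an open part of) \<open>M\<close>. Interior points are covered by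
  taking \<open>U\<close> inside the open half plane.
\<close>

definition surface_chart ::
  "(real^3) set \<Rightarrow> (real^2) set \<Rightarrow> (real^2 \<Rightarrow> real^3) \<Rightarrow> bool" where
  "surface_chart M U X \<longleftrightarrow>
     open U \<and> smooth_on U X \<and> (\<forall>q\<in>U. inj (frechet_derivative X (at q))) \<and>
     openin (top_of_set M) (X ` (U \<inter> half_plane)) \<and>
     (\<exists>Y. homeomorphism (U \<inter> half_plane) (X ` (U \<inter> half_plane)) X Y)"

definition smooth_surface :: "(real^3) set \<Rightarrow> bool" where
  "smooth_surface M \<longleftrightarrow>
     M \<noteq> {} \<and> connected M \<and> (\<forall>p\<in>M. \<exists>U X. surface_chart M U X \<and> p \<in> X ` (U \<inter> half_plane))"

definition surface_boundary :: "(real^3) set \<Rightarrow> (real^3) set" where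
  "surface_boundary M = {X q | X q. \<exists>U. surface_chart M U X \<and> q \<in> U \<and> q $ 2 = 0}"

definition tangent_plane :: "(real^3) set \<Rightarrow> real^3 \<Rightarrow> (real^3) set" where
  "tangent_plane M p =
     {frechet_derivative X (at q) w | X q w.
        \<exists>U. surface_chart M U X \<and> q \<in> U \<inter> half_plane \<and> X q = p}"

text \<open>Continuity of a unit normal field on a smooth surface already makes it smooth.\<close>

definition gauss_map :: "(real^3) set \<Rightarrow> (real^3 \<Rightarrow> real^3) \<Rightarrow> bool" where
  "gauss_map M N \<longleftrightarrow>
     continuous_on M N \<and>
     (\<forall>p\<in>M. N p \<in> sphere 0 1 \<and> (\<forall>v\<in>tangent_plane M p. N p \<bullet> v = 0))"

text \<open>
  The principal curvatures are the eigenvalues, counted with multiplicity, of the shape operator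
  \<open>- dN\<close> on the tangent plane, here given through an orthonormal basis of eigenvectors.
  A derivative \<open>D\<close> of \<open>N\<close> at \<open>p\<close> within \<open>M\<close> is determined by \<open>M\<close> and \<open>N\<close> only on the tangent
  plane at \<open>p\<close>, which is the only place where it is used. With this sign, the unit sphere with
  the inward normal \<open>N p = - p\<close> has both principal curvatures equal to \<open>1\<close>.
\<close>

definition principal_curvatures ::
  "(real^3) set \<Rightarrow> (real^3 \<Rightarrow> real^3) \<Rightarrow> real^3 \<Rightarrow> real \<Rightarrow> real \<Rightarrow> bool" where
  "principal_curvatures M N p k1 k2 \<longleftrightarrow>
     (\<exists>D e1 e2. (N has_derivative D) (at p within M) \<and>
        e1 \<in> tangent_plane M p \<and> e2 \<in> tangent_plane M p \<and>
        norm e1 = 1 \<and> norm e2 = 1 \<and> e1 \<bullet> e2 = 0 \<and>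
        - D e1 = k1 *\<^sub>R e1 \<and> - D e2 = k2 *\<^sub>R e2)"

definition has_mean_curvature ::
  "(real^3) set \<Rightarrow> (real^3 \<Rightarrow> real^3) \<Rightarrow> real^3 \<Rightarrow> real \<Rightarrow> bool" where
  "has_mean_curvature M N p m \<longleftrightarrow>
     (\<exists>k1 k2. principal_curvatures M N p k1 k2 \<and> m = (k1 + k2) / 2)"

definition H_surface ::
  "(real^3 \<Rightarrow> real) \<Rightarrow> (real^3) set \<Rightarrow> (real^3 \<Rightarrow> real^3) \<Rightarrow> bool" where
  "H_surface H M N \<longleftrightarrow>
     smooth_surface M \<and> gauss_map M N \<and> (\<forall>p\<in>M. has_mean_curvature M N p (H (N p)))"

definition is_plane :: "(real^3) set \<Rightarrow> bool" where
  "is_plane P \<longleftrightarrow> affine P \<and> aff_dim P = 2"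

text \<open>
  Smoothness is a condition on the surface \<open>M\<close>, not on the function \<open>u\<close>: a closed hemisphere is a
  compact graph although its \<open>u\<close> is not differentiable at the boundary of the disc.
\<close>

definition compact_H_graph ::
  "(real^3 \<Rightarrow> real) \<Rightarrow> (real^3) set \<Rightarrow> (real^3 \<Rightarrow> real^3) \<Rightarrow> (real^3) set \<Rightarrow> bool" where
  "compact_H_graph H M N P \<longleftrightarrow>
     H_surface H M N \<and> compact M \<and>
     (\<exists>\<Omega> \<nu> u. openin (top_of_set P) \<Omega> \<and> connected \<Omega> \<and> \<Omega> \<noteq> {} \<and> bounded \<Omega> \<and>
        norm \<nu> = 1 \<and> (\<forall>x\<in>P. \<forall>y\<in>P. \<nu> \<bullet> (x - y) = 0) \<and>
        M = (\<lambda>q. q + u q *\<^sub>R \<nu>) ` closure \<Omega>)"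

definition height :: "(real^3) set \<Rightarrow> (real^3) set \<Rightarrow> real" where
  "height M P = (SUP p\<in>M. infdist p P)"

definition area_element :: "(real^2 \<Rightarrow> real^3) \<Rightarrow> real^2 \<Rightarrow> real" where
  "area_element X q =
     norm (cross3 (frechet_derivative X (at q) (axis 1 1)) (frechet_derivative X (at q) (axis 2 1)))"

text \<open>
  The area of \<open>M\<close> is the total area of a decomposition of \<open>M\<close> into disjoint Borel pieces, each
  contained in one chart. It does not depend on the decomposition, so it is also the supremum
  over all finite families of disjoint pieces.
\<close>

definition chart_pieces :: "(real^3) set \<Rightarrow> ((real^2 \<Rightarrow> real^3) \<times> (real^2) set) set" where
  "chart_pieces M =
     {(X, B). B \<in> sets borel \<and> (\<exists>U. surface_chart M U X \<and> B \<subseteq> U \<inter> half_plane)}"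

definition area :: "(real^3) set \<Rightarrow> ennreal" where
  "area M =
     (SUP F \<in> {F. finite F \<and> F \<subseteq> chart_pieces M \<and> disjoint_family_on (\<lambda>(X, B). X ` B) F}.
        \<Sum>(X, B)\<in>F. \<integral>\<^sup>+q\<in>B. ennreal (area_element X q) \<partial>lborel)"

end

theory Submission
  imports Defs
begin

text \<open>
  Let \<open>u > 0\<close> be the height of the part of \<open>M\<close> on one side of the plane, as a function on an open
  set \<open>D\<close> of the plane, let \<open>W = sqrt (1 + |Du|^2)\<close>, and let \<open>K\<close> be the maximum of \<open>H\<close>. The
  vector field \<open>Du / W\<close> has divergence \<open>2 H\<close> up to sign, hence of modulus at most \<open>2 K\<close>, and
  \<open>M\<close> has at least the area \<open>\<integral>\<^sub>D W\<close>. The classical argument compares, for a level \<open>t\<close>, the length of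
  the level curve \<open>{u = t}\<close> with the measure \<open>V(t)\<close> of \<open>{u \<ge> t}\<close> by the isoperimetric inequality.
  The divergence theorem bounds \<open>\<integral> |Du| / W\<close> over the level curve by \<open>2 K V(t)\<close>, and the
  Cauchy-Schwarz inequality then shows that the area above level \<open>t\<close> decreases in \<open>t\<close> at rate at
  least \<open>2 pi / K\<close>.

  Here the level curves are replaced by thin slices \<open>{a < u < b}\<close>, so that no regular values and no
  coarea formula occur. On a slice the Cauchy-Schwarz inequality is used in the linearized form
  \<open>W \<ge> 2 s |Du| - s^2 |Du|^2 / W\<close>. The first term is bounded below by the sharp Sobolev inequality
  \<open>\<integral> |Dv| \<ge> 2 sqrt pi (\<integral> v^2) powr (1/2)\<close> for \<open>v\<close> a truncation of \<open>u\<close>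
  (\<open>sharp_sobolev_plane\<close>, the functional form of the isoperimetric inequality, proved by
  transporting the density \<open>v^2\<close> to the uniform density of a disc), the second one is computed by
  testing the divergence with another truncation. A suitable \<open>s\<close> gives
  \<open>(2 pi / K) (b - a) (2 sqrt (V b / V a) - 1)\<close> (\<open>slice_area_bound\<close>). Summing over
  many equal slices, the error is a telescoping sum of logarithms divided by the number of slices,
  so it disappears in the limit (\<open>slab_area_bound\<close>, \<open>height_le_area\<close>).

  What remains is that \<open>u\<close> is smooth on \<open>D\<close>. Since \<open>M\<close> is smooth as a surface only, this says that
  its tangent plane is not vertical away from the boundary (\<open>interior_normal_not_vertical\<close>). Near a
  point with vertical tangent plane, \<open>M\<close> is the graph of a function \<open>f\<close> over that plane; vertical
  lines meet \<open>M\<close> only once, so the vertical derivative \<open>g\<close> of \<open>f\<close> has a constant sign, and it vanishes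
  at the point. Differentiating the mean curvature equation, which is where \<open>H\<close> has to be
  \<open>C^1\<close>, gives a linear elliptic equation without zeroth order term for \<open>g\<close>, so \<open>g\<close> vanishes
  identically by Hopf's strong minimum principle (\<open>hopf_strong_minimum_principle\<close>). Then \<open>M\<close> contains
  a vertical segment, which is impossible.
\<close>

section \<open>The sharp Sobolev inequality in the plane\<close>

text \<open>The vertical chord of the unit disc at abscissa \<open>- cos t\<close> cuts off on its left the area
  \<open>t - sin t * cos t\<close>, so \<open>g\<close> turns a prescribed area into the angle of the chord that cuts it off.\<close>

lemma disc_slice_angle:
  obtains g :: "real \<Rightarrow> real"
  where "\<And>s. 0 < s \<Longrightarrow> s < pi \<Longrightarrow> 0 < g s \<and> g s < pi"
    and "\<And>s. 0 < s \<Longrightarrow> s < pi \<Longrightarrow>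
      (g has_real_derivative 1 / (2 * (sin (g s))\<^sup>2)) (at s)"
proof -
  define G :: "real \<Rightarrow> real" where "G = (\<lambda>t. t - sin t * cos t)"
  have derG: "(G has_real_derivative 2 * (sin t)\<^sup>2) (at t)" for t
  proof -
    have "(G has_real_derivative 1 - (cos t * cos t - sin t * sin t)) (at t)"
      unfolding G_def by (auto intro!: derivative_eq_intros)
    moreover have "1 - (cos t * cos t - sin t * sin t) = 2 * (sin t)\<^sup>2"
      using sin_cos_squared_add[of t] by (simp add: power2_eq_square algebra_simps)
    ultimately show ?thesis by simp
  qed
  have contG: "isCont G t" for t using derG DERIV_isCont by blast
  have strict: "G a < G b" if "0 \<le> a" "a < b" "b \<le> pi" for a b
  proof (rule DERIV_pos_imp_increasing_open[OF \<open>a < b\<close>])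
    fix x assume "a < x" "x < b"
    then have "sin x > 0" using that by (intro sin_gt_zero) auto
    then show "\<exists>y. DERIV G x :> y \<and> y > 0" using derG[of x] by force
  qed (use contG continuous_at_imp_continuous_on in blast)
  have G0: "G 0 = 0" and Gpi: "G pi = pi" by (auto simp: G_def)
  define g where "g = (\<lambda>s. THE t. 0 < t \<and> t < pi \<and> G t = s)"
  have g: "0 < g s \<and> g s < pi \<and> G (g s) = s" if "0 < s" "s < pi" for s
  proof -
    have "\<exists>t\<ge>0. t \<le> pi \<and> G t = s"
      by (rule IVT) (use that G0 Gpi contG in auto)
    then obtain t where t: "0 \<le> t" "t \<le> pi" "G t = s" by auto
    then have "t \<noteq> 0" "t \<noteq> pi" using that G0 Gpi by auto
    then have t': "0 < t \<and> t < pi \<and> G t = s" using t by auto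
    have "t' = t" if "0 < t' \<and> t' < pi \<and> G t' = s" for t'
      using strict[of t t'] strict[of t' t] t' that by (cases t t' rule: linorder_cases) auto
    then have "\<exists>!t. 0 < t \<and> t < pi \<and> G t = s" using t' by blast
    from theI'[OF this] show ?thesis unfolding g_def .
  qed
  have gG: "g (G t) = t" if "0 < t" "t < pi" for t
  proof -
    have "0 < G t" "G t < pi" using strict[of 0 t] strict[of t pi] that G0 Gpi by auto
    from g[OF this] strict[of t "g (G t)"] strict[of "g (G t)" t] that show ?thesis
      by (cases t "g (G t)" rule: linorder_cases) auto
  qed
  have contg: "isCont g s" if "0 < s" "s < pi" for s
  proof -
    have "isCont g (G (g s))"
    proof (rule isCont_inverse_function2[of "g s / 2" "g s" "(g s + pi) / 2"])
      show "g (G z) = z" if "g s / 2 \<le> z" "z \<le> (g s + pi) / 2" for z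
        using that g[OF \<open>0 < s\<close> \<open>s < pi\<close>] by (intro gG) auto
    qed (use g[OF that] contG in auto)
    then show ?thesis using g[OF that] by simp
  qed
  have derg: "(g has_real_derivative 1 / (2 * (sin (g s))\<^sup>2)) (at s)" if s: "0 < s" "s < pi" for s
  proof -
    have "sin (g s) > 0" using g[OF s] by (intro sin_gt_zero) auto
    then have "(g has_real_derivative inverse (2 * (sin (g s))\<^sup>2)) (at s)"
    proof (intro DERIV_inverse_function[OF derG _ s])
      show "G (g y) = y" if "0 < y" "y < pi" for y using g[OF that] by simp
      show "isCont g s" by (rule contg[OF s])
    qed simp
    then show ?thesis by (simp only: inverse_eq_divide)
  qed
  show thesis
  proof (rule that)
    show "0 < g s \<and> g s < pi" if "0 < s" "s < pi" for s using g[OF that] by simp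
    show "(g has_real_derivative 1 / (2 * (sin (g s))\<^sup>2)) (at s)" if "0 < s" "s < pi" for s
      using derg[OF that] .
  qed
qed

lemma continuous_on_column:
  fixes f :: "real \<Rightarrow> real \<Rightarrow> real"
  assumes "continuous_on UNIV (\<lambda>(x, y). f x y)"
  shows "continuous_on A (f x)" and "continuous_on A (\<lambda>x. f x y)"
proof -
  have "continuous_on A (\<lambda>y. (x, y))" "continuous_on A (\<lambda>x. (x, y))"
    by (intro continuous_on_Pair continuous_on_const continuous_on_id)+
  then show "continuous_on A (f x)" "continuous_on A (\<lambda>x. f x y)"
    using continuous_on_compose2[OF assms, of A "\<lambda>y. (x, y)"]
      continuous_on_compose2[OF assms, of A "\<lambda>x. (x, y)"] by simp_all
qed

lemma continuous_on_column_integral: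
  fixes f :: "real \<Rightarrow> real \<Rightarrow> real"
  assumes "continuous_on UNIV (\<lambda>(x, y). f x y)"
  shows "continuous_on A (\<lambda>x. integral {a..b} (f x))"
  using integral_continuous_on_param[of A a b f] continuous_on_subset[OF assms] by auto

lemma column_integral_derivative:
  fixes f fx :: "real \<Rightarrow> real \<Rightarrow> real"
  assumes cf: "continuous_on UNIV (\<lambda>(x, y). f x y)" and cx: "continuous_on UNIV (\<lambda>(x, y). fx x y)"
    and d: "\<And>x y. ((\<lambda>x. f x y) has_real_derivative fx x y) (at x)"
  shows "((\<lambda>x. integral {a..b} (f x)) has_real_derivative integral {a..b} (fx x)) (at x)"
  using leibniz_rule_field_derivative[of UNIV a b f fx x]
    continuous_on_column(1)[OF cf] continuous_on_subset[OF cx] d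
  by (auto intro!: integrable_continuous_real)

text \<open>Integration by parts is used below only in this form, for a product that vanishes at both ends.\<close>

lemma integral_derivative_vanishing_ends:
  fixes f :: "real \<Rightarrow> real"
  assumes "a \<le> b" "\<And>x. x \<in> {a..b} \<Longrightarrow> (f has_real_derivative f' x) (at x within {a..b})"
    "f a = 0" "f b = 0"
  shows "(f' has_integral 0) {a..b}"
  using fundamental_theorem_of_calculus[of a b f f'] assms
  by (simp add: has_real_derivative_iff_has_vector_derivative)

text \<open>This is the part of the transport argument that happens on one vertical line. The transport map
  has first component \<open>t\<close> on this line, and \<open>b\<close> is half the length of the chord of the unit disc at
  abscissa \<open>t\<close>. Its second component \<open>T\<close> distributes the mass of \<open>v^2\<close> on the line
  uniformly over that chord. The hypothesis on \<open>t'\<close> makes \<open>c\<^sup>2 * v\<^sup>2\<close> the Jacobian of the map,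
  so the divergence of the map is at least \<open>2 * c * v\<close> by the inequality of the
  arithmetic and geometric means. An integration by parts along the line moves the second
  derivative to \<open>v\<close>, and since the map takes values in the disc, \<open>T * w + t * z\<close> is
  dominated by the length of the gradient. The term with \<open>t'\<close> is kept as it is: together with
  the one with \<open>t\<close> it is the derivative of a product in the other variable.\<close>

lemma knothe_column_estimate:
  fixes v w z :: "real \<Rightarrow> real" and R b t t' c r :: real
  assumes R: "R > 0" and cz: "continuous_on {-R..R} z" and cw: "continuous_on {-R..R} w"
    and dv: "\<And>y. y \<in> {-R..R} \<Longrightarrow> (v has_real_derivative w y) (at y within {-R..R})"
    and v0: "\<And>y. v y \<ge> 0" and ends: "v (-R) = 0" "v R = 0"
    and r: "r = integral {-R..R} (\<lambda>y. (v y)\<^sup>2)"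
    and tb: "t\<^sup>2 + b\<^sup>2 = 1" "b > 0" and c: "c \<ge> 0" and t': "2 * b * t' = c\<^sup>2 * r"
  shows "2 * c * r \<le> t' * integral {-R..R} v + t * integral {-R..R} z
            + integral {-R..R} (\<lambda>y. sqrt ((z y)\<^sup>2 + (w y)\<^sup>2))"
proof -
  have cv: "continuous_on {-R..R} v"
    using dv DERIV_continuous by (force simp: continuous_on_eq_continuous_within)
  have r0: "r \<ge> 0" unfolding r by (intro integral_nonneg integrable_continuous_real continuous_intros cv) simp
  have norm_integrable: "(\<lambda>y. sqrt ((z y)\<^sup>2 + (w y)\<^sup>2)) integrable_on {-R..R}"
    by (intro integrable_continuous_real continuous_intros cz cw)
  have t'0: "t' \<ge> 0"
  proof -
    have "0 \<le> (2 * b) * t'" using t' r0 by simp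
    then show ?thesis using tb(2) by (simp add: zero_le_mult_iff)
  qed
  \<comment> \<open>If the line carries no mass, any second component will do.\<close>
  define T where "T = (\<lambda>y. if r = 0 then 0 else b * (2 * integral {-R..y} (\<lambda>y. (v y)\<^sup>2) / r - 1))"
  define T' where "T' = (\<lambda>y. if r = 0 then 0 else 2 * b * (v y)\<^sup>2 / r)"
  have dT: "(T has_real_derivative T' y) (at y within {-R..R})" if "y \<in> {-R..R}" for y
    unfolding T_def T'_def
    by (cases "r = 0")
      (auto intro!: derivative_eq_intros integral_has_real_derivative[OF _ that] continuous_intros cv)
  have cT: "continuous_on {-R..R} T"
    using dT DERIV_continuous by (force simp: continuous_on_eq_continuous_within)
  have cT': "continuous_on {-R..R} T'"
    unfolding T'_def by (cases "r = 0") (simp_all, intro continuous_intros cv, simp)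
  have Tb: "(T y)\<^sup>2 \<le> b\<^sup>2" if "y \<in> {-R..R}" for y
  proof (cases "r = 0")
    case False
    have int: "(\<lambda>y. (v y)\<^sup>2) integrable_on {-R..R}" by (intro integrable_continuous_real continuous_intros cv)
    have "(\<lambda>y. (v y)\<^sup>2) integrable_on {-R..y}" using int that by (rule_tac integrable_subinterval_real) auto
    then have 1: "0 \<le> integral {-R..y} (\<lambda>y. (v y)\<^sup>2)" by (rule integral_nonneg) auto
    have 2: "integral {-R..y} (\<lambda>y. (v y)\<^sup>2) \<le> r"
      unfolding r using that int \<open>_ integrable_on {-R..y}\<close> by (intro integral_subset_le) auto
    have "\<bar>2 * integral {-R..y} (\<lambda>y. (v y)\<^sup>2) / r - 1\<bar> \<le> 1"
      using 1 2 r0 False by (auto simp: abs_le_iff field_simps)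
    then have "\<bar>T y\<bar> \<le> b * 1" unfolding T_def using False tb(2) by (simp add: abs_mult)
    then show ?thesis by (metis abs_le_square_iff mult.right_neutral abs_of_pos tb(2))
  qed (simp add: T_def)
  have "((\<lambda>y. w y * T y + v y * T' y) has_integral 0) {-R..R}"
    by (rule integral_derivative_vanishing_ends[where f = "\<lambda>y. v y * T y"])
      (use R ends in \<open>auto intro!: derivative_eq_intros dv dT\<close>)
  moreover have "((\<lambda>y. 2 * c * (v y)\<^sup>2 - t' * v y - t * z y - sqrt ((z y)\<^sup>2 + (w y)\<^sup>2)) has_integral
      (2 * c * r - t' * integral {-R..R} v - t * integral {-R..R} z
         - integral {-R..R} (\<lambda>y. sqrt ((z y)\<^sup>2 + (w y)\<^sup>2)))) {-R..R}"
    unfolding r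
    by (intro has_integral_diff has_integral_mult_right integrable_integral norm_integrable
        integrable_continuous_real continuous_intros cv cz cw)
  moreover have "2 * c * (v y)\<^sup>2 - t' * v y - t * z y - sqrt ((z y)\<^sup>2 + (w y)\<^sup>2) \<le> w y * T y + v y * T' y"
    if y: "y \<in> {-R..R}" and rpos: "r > 0" for y
  proof -
    \<comment> \<open>The arithmetic-geometric mean inequality for the two diagonal entries of the differential.\<close>
    have prod: "t' * T' y = (c * v y)\<^sup>2"
      using t' rpos unfolding T'_def by (auto simp: field_simps power_mult_distrib)

    have T'0: "T' y \<ge> 0" using tb(2) rpos by (simp add: T'_def)
    have "(2 * (c * v y))\<^sup>2 \<le> (t' + T' y)\<^sup>2"
      using prod zero_le_power2[of "t' - T' y"] by (simp add: power2_eq_square algebra_simps)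
    then have "2 * (c * v y) \<le> t' + T' y" by (rule power2_le_imp_le) (use t'0 T'0 in simp)
    then have "(2 * (c * v y)) * v y \<le> (t' + T' y) * v y" by (rule mult_right_mono) (rule v0)
    moreover have "- (t * z y + T y * w y) \<le> sqrt ((z y)\<^sup>2 + (w y)\<^sup>2)"
    proof -
      have "(t * z y + T y * w y)\<^sup>2 \<le> (t\<^sup>2 + (T y)\<^sup>2) * ((z y)\<^sup>2 + (w y)\<^sup>2)"
        using zero_le_power2[of "t * w y - T y * z y"] by (simp add: power2_eq_square algebra_simps)
      also have "\<dots> \<le> 1 * ((z y)\<^sup>2 + (w y)\<^sup>2)"
        using Tb[OF y] tb(1) by (intro mult_right_mono) auto
      finally have "\<bar>t * z y + T y * w y\<bar> \<le> sqrt ((z y)\<^sup>2 + (w y)\<^sup>2)"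
        using real_le_rsqrt by auto
      then show ?thesis by linarith
    qed
    ultimately show ?thesis by (simp add: power2_eq_square algebra_simps)
  qed
  ultimately have "2 * c * r - t' * integral {-R..R} v - t * integral {-R..R} z
         - integral {-R..R} (\<lambda>y. sqrt ((z y)\<^sup>2 + (w y)\<^sup>2)) \<le> 0" if "r > 0"
    using that by (blast intro: has_integral_le)
  moreover have ?thesis if "r = 0"
  proof -
    have "t' = 0" using t' that tb(2) by auto
    have "\<bar>t\<bar> \<le> 1" using tb(1) zero_le_power2[of b] by (subst abs_square_le_1[symmetric]) linarith
    have "integral {-R..R} (\<lambda>y. - (t * z y)) \<le> integral {-R..R} (\<lambda>y. sqrt ((z y)\<^sup>2 + (w y)\<^sup>2))"
    proof (rule integral_le)
      fix y
      have "\<bar>t * z y\<bar> \<le> 1 * \<bar>z y\<bar>" unfolding abs_mult by (rule mult_right_mono) (use \<open>\<bar>t\<bar> \<le> 1\<close> in auto)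
      also have "\<dots> \<le> sqrt ((z y)\<^sup>2 + (w y)\<^sup>2)" by simp
      finally show "- (t * z y) \<le> sqrt ((z y)\<^sup>2 + (w y)\<^sup>2)" by linarith
    qed (intro norm_integrable integrable_continuous_real continuous_intros cz)+
    then show ?thesis using that \<open>t' = 0\<close> by simp
  qed
  ultimately show ?thesis using r0 by fastforce
qed

text \<open>The constant is optimal (discs give equality in the limit). Instead of the isoperimetric inequality
  one transports the density proportional to \<open>v^2\<close> to the uniform density of the unit disc by
  Knothe's map, whose first component depends on \<open>x\<close> only. It is given by comparing the mass to the
  left of \<open>x\<close> with the area that a chord cuts off. At the two extreme chords this map is not
  differentiable, so only the fraction \<open>1 - 2 * e\<close> of the disc between two chords is used as a target,
  and \<open>e\<close> tends to \<open>0\<close> at the end.\<close>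

theorem sharp_sobolev_plane:
  fixes v vx vy :: "real \<Rightarrow> real \<Rightarrow> real" and R :: real
  assumes R: "R > 0"
    and cv: "continuous_on UNIV (\<lambda>(x, y). v x y)"
    and cvx: "continuous_on UNIV (\<lambda>(x, y). vx x y)"
    and cvy: "continuous_on UNIV (\<lambda>(x, y). vy x y)"
    and dx: "\<And>x y. ((\<lambda>x. v x y) has_real_derivative vx x y) (at x)"
    and dy: "\<And>x y. (v x has_real_derivative vy x y) (at y)"
    and v0: "\<And>x y. v x y \<ge> 0"
    and supp: "\<And>x y. \<not> (\<bar>x\<bar> < R \<and> \<bar>y\<bar> < R) \<Longrightarrow> v x y = 0"
  shows "2 * sqrt pi * sqrt (integral {-R..R} (\<lambda>x. integral {-R..R} (\<lambda>y. (v x y)\<^sup>2)))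
     \<le> integral {-R..R} (\<lambda>x. integral {-R..R} (\<lambda>y. sqrt ((vx x y)\<^sup>2 + (vy x y)\<^sup>2)))"
    (is "2 * sqrt pi * sqrt ?m \<le> ?I")
proof -
  define q where "q = (\<lambda>x. integral {-R..R} (\<lambda>y. (v x y)\<^sup>2))"
  define m where "m = ?m"
  have cv2: "continuous_on UNIV (\<lambda>(x, y). (v x y)\<^sup>2)"
    using continuous_on_power[OF cv, of 2] by (simp add: case_prod_beta')
  have cn: "continuous_on UNIV (\<lambda>(x, y). sqrt ((vx x y)\<^sup>2 + (vy x y)\<^sup>2))"
    using continuous_on_real_sqrt[OF continuous_on_add[OF continuous_on_power[OF cvx, of 2] continuous_on_power[OF cvy, of 2]]]
    by (simp add: case_prod_beta')
  have cq: "continuous_on A q" for A unfolding q_def by (rule continuous_on_column_integral[OF cv2])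
  have q0: "q x \<ge> 0" for x unfolding q_def
    by (rule integral_nonneg) (auto intro!: integrable_continuous_real continuous_on_column(1)[OF cv2])
  have m: "m = integral {-R..R} q" by (simp add: m_def q_def)
  have m0: "m \<ge> 0" unfolding m by (rule integral_nonneg) (auto intro!: integrable_continuous_real cq q0)
  have I0: "?I \<ge> 0"
    by (rule integral_nonneg)
      (auto intro!: integrable_continuous_real continuous_on_column_integral[OF cn] integral_nonneg
        continuous_on_column(1)[OF cn])
  have main: "2 * sqrt (pi * (1 - 2 * e) / m) * m \<le> ?I" if mpos: "m > 0" and e: "0 < e" "e < 1/2" for e
  proof -
    obtain g where g: "\<And>s. 0 < s \<Longrightarrow> s < pi \<Longrightarrow> 0 < g s \<and> g s < pi"
      and dg: "\<And>s. 0 < s \<Longrightarrow> s < pi \<Longrightarrow> (g has_real_derivative 1 / (2 * (sin (g s))\<^sup>2)) (at s)"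
      by (rule disc_slice_angle) (rule that)
    define c where "c = sqrt (pi * (1 - 2 * e) / m)"
    define s where "s = (\<lambda>x. pi * ((1 - 2 * e) * integral {-R..x} q / m + e))"
    define b where "b = (\<lambda>x. sin (g (s x)))"
    define T where "T = (\<lambda>x. - cos (g (s x)))"
    define T' where "T' = (\<lambda>x. c\<^sup>2 * q x / (2 * b x))"
    have c2: "c\<^sup>2 = pi * (1 - 2 * e) / m" unfolding c_def using e mpos by simp
    have ds: "(s has_real_derivative c\<^sup>2 * q x) (at x within {-R..R})" if "x \<in> {-R..R}" for x
      unfolding s_def c2 using mpos
      by (auto intro!: derivative_eq_intros integral_has_real_derivative[OF _ that] cq)
    have s: "0 < s x \<and> s x < pi" if "x \<in> {-R..R}" for x
    proof -
      have "q integrable_on {-R..R}" "q integrable_on {-R..x}" by (auto intro!: integrable_continuous_real cq)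
      then have "0 \<le> integral {-R..x} q" "integral {-R..x} q \<le> m"
        unfolding m using that q0 by (auto intro!: integral_nonneg integral_subset_le)
      moreover define k where "k = integral {-R..x} q / m"
      ultimately have "0 \<le> k" "k \<le> 1" using mpos by auto
      then have "0 \<le> (1 - 2 * e) * k" "(1 - 2 * e) * k \<le> 1 - 2 * e"
        using e mult_left_mono[of k 1 "1 - 2 * e"] by simp_all
      moreover define p where "p = (1 - 2 * e) * k"
      ultimately have "0 < (1 - 2 * e) * k + e" "(1 - 2 * e) * k + e < 1"
        using e unfolding p_def[symmetric] by linarith+
      moreover have "s x = pi * ((1 - 2 * e) * k + e)" by (simp add: s_def k_def)
      ultimately show ?thesis using pi_gt_zero by (simp add: mult_less_cancel_left2 not_le del: pi_gt_zero)
    qed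
    have b: "b x > 0" if "x \<in> {-R..R}" for x
      unfolding b_def using g s[OF that] by (intro sin_gt_zero) auto
    have dT: "(T has_real_derivative T' x) (at x within {-R..R})" if "x \<in> {-R..R}" for x
    proof -
      have "((\<lambda>x. g (s x)) has_real_derivative 1 / (2 * (sin (g (s x)))\<^sup>2) * (c\<^sup>2 * q x)) (at x within {-R..R})"
        by (rule DERIV_chain2[OF dg ds[OF that]]) (use s[OF that] in auto)
      then have "(T has_real_derivative - (- sin (g (s x)) * (1 / (2 * (sin (g (s x)))\<^sup>2) * (c\<^sup>2 * q x)))) (at x within {-R..R})"
        unfolding T_def by (intro DERIV_minus DERIV_chain2[OF DERIV_cos])
      moreover have "- (- sin (g (s x)) * (1 / (2 * (sin (g (s x)))\<^sup>2) * (c\<^sup>2 * q x))) = T' x"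
        using b[OF that] unfolding T'_def b_def by (simp add: power2_eq_square field_simps)
      ultimately show ?thesis by simp
    qed
    define V where "V = (\<lambda>x. integral {-R..R} (v x))"
    define V' where "V' = (\<lambda>x. integral {-R..R} (vx x))"
    have dV: "(V has_real_derivative V' x) (at x within {-R..R})" for x
      unfolding V_def V'_def
      by (rule has_field_derivative_at_within[OF column_integral_derivative[OF cv cvx dx]])
    have column: "2 * c * q x \<le> (T' x * V x + V' x * T x) + integral {-R..R} (\<lambda>y. sqrt ((vx x y)\<^sup>2 + (vy x y)\<^sup>2))"
      if "x \<in> {-R..R}" for x
    proof -
      have "2 * c * q x \<le> T' x * integral {-R..R} (v x) + T x * integral {-R..R} (vx x)
            + integral {-R..R} (\<lambda>y. sqrt ((vx x y)\<^sup>2 + (vy x y)\<^sup>2))"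
        by (rule knothe_column_estimate[where b = "b x"])
          (use R b[OF that] e mpos in \<open>auto intro!: continuous_on_column(1)[OF cvx] continuous_on_column(1)[OF cvy]
             has_field_derivative_at_within[OF dy] v0 supp simp: q_def T_def b_def T'_def c_def\<close>)
      then show ?thesis by (simp add: V_def V'_def mult.commute)
    qed
    have "v (-R) = (\<lambda>_. 0)" "v R = (\<lambda>_. 0)" using R by (auto simp: fun_eq_iff supp)
    then have Vends: "V (-R) = 0" "V R = 0" by (simp_all add: V_def)
    have i0: "((\<lambda>x. T' x * V x + V' x * T x) has_integral 0) {-R..R}"
      by (rule integral_derivative_vanishing_ends[where f = "\<lambda>x. T x * V x"])
        (use R Vends in \<open>auto intro!: derivative_eq_intros dT dV\<close>)
    have "((\<lambda>x. 2 * c * q x) has_integral 2 * c * m) {-R..R}"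
      unfolding m by (intro has_integral_mult_right integrable_integral integrable_continuous_real cq)
    moreover have "((\<lambda>x. (T' x * V x + V' x * T x) + integral {-R..R} (\<lambda>y. sqrt ((vx x y)\<^sup>2 + (vy x y)\<^sup>2)))
        has_integral 0 + ?I) {-R..R}"
      by (intro has_integral_add i0 integrable_integral integrable_continuous_real continuous_on_column_integral[OF cn])
    ultimately have "2 * c * m \<le> 0 + ?I" using column by (rule has_integral_le)
    then show ?thesis by (simp add: c_def)
  qed
  show ?thesis
  proof (cases "m > 0")
    case True
    have "z * (4 * pi * m) \<le> ?I\<^sup>2" if z: "0 < z" "z < 1" for z
    proof -
      have "1 - 2 * ((1 - z) / 2) = z" by (simp add: field_simps)
      then have "2 * sqrt (pi * z / m) * m \<le> ?I" using main[OF True, of "(1 - z) / 2"] z by simp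
      then have "(2 * sqrt (pi * z / m) * m)\<^sup>2 \<le> ?I\<^sup>2" using True by (intro power_mono) (use z in auto)
      moreover have "(2 * sqrt (pi * z / m) * m)\<^sup>2 = z * (4 * pi * m)"
        using True z by (simp add: power_mult_distrib) (simp add: power2_eq_square)
      ultimately show ?thesis by simp
    qed
    then have "4 * pi * m \<le> ?I\<^sup>2" by (rule field_le_mult_one_interval)
    then have "sqrt (4 * pi * m) \<le> ?I" using I0 real_le_lsqrt True by auto
    then show ?thesis by (simp add: real_sqrt_mult m_def)
  next
    case False
    then have "m = 0" using m0 by simp
    then show ?thesis using I0 by (simp add: m_def)
  qed
qed

section \<open>Area of the slices of a graph of bounded mean curvature\<close>

text \<open>The divergence theorem for a vector field of compact support: one of the two derivatives
  integrates to \<open>0\<close> over each line, the other one after exchanging derivative and integral.\<close>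

lemma integral_divergence_eq_0:
  fixes f fx h hy :: "real \<Rightarrow> real \<Rightarrow> real" and R :: real
  assumes R: "R > 0"
    and cf: "continuous_on UNIV (\<lambda>(x, y). f x y)"
    and cfx: "continuous_on UNIV (\<lambda>(x, y). fx x y)"
    and chy: "continuous_on UNIV (\<lambda>(x, y). hy x y)"
    and dx: "\<And>x y. ((\<lambda>x. f x y) has_real_derivative fx x y) (at x)"
    and dy: "\<And>x y. (h x has_real_derivative hy x y) (at y)"
    and supp: "\<And>x y. \<not> (\<bar>x\<bar> < R \<and> \<bar>y\<bar> < R) \<Longrightarrow> f x y = 0 \<and> h x y = 0"
  shows "integral {-R..R} (\<lambda>x. integral {-R..R} (\<lambda>y. fx x y + hy x y)) = 0"
proof -
  have 1: "integral {-R..R} (hy x) = 0" for x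
    by (rule integral_unique, rule integral_derivative_vanishing_ends[where f = "h x"])
      (use R supp in \<open>auto intro!: has_field_derivative_at_within[OF dy]\<close>)
  have "integral {-R..R} (\<lambda>y. fx x y + hy x y) = integral {-R..R} (fx x)" for x
    using 1[of x] by (subst integral_add)
      (auto intro!: integrable_continuous_real continuous_on_column(1)[OF cfx] continuous_on_column(1)[OF chy])
  moreover have "f (-R) = (\<lambda>_. 0)" "f R = (\<lambda>_. 0)" using R by (auto simp: fun_eq_iff supp)
  then have "((\<lambda>x. integral {-R..R} (fx x)) has_integral 0) {-R..R}"
    using R by (intro integral_derivative_vanishing_ends[where f = "\<lambda>x. integral {-R..R} (f x)"]
        has_field_derivative_at_within[OF column_integral_derivative[OF cf cfx dx]]) auto
  then have "integral {-R..R} (\<lambda>x. integral {-R..R} (fx x)) = 0"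
    by (rule integral_unique)
  ultimately show ?thesis by simp
qed

definition zero_ext :: "'a set \<Rightarrow> ('a \<Rightarrow> real) \<Rightarrow> 'a \<Rightarrow> real" where
  "zero_ext D F p = (if p \<in> D then F p else 0)"

lemma continuous_zero_ext:
  fixes F :: "'a::t2_space \<Rightarrow> real"
  assumes "open D" "compact C" "C \<subseteq> D" "continuous_on D F" "\<And>p. p \<in> D - C \<Longrightarrow> F p = 0"
  shows "continuous_on UNIV (zero_ext D F)"
proof -
  have "continuous_on (D \<union> (- C)) (zero_ext D F)"
  proof (rule continuous_on_open_Un)
    show "continuous_on D (zero_ext D F)"
      using assms(4) by (rule continuous_on_eq) (simp add: zero_ext_def)
    show "continuous_on (- C) (zero_ext D F)"
      using continuous_on_const[of "- C" 0] by (rule continuous_on_eq) (use assms(5) in \<open>auto simp: zero_ext_def\<close>)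
  qed (use assms compact_imp_closed in auto)
  moreover have "D \<union> (- C) = UNIV" using assms by auto
  ultimately show ?thesis by simp
qed

lemma deriv_zero_ext:
  fixes F F' :: "'a::t2_space \<Rightarrow> real" and l :: "real \<Rightarrow> 'a"
  assumes "open D" "compact C" "C \<subseteq> D" "\<And>p. p \<in> D - C \<Longrightarrow> F p = 0"
    and l: "continuous_on UNIV l"
    and d: "\<And>x. l x \<in> D \<Longrightarrow> ((\<lambda>x. F (l x)) has_real_derivative F' (l x)) (at x)"
  shows "((\<lambda>x. zero_ext D F (l x)) has_real_derivative zero_ext D F' (l x)) (at x)"
proof (cases "l x \<in> D")
  case True
  have "((\<lambda>x. zero_ext D F (l x)) has_real_derivative F' (l x)) (at x)"
    by (rule has_field_derivative_transform_within_open[OF d[OF True] open_vimage[OF \<open>open D\<close> l]])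
      (use True in \<open>auto simp: zero_ext_def\<close>)
  then show ?thesis using True by (simp add: zero_ext_def)
next
  case False
  have "open (l -` (- C))" by (rule open_vimage[OF open_Compl[OF compact_imp_closed[OF \<open>compact C\<close>]] l])
  then have "((\<lambda>x. zero_ext D F (l x)) has_real_derivative 0) (at x)"
    by (rule has_field_derivative_transform_within_open[OF DERIV_const[of 0]])
      (use False assms in \<open>auto simp: zero_ext_def\<close>)
  then show ?thesis using False by (simp add: zero_ext_def)
qed

lemma iterated_integral_eq_lborel:
  fixes F :: "real \<times> real \<Rightarrow> real"
  assumes c: "continuous_on UNIV F" and supp: "\<And>x y. \<not> (\<bar>x\<bar> < R \<and> \<bar>y\<bar> < R) \<Longrightarrow> F (x, y) = 0"
  shows "integrable lborel F"
    and "integral {-R..R} (\<lambda>x. integral {-R..R} (\<lambda>y. F (x, y))) = (\<integral>p. F p \<partial>lborel)"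
proof -
  let ?B = "cbox (-R, -R) (R, R)"
  have F: "(\<lambda>p. indicator ?B p *\<^sub>R F p) = F"
  proof
    fix p show "indicator ?B p *\<^sub>R F p = F p"
    proof (cases "\<bar>fst p\<bar> < R \<and> \<bar>snd p\<bar> < R")
      case True
      then have "p \<in> ?B" by (cases p) (auto simp: cbox_Pair_eq)
      then show ?thesis by simp
    next
      case False
      then show ?thesis using supp[of "fst p" "snd p"] by simp
    qed
  qed
  have si: "set_integrable lborel ?B F"
    unfolding set_integrable_def by (rule borel_integrable_compact) (auto intro: continuous_on_subset[OF c])
  then show "integrable lborel F" unfolding set_integrable_def F .
  have "(\<integral>p. F p \<partial>lborel) = integral ?B F"
    using set_borel_integral_eq_integral(2)[OF si] unfolding set_lebesgue_integral_def F .
  also have "\<dots> = integral {-R..R} (\<lambda>x. integral {-R..R} (\<lambda>y. F (x, y)))"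
    using integral_prod_continuous[of "-R" "-R" R R F] continuous_on_subset[OF c] by simp
  finally show "integral {-R..R} (\<lambda>x. integral {-R..R} (\<lambda>y. F (x, y))) = (\<integral>p. F p \<partial>lborel)" by simp
qed

text \<open>The primitives of the cutoff functions of a slice are the truncations of the height that serve as
  test functions. A primitive starting at \<open>0\<close> is constant off the slice and rises by almost \<open>b - a\<close>
  in it.\<close>

lemma primitive_of_slice_cutoff:
  fixes g P :: "real \<Rightarrow> real"
  assumes cg: "continuous_on UNIV g" and g01: "\<And>t. 0 \<le> g t \<and> g t \<le> 1"
    and supp: "\<And>t. \<not> (a < t \<and> t < b) \<Longrightarrow> g t = 0" and ab: "0 < a" "a < b"
    and P_def: "P = (\<lambda>t. integral {0..t} g)"
  shows "\<And>t. t > 0 \<Longrightarrow> (P has_real_derivative g t) (at t)"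
    and "\<And>t. t \<le> a \<Longrightarrow> P t = 0" and "\<And>t. 0 \<le> P t" and "\<And>t. P t \<le> b - a"
    and "\<And>t c d. \<lbrakk>a \<le> c; c \<le> d; d \<le> b; b \<le> t; \<And>s. c \<le> s \<Longrightarrow> s \<le> d \<Longrightarrow> g s = 1\<rbrakk> \<Longrightarrow> d - c \<le> P t"
proof -
  have int: "g integrable_on {c..d}" for c d
    by (rule integrable_continuous_real) (rule continuous_on_subset[OF cg], simp)
  show "(P has_real_derivative g t) (at t)" if "t > 0" for t
  proof -
    have "(P has_real_derivative g t) (at t within {0..t+1})"
      unfolding P_def by (rule integral_has_real_derivative) (use that in \<open>auto intro: continuous_on_subset[OF cg]\<close>)
    moreover have "at t within {0..t+1} = at t"
      by (rule at_within_interior) (use that in simp)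
    ultimately show ?thesis by simp
  qed
  show P0: "P t = 0" if "t \<le> a" for t
    unfolding P_def by (subst integral_cong[of _ g "\<lambda>_. 0"]) (use supp that in auto)
  show "0 \<le> P t" for t
    unfolding P_def by (rule integral_nonneg[OF int]) (use g01 in auto)
  have nb: "P t = integral {a..b} (\<lambda>s. if s \<le> t then g s else 0)" if "t \<ge> 0" for t
  proof -
    have "P t = integral UNIV (\<lambda>s. if s \<in> {0..t} then g s else 0)"
      unfolding P_def by (rule integral_restrict_UNIV[symmetric])
    also have "\<dots> = integral UNIV (\<lambda>s. if s \<in> {a..b} then (if s \<le> t then g s else 0) else 0)"
      by (rule integral_cong) (use supp ab in auto)
    also have "\<dots> = integral {a..b} (\<lambda>s. if s \<le> t then g s else 0)"
      by (rule integral_restrict_UNIV)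
    finally show ?thesis .
  qed
  show "P t \<le> b - a" for t
  proof (cases "t \<le> a")
    case True then show ?thesis using P0 ab by simp
  next
    case False
    then have "P t = integral {0..a} g + integral {a..t} g"
      unfolding P_def using ab by (intro Henstock_Kurzweil_Integration.integral_combine[symmetric] int) auto
    also have "\<dots> = integral {a..t} g" using P0[of a] by (simp add: P_def)
    also have "\<dots> \<le> integral {a..max t b} g"
      by (rule integral_subset_le) (use int g01 in auto)
    also have "\<dots> = integral {a..b} g + integral {b..max t b} g"
      using ab by (intro Henstock_Kurzweil_Integration.integral_combine[symmetric] int) auto
    also have "integral {b..max t b} g = 0"
      by (subst integral_cong[of _ g "\<lambda>_. 0"]) (use supp in auto)
    also have "integral {a..b} g \<le> integral {a..b} (\<lambda>_. 1)"
      by (rule integral_le) (use int g01 in auto)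
    finally show ?thesis using ab by simp
  qed
  show "d - c \<le> P t" if "a \<le> c" "c \<le> d" "d \<le> b" "b \<le> t" and 1: "\<And>s. c \<le> s \<Longrightarrow> s \<le> d \<Longrightarrow> g s = 1" for t c d
  proof -
    have "d - c = integral {c..d} (\<lambda>_. 1::real)" using that by simp
    also have "\<dots> = integral {c..d} g" by (rule integral_cong) (use 1 in auto)
    also have "\<dots> \<le> P t" unfolding P_def by (rule integral_subset_le) (use int g01 that ab in auto)
    finally show ?thesis .
  qed
qed

lemma trapezoid_cutoff:
  fixes a b e :: real
  assumes "0 < e"
  obtains g :: "real \<Rightarrow> real" where "continuous_on UNIV g" "\<And>t. 0 \<le> g t \<and> g t \<le> 1"
    "\<And>t. \<not> (a < t \<and> t < b) \<Longrightarrow> g t = 0" "\<And>t. a + e \<le> t \<Longrightarrow> t \<le> b - e \<Longrightarrow> g t = 1"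
proof
  let ?g = "\<lambda>t. max 0 (min 1 (min (t - a) (b - t) / e))"
  show "continuous_on UNIV ?g" using assms by (intro continuous_intros) auto
  show "0 \<le> ?g t \<and> ?g t \<le> 1" for t by auto
  show "?g t = 0" if "\<not> (a < t \<and> t < b)" for t
  proof -
    have "min (t - a) (b - t) / e \<le> 0" using that assms by (intro divide_nonpos_pos) auto
    then show ?thesis by linarith
  qed
  show "?g t = 1" if "a + e \<le> t" "t \<le> b - e" for t
  proof -
    have "1 \<le> min (t - a) (b - t) / e" using that assms by (auto simp: field_simps)
    then show ?thesis by linarith
  qed
qed

text \<open>The graph of \<open>u\<close> over \<open>D\<close>, cut off by the plane at height \<open>0\<close>: \<open>Z1 + Z2\<close> is the divergence of
  \<open>Du / W\<close>, that is twice the mean curvature up to sign. The compactness of the superlevel sets takes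
  the place of the boundary condition \<open>u = 0\<close>.\<close>

locale mean_curvature_graph =
  fixes D :: "(real \<times> real) set" and u ux uy W Z1 Z2 :: "real \<times> real \<Rightarrow> real" and K :: real
  assumes D: "open D"
    and du1: "\<And>x y. (x, y) \<in> D \<Longrightarrow> ((\<lambda>x. u (x, y)) has_real_derivative ux (x, y)) (at x)"
    and du2: "\<And>x y. (x, y) \<in> D \<Longrightarrow> ((\<lambda>y. u (x, y)) has_real_derivative uy (x, y)) (at y)"
    and cu: "continuous_on D u" and cux: "continuous_on D ux" and cuy: "continuous_on D uy"
    and W: "W = (\<lambda>p. sqrt (1 + (ux p)\<^sup>2 + (uy p)\<^sup>2))"
    and dz1: "\<And>x y. (x, y) \<in> D \<Longrightarrow> ((\<lambda>x. ux (x, y) / W (x, y)) has_real_derivative Z1 (x, y)) (at x)"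
    and dz2: "\<And>x y. (x, y) \<in> D \<Longrightarrow> ((\<lambda>y. uy (x, y) / W (x, y)) has_real_derivative Z2 (x, y)) (at y)"
    and cz1: "continuous_on D Z1" and cz2: "continuous_on D Z2"
    and K: "K > 0" and Z: "\<And>p. p \<in> D \<Longrightarrow> \<bar>Z1 p + Z2 p\<bar> \<le> 2 * K"
    and u0: "\<And>p. p \<in> D \<Longrightarrow> u p > 0"
    and cpt: "\<And>t. t > 0 \<Longrightarrow> compact {p \<in> D. t \<le> u p}"
begin

lemma W1: "W p \<ge> 1" and W2: "(W p)\<^sup>2 = 1 + (ux p)\<^sup>2 + (uy p)\<^sup>2" and cW: "continuous_on D W"
  unfolding W by (auto intro!: continuous_intros cux cuy)

lemma slice_in_borel: "{p \<in> D. a < u p \<and> u p < b} \<in> sets borel"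
proof -
  have "openin (top_of_set D) (D \<inter> u -` {a<..<b})"
    by (rule continuous_openin_preimage_gen[OF cu]) simp
  then have "open (D \<inter> u -` {a<..<b})" using D openin_open_trans by blast
  moreover have "D \<inter> u -` {a<..<b} = {p \<in> D. a < u p \<and> u p < b}" by auto
  ultimately show ?thesis by simp
qed

lemma slice_integrable:
  assumes "a > 0"
  shows "integrable lborel (\<lambda>p. indicator {p \<in> D. a < u p \<and> u p < b} p * W p)"
proof -
  let ?C = "{p \<in> D. a \<le> u p}"
  have 1: "integrable lborel (\<lambda>p. indicator ?C p *\<^sub>R W p)"
    by (rule borel_integrable_compact[OF cpt[OF assms]]) (rule continuous_on_subset[OF cW], auto)
  have "integrable lborel (\<lambda>p. indicator {p \<in> D. a < u p \<and> u p < b} p *\<^sub>R (indicator ?C p *\<^sub>R W p))"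
    by (rule integrable_mult_indicator[OF _ 1]) (use slice_in_borel in simp)
  moreover have "(\<lambda>p. indicator {p \<in> D. a < u p \<and> u p < b} p *\<^sub>R (indicator ?C p *\<^sub>R W p))
     = (\<lambda>p. indicator {p \<in> D. a < u p \<and> u p < b} p * W p)"
    by (auto simp: fun_eq_iff indicator_def)
  ultimately show ?thesis by simp
qed

definition slice_area :: "real \<Rightarrow> real \<Rightarrow> real" where
  "slice_area a b = (\<integral>p. indicator {p \<in> D. a < u p \<and> u p < b} p * W p \<partial>lborel)"

definition level_measure :: "real \<Rightarrow> real" where
  "level_measure t = measure lborel {p \<in> D. t \<le> u p}"

lemma superlevel_finite: "t > 0 \<Longrightarrow> emeasure lborel {p \<in> D. t \<le> u p} < \<infinity>"
  by (rule emeasure_bounded_finite[OF compact_imp_bounded[OF cpt]])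

text \<open>Here \<open>v = P(u)\<close> and \<open>S(u)\<close> are truncations of \<open>u\<close> with \<open>P' = g\<close> and \<open>S' = g^2\<close> for a cutoff function
  \<open>g\<close> of the slice. The pointwise inequality \<open>W \<ge> 2 * s * (g * |Du|) - s^2 * g^2 * |Du|^2 / W\<close> on
  the slice is integrated. The first term contains the length of the gradient of \<open>v\<close> and falls under the
  Sobolev inequality, with \<open>v \<ge> b - a - 2 * e\<close> above the slice. The second one differs from the divergence of
  \<open>S(u) Du / W\<close>, which integrates to \<open>0\<close>, by \<open>S(u)\<close> times the mean curvature, and \<open>S(u) \<le> b - a\<close>
  lives on \<open>{u \<ge> a}\<close>.\<close>

lemma slice_area_cutoff_bound:
  assumes ab: "0 < a" "a < b" and s: "s \<ge> 0" and e: "0 < e" "2 * e < b - a"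
  shows "4 * s * sqrt pi * (b - a - 2 * e) * sqrt (level_measure b)
     - 2 * s\<^sup>2 * K * (b - a) * level_measure a \<le> slice_area a b"
proof -
  obtain g :: "real \<Rightarrow> real" where cg: "continuous_on UNIV g" and g01: "\<And>t. 0 \<le> g t \<and> g t \<le> 1"
    and g0: "\<And>t. \<not> (a < t \<and> t < b) \<Longrightarrow> g t = 0" and g1: "\<And>t. a + e \<le> t \<Longrightarrow> t \<le> b - e \<Longrightarrow> g t = 1"
    by (rule trapezoid_cutoff[OF e(1)]) (rule that)
  define P where "P = (\<lambda>t. integral {0..t} g)"
  define S where "S = (\<lambda>t. integral {0..t} (\<lambda>t. (g t)\<^sup>2))"
  have cg2: "continuous_on UNIV (\<lambda>t. (g t)\<^sup>2)" by (intro continuous_intros cg)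
  have g201: "0 \<le> (g t)\<^sup>2 \<and> (g t)\<^sup>2 \<le> 1" for t using g01[of t] by (simp add: power_le_one)
  have g20: "\<not> (a < t \<and> t < b) \<Longrightarrow> (g t)\<^sup>2 = 0" for t using g0[of t] by simp
  note P = primitive_of_slice_cutoff[OF cg g01 g0 ab P_def]
  note S = primitive_of_slice_cutoff[OF cg2 g201 g20 ab S_def]
  let ?C = "{p \<in> D. a \<le> u p}"
  note C = cpt[OF ab(1)]
  have CD: "?C \<subseteq> D" by auto
  obtain R where R: "R > 0" "?C \<subseteq> {p. \<bar>fst p\<bar> < R \<and> \<bar>snd p\<bar> < R}"
  proof -
    from compact_imp_bounded[OF C, unfolded bounded_iff] obtain r where r: "\<forall>p\<in>?C. norm p \<le> r" ..
    have "\<bar>fst p\<bar> < \<bar>r\<bar> + 1 \<and> \<bar>snd p\<bar> < \<bar>r\<bar> + 1" if "p \<in> ?C" for p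
      using bspec[OF r that] norm_fst_le[of "fst p" "snd p"] norm_snd_le[of "snd p" "fst p"] by (simp del: split_paired_All)
    then have "?C \<subseteq> {p. \<bar>fst p\<bar> < \<bar>r\<bar> + 1 \<and> \<bar>snd p\<bar> < \<bar>r\<bar> + 1}" by blast
    then show ?thesis by (intro that[of "\<bar>r\<bar> + 1"]) simp_all
  qed
  have ug: "g (u p) = 0" "P (u p) = 0" "S (u p) = 0" if "p \<in> D - ?C" for p
    using that P(2) S(2) g0 by auto
  have cgu: "continuous_on D (\<lambda>p. g (u p))" by (rule continuous_on_compose2[OF cg cu]) auto
  have cP: "continuous_on D (\<lambda>p. P (u p))" and cS: "continuous_on D (\<lambda>p. S (u p))"
  proof -
    have "continuous_on {0<..} P" "continuous_on {0<..} S"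
      by (auto intro!: continuous_at_imp_continuous_on DERIV_isCont[OF P(1)] DERIV_isCont[OF S(1)])
    then show "continuous_on D (\<lambda>p. P (u p))" "continuous_on D (\<lambda>p. S (u p))"
      using u0 by (auto intro!: continuous_on_compose2[OF _ cu])
  qed
  have Wn0: "W p \<noteq> 0" for p using W1[of p] by auto
  have lines: "continuous_on UNIV (\<lambda>x::real. (x, y))" "continuous_on UNIV (\<lambda>y::real. (x, y))" for x y :: real
    by (intro continuous_on_Pair continuous_on_const continuous_on_id)+
  define v where "v = zero_ext D (\<lambda>p. P (u p))"
  define vx where "vx = zero_ext D (\<lambda>p. g (u p) * ux p)"
  define vy where "vy = zero_ext D (\<lambda>p. g (u p) * uy p)"
  define f where "f = zero_ext D (\<lambda>p. S (u p) * (ux p / W p))"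
  define fx where "fx = zero_ext D (\<lambda>p. (g (u p))\<^sup>2 * ux p * (ux p / W p) + S (u p) * Z1 p)"
  define h where "h = zero_ext D (\<lambda>p. S (u p) * (uy p / W p))"
  define hy where "hy = zero_ext D (\<lambda>p. (g (u p))\<^sup>2 * uy p * (uy p / W p) + S (u p) * Z2 p)"
  have cv: "continuous_on UNIV v" unfolding v_def
    by (rule continuous_zero_ext[OF D C CD]) (use ug cP in auto)
  have cvx: "continuous_on UNIV vx" unfolding vx_def
    by (rule continuous_zero_ext[OF D C CD]) (auto simp: ug intro!: continuous_intros cgu cux)
  have cvy: "continuous_on UNIV vy" unfolding vy_def
    by (rule continuous_zero_ext[OF D C CD]) (auto simp: ug intro!: continuous_intros cgu cuy)
  have cf: "continuous_on UNIV f" unfolding f_def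
    by (rule continuous_zero_ext[OF D C CD]) (auto simp: ug Wn0 intro!: continuous_intros cS cux cW)
  have cfx: "continuous_on UNIV fx" unfolding fx_def
    by (rule continuous_zero_ext[OF D C CD]) (auto simp: ug Wn0 intro!: continuous_intros cgu cS cux cW cz1)
  have chy: "continuous_on UNIV hy" unfolding hy_def
    by (rule continuous_zero_ext[OF D C CD]) (auto simp: ug Wn0 intro!: continuous_intros cgu cS cuy cW cz2)
  have dPu: "((\<lambda>x. P (u (x, y))) has_real_derivative g (u (x, y)) * ux (x, y)) (at x)"
    "((\<lambda>y. P (u (x, y))) has_real_derivative g (u (x, y)) * uy (x, y)) (at y)"
    "((\<lambda>x. S (u (x, y))) has_real_derivative (g (u (x, y)))\<^sup>2 * ux (x, y)) (at x)"
    "((\<lambda>y. S (u (x, y))) has_real_derivative (g (u (x, y)))\<^sup>2 * uy (x, y)) (at y)"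
    if "(x, y) \<in> D" for x y
    using that by (auto intro!: DERIV_chain2[OF P(1)] DERIV_chain2[OF S(1)] du1 du2 u0)
  have dvx: "((\<lambda>x. v (x, y)) has_real_derivative vx (x, y)) (at x)" for x y
    unfolding v_def vx_def
    by (rule deriv_zero_ext[OF D C CD _ lines(1)]) (use ug dPu in auto)
  have dvy: "((\<lambda>y. v (x, y)) has_real_derivative vy (x, y)) (at y)" for x y
    unfolding v_def vy_def
    by (rule deriv_zero_ext[OF D C CD _ lines(2)]) (use ug dPu in auto)
  have dfx: "((\<lambda>x. f (x, y)) has_real_derivative fx (x, y)) (at x)" for x y
    unfolding f_def fx_def
  proof (rule deriv_zero_ext[OF D C CD _ lines(1)])
    fix x assume "(x, y) \<in> D"
    from DERIV_mult[OF dPu(3)[OF this] dz1[OF this]]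
    show "((\<lambda>x. S (u (x, y)) * (ux (x, y) / W (x, y))) has_real_derivative
        (g (u (x, y)))\<^sup>2 * ux (x, y) * (ux (x, y) / W (x, y)) + S (u (x, y)) * Z1 (x, y)) (at x)"
      by (simp only: mult.commute[of "Z1 (x, y)"])
  qed (simp add: ug)
  have dhy: "((\<lambda>y. h (x, y)) has_real_derivative hy (x, y)) (at y)" for x y
    unfolding h_def hy_def
  proof (rule deriv_zero_ext[OF D C CD _ lines(2)])
    fix y assume "(x, y) \<in> D"
    from DERIV_mult[OF dPu(4)[OF this] dz2[OF this]]
    show "((\<lambda>y. S (u (x, y)) * (uy (x, y) / W (x, y))) has_real_derivative
        (g (u (x, y)))\<^sup>2 * uy (x, y) * (uy (x, y) / W (x, y)) + S (u (x, y)) * Z2 (x, y)) (at y)"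
      by (simp only: mult.commute[of "Z2 (x, y)"])
  qed (simp add: ug)
  have outside: "zero_ext D F (x, y) = 0" if "\<not> (\<bar>x\<bar> < R \<and> \<bar>y\<bar> < R)" "\<And>p. p \<in> D - ?C \<Longrightarrow> F p = 0" for F x y
  proof -
    have "(x, y) \<notin> ?C" using R(2) that(1) by (metis (no_types, lifting) fst_conv mem_Collect_eq snd_conv subsetD)
    then show ?thesis using that(2)[of "(x, y)"] by (auto simp: zero_ext_def)
  qed
  have supp: "v (x, y) = 0 \<and> vx (x, y) = 0 \<and> vy (x, y) = 0 \<and> f (x, y) = 0 \<and> fx (x, y) = 0 \<and> h (x, y) = 0 \<and> hy (x, y) = 0"
    if "\<not> (\<bar>x\<bar> < R \<and> \<bar>y\<bar> < R)" for x y
    unfolding v_def vx_def vy_def f_def fx_def h_def hy_def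
    by (intro conjI outside[OF that]) (simp_all add: ug)
  have sob: "2 * sqrt pi * sqrt (\<integral>p. (v p)\<^sup>2 \<partial>lborel) \<le> (\<integral>p. sqrt ((vx p)\<^sup>2 + (vy p)\<^sup>2) \<partial>lborel)"
    and iDv: "integrable lborel (\<lambda>p. sqrt ((vx p)\<^sup>2 + (vy p)\<^sup>2))"
    and iv: "integrable lborel (\<lambda>p. (v p)\<^sup>2)"
  proof -
    have 1: "continuous_on UNIV (\<lambda>p. (v p)\<^sup>2)" "continuous_on UNIV (\<lambda>p. sqrt ((vx p)\<^sup>2 + (vy p)\<^sup>2))"
      by (intro continuous_intros cv cvx cvy)+
    have 2: "(v (x, y))\<^sup>2 = 0" "sqrt ((vx (x, y))\<^sup>2 + (vy (x, y))\<^sup>2) = 0" if "\<not> (\<bar>x\<bar> < R \<and> \<bar>y\<bar> < R)" for x y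
      using supp[OF that] by auto
    have "2 * sqrt pi * sqrt (integral {-R..R} (\<lambda>x. integral {-R..R} (\<lambda>y. (v (x, y))\<^sup>2)))
      \<le> integral {-R..R} (\<lambda>x. integral {-R..R} (\<lambda>y. sqrt ((vx (x, y))\<^sup>2 + (vy (x, y))\<^sup>2)))"
      by (rule sharp_sobolev_plane[OF R(1)])
        (use cv cvx cvy dvx dvy supp P(3) in \<open>auto simp: v_def zero_ext_def\<close>)
    then show "2 * sqrt pi * sqrt (\<integral>p. (v p)\<^sup>2 \<partial>lborel) \<le> (\<integral>p. sqrt ((vx p)\<^sup>2 + (vy p)\<^sup>2) \<partial>lborel)"
      using iterated_integral_eq_lborel(2)[OF 1(1) 2(1)] iterated_integral_eq_lborel(2)[OF 1(2) 2(2)]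
      by (simp)
    show "integrable lborel (\<lambda>p. sqrt ((vx p)\<^sup>2 + (vy p)\<^sup>2))"
      using iterated_integral_eq_lborel(1)[OF 1(2) 2(2)] by simp
    show "integrable lborel (\<lambda>p. (v p)\<^sup>2)"
      using iterated_integral_eq_lborel(1)[OF 1(1) 2(1)] by simp
  qed
  have div: "(\<integral>p. fx p + hy p \<partial>lborel) = 0" and idiv: "integrable lborel (\<lambda>p. fx p + hy p)"
  proof -
    have 1: "continuous_on UNIV (\<lambda>p. fx p + hy p)" by (intro continuous_intros cfx chy)
    have 2: "fx (x, y) + hy (x, y) = 0" if "\<not> (\<bar>x\<bar> < R \<and> \<bar>y\<bar> < R)" for x y
      using supp[OF that] by auto
    have "integral {-R..R} (\<lambda>x. integral {-R..R} (\<lambda>y. fx (x, y) + hy (x, y))) = 0"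
      by (rule integral_divergence_eq_0[OF R(1), where f = "\<lambda>x y. f (x, y)" and h = "\<lambda>x y. h (x, y)"])
        (use cf cfx chy dfx dhy supp in auto)
    then show "(\<integral>p. fx p + hy p \<partial>lborel) = 0"
      using iterated_integral_eq_lborel(2)[OF 1 2] by simp
    show "integrable lborel (\<lambda>p. fx p + hy p)" by (rule iterated_integral_eq_lborel(1)[OF 1 2])
  qed
  have iC: "integrable lborel (\<lambda>p. indicator ?C p :: real)"
    using superlevel_finite[OF ab(1)] borel_compact[OF C] by (intro integrable_real_indicator) auto
  have pointwise: "2 * s * sqrt ((vx p)\<^sup>2 + (vy p)\<^sup>2) - s\<^sup>2 * (fx p + hy p) - s\<^sup>2 * (2 * K * (b - a)) * indicator ?C p
      \<le> indicator {p \<in> D. a < u p \<and> u p < b} p * W p" for p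
  proof (cases "p \<in> D")
    case False
    then show ?thesis by (simp add: vx_def vy_def fx_def hy_def zero_ext_def)
  next
    case True
    define G where "G = sqrt ((ux p)\<^sup>2 + (uy p)\<^sup>2)"
    define n where "n = g (u p)"
    have G2: "G\<^sup>2 = (ux p)\<^sup>2 + (uy p)\<^sup>2" by (simp add: G_def)
    have n0: "n \<ge> 0" using g01 n_def by simp
    have vG: "sqrt ((vx p)\<^sup>2 + (vy p)\<^sup>2) = n * G"
    proof -
      have "(vx p)\<^sup>2 + (vy p)\<^sup>2 = n\<^sup>2 * G\<^sup>2"
        using True by (simp add: vx_def vy_def zero_ext_def n_def G2 power_mult_distrib algebra_simps)
      then show ?thesis using n0 by (simp add: real_sqrt_mult G_def)
    qed
    have fh: "fx p + hy p = n\<^sup>2 * G\<^sup>2 / W p + S (u p) * (Z1 p + Z2 p)"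
      unfolding G2 using True
      by (simp add: fx_def hy_def zero_ext_def n_def add_divide_distrib power2_eq_square algebra_simps)
    have SZ: "- (S (u p) * (Z1 p + Z2 p)) \<le> 2 * K * (b - a) * indicator ?C p"
    proof (cases "p \<in> ?C")
      case True
      have "\<bar>S (u p) * (Z1 p + Z2 p)\<bar> \<le> (b - a) * (2 * K)"
        unfolding abs_mult using S(3,4)[of "u p"] Z[OF \<open>p \<in> D\<close>] K by (intro mult_mono) auto
      then show ?thesis using True by (simp add: mult_ac)
    next
      case False
      then show ?thesis using ug(3)[of p] \<open>p \<in> D\<close> by simp
    qed
    \<comment> \<open>Expanding the square of \<open>W - s n G\<close> gives the linearized Cauchy-Schwarz inequality.\<close>
    have cs: "2 * s * (n * G) - s\<^sup>2 * (n\<^sup>2 * G\<^sup>2 / W p) \<le> indicator {p \<in> D. a < u p \<and> u p < b} p * W p"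
    proof (cases "a < u p \<and> u p < b")
      case True
      have "0 \<le> (W p - s * n * G)\<^sup>2 / W p" using W1[of p] by auto
      also have "\<dots> = W p - 2 * s * (n * G) + s\<^sup>2 * (n\<^sup>2 * G\<^sup>2 / W p)"
        using W1[of p] by (simp add: power2_eq_square field_simps)
      finally show ?thesis using True \<open>p \<in> D\<close> by simp
    next
      case False
      then have "n = 0" unfolding n_def by (rule g0)
      then show ?thesis using W1[of p] by (simp add: indicator_def)
    qed
    have "s\<^sup>2 * (- (S (u p) * (Z1 p + Z2 p))) \<le> s\<^sup>2 * (2 * K * (b - a) * indicator ?C p)"
      by (rule mult_left_mono[OF SZ]) simp
    then show ?thesis using cs unfolding vG fh by (simp add: algebra_simps)
  qed
  have "(\<integral>p. 2 * s * sqrt ((vx p)\<^sup>2 + (vy p)\<^sup>2) - s\<^sup>2 * (fx p + hy p) - s\<^sup>2 * (2 * K * (b - a)) * indicator ?C p \<partial>lborel)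
     \<le> slice_area a b"
    unfolding slice_area_def
    by (rule integral_mono[OF _ slice_integrable[OF ab(1)] pointwise])
      (intro Bochner_Integration.integrable_diff integrable_mult_right iDv idiv iC)
  also have "(\<integral>p. 2 * s * sqrt ((vx p)\<^sup>2 + (vy p)\<^sup>2) - s\<^sup>2 * (fx p + hy p) - s\<^sup>2 * (2 * K * (b - a)) * indicator ?C p \<partial>lborel)
     = 2 * s * (\<integral>p. sqrt ((vx p)\<^sup>2 + (vy p)\<^sup>2) \<partial>lborel) - s\<^sup>2 * (\<integral>p. fx p + hy p \<partial>lborel)
        - s\<^sup>2 * (2 * K * (b - a)) * level_measure a"
    using iDv idiv iC by (simp add: level_measure_def del: Bochner_Integration.integral_add)
  finally have A: "2 * s * (\<integral>p. sqrt ((vx p)\<^sup>2 + (vy p)\<^sup>2) \<partial>lborel) - s\<^sup>2 * (2 * K * (b - a)) * level_measure a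
     \<le> slice_area a b" using div by simp
  have "(b - a - 2 * e)\<^sup>2 * level_measure b \<le> (\<integral>p. (v p)\<^sup>2 \<partial>lborel)"
  proof -
    let ?Cb = "{p \<in> D. b \<le> u p}"
    have b0: "b > 0" using ab by simp
    have iCb: "integrable lborel (\<lambda>p. indicator ?Cb p :: real)"
      using superlevel_finite[OF b0] borel_compact[OF cpt[OF b0]] by (intro integrable_real_indicator) auto
    have "(\<integral>p. (b - a - 2 * e)\<^sup>2 * indicator ?Cb p \<partial>lborel) \<le> (\<integral>p. (v p)\<^sup>2 \<partial>lborel)"
    proof (rule integral_mono[OF _ iv])
      show "(b - a - 2 * e)\<^sup>2 * indicator ?Cb p \<le> (v p)\<^sup>2" for p
      proof (cases "p \<in> ?Cb")
        case True
        have "(b - e) - (a + e) \<le> P (u p)" by (rule P(5)) (use e True g1 in auto)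
        then show ?thesis using True e by (auto simp: v_def zero_ext_def intro!: power_mono)
      qed simp
    qed (use iCb in simp)
    then show ?thesis using iCb by (simp add: level_measure_def)
  qed
  then have "sqrt ((b - a - 2 * e)\<^sup>2 * level_measure b) \<le> sqrt (\<integral>p. (v p)\<^sup>2 \<partial>lborel)" by simp
  then have "(b - a - 2 * e) * sqrt (level_measure b) \<le> sqrt (\<integral>p. (v p)\<^sup>2 \<partial>lborel)"
    using e by (simp add: real_sqrt_mult)
  then have "2 * sqrt pi * ((b - a - 2 * e) * sqrt (level_measure b)) \<le> 2 * sqrt pi * sqrt (\<integral>p. (v p)\<^sup>2 \<partial>lborel)"
    by (intro mult_left_mono) auto
  also note sob
  finally have "(2 * s) * (2 * sqrt pi * ((b - a - 2 * e) * sqrt (level_measure b)))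
       \<le> (2 * s) * (\<integral>p. sqrt ((vx p)\<^sup>2 + (vy p)\<^sup>2) \<partial>lborel)" using s by (intro mult_left_mono) auto
  then show ?thesis using A by (simp add: algebra_simps)
qed

lemma level_measure_pos:
  assumes "t > 0" "p \<in> D" "t < u p"
  shows "level_measure t > 0"
proof -
  have "openin (top_of_set D) (D \<inter> u -` {t<..})"
    by (rule continuous_openin_preimage_gen[OF cu]) simp
  then have "open (D \<inter> u -` {t<..})" using D openin_open_trans by blast
  moreover have "D \<inter> u -` {t<..} \<noteq> {}" using assms by auto
  ultimately have "\<not> negligible (D \<inter> u -` {t<..})" by (rule open_not_negligible)
  then have nn: "\<not> negligible {p \<in> D. t \<le> u p}" by (rule contrapos_nn) (rule negligible_subset, auto)
  have b: "{p \<in> D. t \<le> u p} \<in> sets borel" using borel_compact[OF cpt[OF assms(1)]] .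
  show ?thesis
  proof (rule ccontr)
    assume "\<not> 0 < level_measure t"
    then have "measure lborel {p \<in> D. t \<le> u p} = 0" by (simp add: level_measure_def zero_less_measure_iff)
    then have "emeasure lborel {p \<in> D. t \<le> u p} = 0"
      using superlevel_finite[OF assms(1)] by (auto simp: measure_def enn2real_eq_0_iff)
    then have "{p \<in> D. t \<le> u p} \<in> null_sets lborel" using b by auto
    then show False using nn by (simp add: negligible_iff_null_sets null_sets_completionI)
  qed
qed

text \<open>The choice \<open>s = sqrt pi / (K * sqrt (level_measure a))\<close> would maximize the lower bound if the
  measures of the two superlevel sets were equal, and
  \<open>sqrt r \<ge> 1 + ln (sqrt r)\<close> turns the ratio of the two measures into a difference of logarithms,
  which telescopes over consecutive slices.\<close>

lemma slice_area_bound: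
  assumes ab: "0 < a" "a < b" and p: "p \<in> D" "b < u p"
  shows "2 * pi / K * (b - a) * (1 + (ln (level_measure b) - ln (level_measure a))) \<le> slice_area a b"
proof -
  define A where "A = level_measure a"
  define B where "B = level_measure b"
  have A: "A > 0" and B: "B > 0"
    unfolding A_def B_def using assms by (auto intro!: level_measure_pos[OF _ p(1)])
  have lim: "4 * s * sqrt pi * (b - a) * sqrt B - 2 * s\<^sup>2 * K * (b - a) * A \<le> slice_area a b"
    if s: "s \<ge> 0" for s
  proof -
    let ?f = "\<lambda>e. 4 * s * sqrt pi * (b - a - 2 * e) * sqrt B - 2 * s\<^sup>2 * K * (b - a) * A"
    have "(?f \<longlongrightarrow> ?f 0) (at_right 0)" by (intro tendsto_intros)
    moreover have "eventually (\<lambda>e. ?f e \<le> slice_area a b) (at_right 0)"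
      using eventually_at_right_less[of 0] order_tendstoD(2)[OF tendsto_ident_at, of 0 "(b - a) / 2" "{0<..}"] ab
      by (auto elim!: eventually_elim2 simp: A_def B_def intro!: slice_area_cutoff_bound s)
    ultimately have "?f 0 \<le> slice_area a b"
      by (intro tendsto_upperbound[of ?f]) auto
    then show ?thesis by simp
  qed
  define s where "s = sqrt pi / (K * sqrt A)"
  have s0: "s \<ge> 0" using K A by (simp add: s_def)
  have "4 * s * sqrt pi * (b - a) * sqrt B - 2 * s\<^sup>2 * K * (b - a) * A
     = 2 * pi / K * (b - a) * (2 * sqrt (B / A) - 1)"
  proof -
    define sA sB sp where "sA = sqrt A" and "sB = sqrt B" and "sp = sqrt pi"
    have sA: "sA > 0" "A = sA\<^sup>2" and sp: "pi = sp\<^sup>2" using A by (auto simp: sA_def sp_def)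
    have "4 * (sp / (K * sA)) * sp * (b - a) * sB - 2 * (sp / (K * sA))\<^sup>2 * K * (b - a) * sA\<^sup>2
       = 2 * sp\<^sup>2 / K * (b - a) * (2 * (sB / sA) - 1)"
      using K sA(1) by (simp add: field_simps power2_eq_square)
    then show ?thesis
      unfolding s_def real_sqrt_divide sA_def[symmetric] sB_def[symmetric] sp_def[symmetric] sA(2)[symmetric] sp[symmetric] .
  qed
  moreover have "2 * sqrt (B / A) - 1 \<ge> 1 + (ln B - ln A)"
  proof -
    have "ln (sqrt (B / A)) \<le> sqrt (B / A) - 1" by (rule ln_le_minus_one) (use A B in simp)
    moreover have "ln (sqrt (B / A)) = (ln B - ln A) / 2" using A B by (simp add: ln_sqrt ln_div)
    ultimately show ?thesis by simp
  qed
  then have "2 * pi / K * (b - a) * (1 + (ln B - ln A)) \<le> 2 * pi / K * (b - a) * (2 * sqrt (B / A) - 1)"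
    using K ab by (intro mult_left_mono) auto
  ultimately show ?thesis using lim[OF s0] by (simp add: A_def B_def)
qed

text \<open>Cut the slab into \<open>n + 1\<close> slices of the same height. The logarithmic terms sum up to the same
  difference for every \<open>n\<close>, while they carry the factor \<open>1 / (n + 1)\<close>.\<close>

lemma slab_area_bound:
  assumes ab: "0 < a" "a < b" and p: "p \<in> D" "b < u p"
    and T: "(\<integral>\<^sup>+q\<in>D. ennreal (W q) \<partial>lborel) = ennreal T" "T \<ge> 0"
  shows "2 * pi / K * (b - a) \<le> T"
proof -
  define L where "L = (\<lambda>t. ln (level_measure t))"
  have main: "2 * pi / K * (b - a) + 2 * pi / K * (b - a) * (L b - L a) * inverse (real (Suc n)) \<le> T" for n
  proof -
    define d where "d = (b - a) / real (Suc n)"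
    define t where "t = (\<lambda>i. a + real i * d)"
    have d0: "d > 0" using ab by (simp add: d_def)
    have nd: "real (Suc n) * d = b - a" by (simp add: d_def del: of_nat_Suc)
    have t: "t 0 = a" "t (Suc n) = b" "t (Suc i) - t i = d" for i
      using nd by (simp_all add: t_def algebra_simps)
    have tm: "t i \<le> t j" if "i \<le> j" for i j
      using that d0 by (simp add: t_def mult_right_mono)
    have 1: "2 * pi / K * d * (1 + (L (t (Suc i)) - L (t i))) \<le> slice_area (t i) (t (Suc i))" if "i < Suc n" for i
    proof -
      have "t (Suc i) \<le> b" using tm[of "Suc i" "Suc n"] t(2) that by simp
      moreover have "a \<le> t i" using tm[of 0 i] t(1) by simp
      ultimately show ?thesis
        using slice_area_bound[of "t i" "t (Suc i)" p] ab p t(3)[of i] d0 by (simp add: L_def)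
    qed
    let ?S = "\<lambda>i. {q \<in> D. t i < u q \<and> u q < t (Suc i)}"
    have sa: "(\<integral>\<^sup>+q. indicator (?S i) q * ennreal (W q) \<partial>lborel) = ennreal (slice_area (t i) (t (Suc i)))" for i
    proof -
      have "a \<le> t i" using tm[of 0 i] t(1) by simp
      then have "t i > 0" using ab by simp
      have "(\<integral>\<^sup>+q. indicator (?S i) q * ennreal (W q) \<partial>lborel) = (\<integral>\<^sup>+q. ennreal (indicator (?S i) q * W q) \<partial>lborel)"
        by (rule nn_integral_cong) (simp add: indicator_def)
      also have "\<dots> = ennreal (slice_area (t i) (t (Suc i)))" unfolding slice_area_def
      proof (rule nn_integral_eq_integral[OF slice_integrable[OF \<open>t i > 0\<close>]])
        show "AE q in lborel. 0 \<le> indicator (?S i) q * W q"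
          using W1 order_trans[OF zero_le_one] by (intro AE_I2 mult_nonneg_nonneg) auto
      qed
      finally show ?thesis .
    qed
    have sa0: "0 \<le> slice_area (t i) (t (Suc i))" for i
      unfolding slice_area_def using W1 order_trans[OF zero_le_one]
      by (intro integral_nonneg_AE AE_I2 mult_nonneg_nonneg) auto
    have meas: "(\<lambda>q. indicator (?S i) q * ennreal (W q)) \<in> borel_measurable lborel" for i
    proof -
      have "a \<le> t i" using tm[of 0 i] t(1) by simp
      then have "t i > 0" using ab by simp
      have "(\<lambda>q. ennreal (indicator (?S i) q * W q)) \<in> borel_measurable lborel"
        using borel_measurable_integrable[OF slice_integrable[OF \<open>t i > 0\<close>]] by measurable
      moreover have "(\<lambda>q. ennreal (indicator (?S i) q * W q)) = (\<lambda>q. indicator (?S i) q * ennreal (W q))"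
        by (auto simp: fun_eq_iff indicator_def)
      ultimately show ?thesis by simp
    qed
    have disj: "(\<Sum>i<Suc n. indicator (?S i) q * ennreal (W q)) \<le> ennreal (W q) * indicator D q" for q
    proof (cases "\<exists>i<Suc n. q \<in> ?S i")
      case True
      then obtain i where i: "i < Suc n" "q \<in> ?S i" by auto
      have "q \<notin> ?S j" if "j \<noteq> i" for j
      proof (cases "j < i")
        case True
        then show ?thesis using tm[of "Suc j" i] i(2) by auto
      next
        case False
        then show ?thesis using tm[of "Suc i" j] i(2) that by auto
      qed
      then have "(\<Sum>j<Suc n. indicator (?S j) q * ennreal (W q)) = (\<Sum>j<Suc n. if j = i then ennreal (W q) else 0)"
        using i(2) by (intro sum.cong) (auto simp: indicator_def)
      also have "\<dots> = ennreal (W q)" using i(1) by (subst sum.delta) auto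
      finally show ?thesis using i(2) by simp
    next
      case False
      then have "(\<Sum>i<Suc n. indicator (?S i) q * ennreal (W q)) = 0"
        by (intro sum.neutral) (auto simp: indicator_def)
      then show ?thesis by (rule ord_eq_le_trans) simp
    qed
    have "ennreal (\<Sum>i<Suc n. slice_area (t i) (t (Suc i))) = (\<Sum>i<Suc n. \<integral>\<^sup>+q. indicator (?S i) q * ennreal (W q) \<partial>lborel)"
      unfolding sa by (rule sum_ennreal[symmetric]) (rule sa0)
    also have "\<dots> = (\<integral>\<^sup>+q. (\<Sum>i<Suc n. indicator (?S i) q * ennreal (W q)) \<partial>lborel)"
      by (rule nn_integral_sum[symmetric]) (rule meas)
    also have "\<dots> \<le> (\<integral>\<^sup>+q\<in>D. ennreal (W q) \<partial>lborel)"
      by (rule nn_integral_mono) (rule disj)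
    finally have "(\<Sum>i<Suc n. slice_area (t i) (t (Suc i))) \<le> T" using T by simp
    moreover have "(\<Sum>i<Suc n. 2 * pi / K * d * (1 + (L (t (Suc i)) - L (t i)))) \<le> (\<Sum>i<Suc n. slice_area (t i) (t (Suc i)))"
      by (rule sum_mono) (use 1 in auto)
    moreover have "(\<Sum>i<Suc n. 2 * pi / K * d * (1 + (L (t (Suc i)) - L (t i)))) = 2 * pi / K * d * (real (Suc n) + (L b - L a))"
      unfolding sum_distrib_left[symmetric] sum.distrib sum_lessThan_telescope[of "\<lambda>i. L (t i)"] t(1,2)
      by (simp only: sum_constant card_lessThan mult_1_right of_nat_id)
    moreover have "2 * pi / K * d * (real (Suc n) + (L b - L a)) = 2 * pi / K * (b - a) + 2 * pi / K * (b - a) * (L b - L a) * inverse (real (Suc n))"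
    proof -
      have "2 * pi / K * d * (real (Suc n) + (L b - L a)) = 2 * pi / K * (real (Suc n) * d) + 2 * pi / K * d * (L b - L a)"
        by (simp only: distrib_left mult_ac)
      also have "2 * pi / K * d * (L b - L a) = 2 * pi / K * ((b - a) * inverse (real (Suc n))) * (L b - L a)"
        by (simp only: d_def divide_inverse[of "b - a"])
      finally show ?thesis unfolding nd by (simp only: mult_ac)
    qed
    ultimately show ?thesis by linarith
  qed
  have "(\<lambda>n. 2 * pi / K * (b - a) + 2 * pi / K * (b - a) * (L b - L a) * inverse (real (Suc n)))
      \<longlonglongrightarrow> 2 * pi / K * (b - a) + 2 * pi / K * (b - a) * (L b - L a) * 0"
    by (intro tendsto_intros LIMSEQ_inverse_real_of_nat)
  from LIMSEQ_le_const2[OF this] main show ?thesis by auto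
qed

text \<open>The slabs used keep a positive distance from both ends of the interval between \<open>0\<close> and \<open>u p\<close>: the
  superlevel sets are compact at positive levels only, and the estimate divides by their measures.\<close>

theorem height_le_area:
  assumes p: "p \<in> D"
  shows "ennreal (u p) \<le> ennreal K * (\<integral>\<^sup>+q\<in>D. ennreal (W q) \<partial>lborel) / ennreal (2 * pi)"
proof (cases "(\<integral>\<^sup>+q\<in>D. ennreal (W q) \<partial>lborel)")
  case (real T)
  have shrink: "2 * pi / K * (u p - 2 * e) \<le> T" if e: "e > 0" "2 * e < u p" for e
    using slab_area_bound[of e "u p - e" p T] real p e by simp
  have "2 * pi / K * u p \<le> T + e" if "e > 0" for e
  proof -
    define d where "d = min (e * K / (4 * pi)) (u p / 4)"
    have d: "d > 0" "2 * d < u p" "d \<le> e * K / (4 * pi)" unfolding d_def using that K u0[OF p] by auto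
    have "2 * pi / K * (2 * d) \<le> e" using d(3) K by (simp add: field_simps)
    moreover have "2 * pi / K * (u p - 2 * d) \<le> T" by (rule shrink[OF d(1,2)])
    ultimately show ?thesis by (simp add: right_diff_distrib)
  qed
  then have "2 * pi / K * u p \<le> T" by (rule field_le_epsilon)
  then have "u p \<le> K * T / (2 * pi)" using K by (simp add: field_simps)
  then have "ennreal (u p) \<le> ennreal (K * T / (2 * pi))" by (rule ennreal_leI)
  also have "\<dots> = ennreal K * ennreal T / ennreal (2 * pi)"
    using K real by (simp add: ennreal_mult[symmetric] divide_ennreal)
  finally show ?thesis using real by simp
next
  case top
  then show ?thesis using K by (simp add: ennreal_mult_top ennreal_top_divide)
qed

end

section \<open>Smooth maps and their local inverses\<close>

lemma Ck_on_subset: "Ck_on k S f \<Longrightarrow> T \<subseteq> S \<Longrightarrow> Ck_on k T f"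
  by (induction k arbitrary: f) (auto intro: continuous_on_subset)

lemma frechet_derivative_cong_open:
  assumes "open S" "x \<in> S" "\<And>y. y \<in> S \<Longrightarrow> f y = g y" "f differentiable (at x)"
  shows "g differentiable (at x)" "frechet_derivative g (at x) = frechet_derivative f (at x)"
proof -
  have "(f has_derivative frechet_derivative f (at x)) (at x)"
    using assms(4) frechet_derivative_works by blast
  then have *: "(g has_derivative frechet_derivative f (at x)) (at x)"
    by (rule has_derivative_transform_within_open[OF _ assms(1,2)]) (use assms(3) in auto)
  then show "g differentiable (at x)" by (auto simp: differentiable_def)
  show "frechet_derivative g (at x) = frechet_derivative f (at x)"
    using frechet_derivative_at[OF *] by simp
qed

lemma Ck_on_cong:
  assumes "open S" "Ck_on k S f" "\<And>y. y \<in> S \<Longrightarrow> f y = g y"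
  shows "Ck_on k S g"
  using assms(2,3)
proof (induction k arbitrary: f g)
  case 0
  then show ?case by (auto intro: continuous_on_eq)
next
  case (Suc k)
  have d: "g differentiable (at x)" "frechet_derivative g (at x) = frechet_derivative f (at x)" if "x \<in> S" for x
    using frechet_derivative_cong_open[OF assms(1) that, of f g] Suc.prems that by auto
  have "Ck_on k S (\<lambda>x. frechet_derivative g (at x) v)" for v
    by (rule Suc.IH[of "\<lambda>x. frechet_derivative f (at x) v"]) (use Suc.prems(1) d in auto)
  then show ?case using d by auto
qed

lemma Ck_on_local:
  assumes "\<And>x. x \<in> S \<Longrightarrow> \<exists>T. open T \<and> x \<in> T \<and> Ck_on k T f"
  shows "Ck_on k S f"
  using assms
proof (induction k arbitrary: f)
  case 0
  have "isCont f x" if "x \<in> S" for x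
    using 0[OF that] by (auto simp: continuous_on_eq_continuous_at)
  then show ?case by (simp add: continuous_at_imp_continuous_on)
next
  case (Suc k)
  have "f differentiable (at x)" if "x \<in> S" for x using Suc.prems[OF that] by auto
  moreover have "Ck_on k S (\<lambda>x. frechet_derivative f (at x) v)" for v
    by (rule Suc.IH) (use Suc.prems in fastforce)
  ultimately show ?case by simp
qed

lemma Ck_on_SucD: "Ck_on (Suc k) S f \<Longrightarrow> Ck_on k S f"
proof (induction k arbitrary: f)
  case 0
  then show ?case
    by (auto intro!: continuous_at_imp_continuous_on differentiable_imp_continuous_within)
next
  case (Suc k)
  have "Ck_on k S (\<lambda>x. frechet_derivative f (at x) v)" for v
    by (rule Suc.IH) (use Suc.prems in auto)
  then show ?case using Suc.prems by auto
qed

lemma Ck_on_const: "Ck_on k S (\<lambda>x. c)"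
  by (induction k arbitrary: c) (auto simp: frechet_derivative_const)

text \<open>This is how membership in the next class is established everywhere below: any known expression
  for the derivative may be used instead of the chosen one.\<close>

lemma Ck_on_deriv:
  assumes "open S" and d: "\<And>x. x \<in> S \<Longrightarrow> (f has_derivative f' x) (at x)"
    and c: "\<And>v. Ck_on k S (\<lambda>x. f' x v)"
  shows "Ck_on (Suc k) S f"
proof -
  have "frechet_derivative f (at x) = f' x" if "x \<in> S" for x
    using frechet_derivative_at[OF d[OF that]] by simp
  then have "Ck_on k S (\<lambda>x. frechet_derivative f (at x) v)" for v
    using Ck_on_cong[OF assms(1) c[of v]] by simp
  then show ?thesis using d by (auto simp: differentiable_def)
qed

lemma Ck_on_SucE:
  assumes "Ck_on (Suc k) S f" "x \<in> S"
  shows "(f has_derivative frechet_derivative f (at x)) (at x)"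
  using assms frechet_derivative_works by auto

lemma Ck_on_bounded_linear:
  assumes "open S" "bounded_linear L"
  shows "Ck_on k S L"
proof (cases k)
  case 0
  then show ?thesis using linear_continuous_on[OF assms(2)] by simp
next
  case (Suc k)
  show ?thesis unfolding Suc
    by (rule Ck_on_deriv[OF assms(1) bounded_linear_imp_has_derivative[OF assms(2)] Ck_on_const])
qed

lemma Ck_on_compose_linear:
  assumes "open S" "bounded_linear L" "Ck_on k S f"
  shows "Ck_on k S (\<lambda>x. L (f x))"
  using assms(3)
proof (induction k arbitrary: f)
  case 0
  then show ?case using bounded_linear.continuous_on[OF assms(2)] by auto
next
  case (Suc k)
  show ?case
    by (rule Ck_on_deriv[OF assms(1) bounded_linear.has_derivative[OF assms(2) Ck_on_SucE[OF Suc.prems]] Suc.IH])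
      (use Suc.prems in auto)
qed

lemma Ck_on_add:
  assumes "open S" "Ck_on k S f" "Ck_on k S g"
  shows "Ck_on k S (\<lambda>x. f x + g x)"
  using assms(2,3)
proof (induction k arbitrary: f g)
  case 0
  then show ?case by (auto intro: continuous_intros)
next
  case (Suc k)
  show ?case
    by (rule Ck_on_deriv[OF assms(1) has_derivative_add[OF Ck_on_SucE[OF Suc.prems(1)] Ck_on_SucE[OF Suc.prems(2)]] Suc.IH])
      (use Suc.prems in auto)
qed

lemma Ck_on_mult:
  fixes f g :: "'a::euclidean_space \<Rightarrow> real"
  assumes "open S" "Ck_on k S f" "Ck_on k S g"
  shows "Ck_on k S (\<lambda>x. f x * g x)"
  using assms(2,3)
proof (induction k arbitrary: f g)
  case 0
  then show ?case by (auto intro: continuous_intros)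
next
  case (Suc k)
  show ?case
    by (rule Ck_on_deriv[OF assms(1) has_derivative_mult[OF Ck_on_SucE[OF Suc.prems(1)] Ck_on_SucE[OF Suc.prems(2)]]])
      (use Suc.prems Ck_on_SucD[OF Suc.prems(1)] Ck_on_SucD[OF Suc.prems(2)] in \<open>auto intro!: Ck_on_add[OF assms(1)] Suc.IH\<close>)
qed

lemma Ck_on_inverse:
  fixes f :: "'a::euclidean_space \<Rightarrow> real"
  assumes "open S" "Ck_on k S f" "\<And>x. x \<in> S \<Longrightarrow> f x \<noteq> 0"
  shows "Ck_on k S (\<lambda>x. inverse (f x))"
  using assms(2)
proof (induction k)
  case 0
  then show ?case using assms(3) by (auto intro: continuous_on_inverse)
next
  case (Suc k)
  have i: "Ck_on k S (\<lambda>x. inverse (f x))" by (rule Suc.IH[OF Ck_on_SucD[OF Suc.prems]])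
  have d: "((\<lambda>x. inverse (f x)) has_derivative (\<lambda>v. - 1 * (inverse (f x) * frechet_derivative f (at x) v * inverse (f x)))) (at x)"
    if "x \<in> S" for x
    using Deriv.has_derivative_inverse[OF assms(3)[OF that] Ck_on_SucE[OF Suc.prems that]] by simp
  show ?case
  proof (rule Ck_on_deriv[OF assms(1) d])
    show "Ck_on k S (\<lambda>x. - 1 * (inverse (f x) * frechet_derivative f (at x) v * inverse (f x)))" for v
      by (intro Ck_on_mult[OF assms(1)] Ck_on_const i) (use Suc.prems in auto)
  qed
qed

lemma Ck_on_sum:
  assumes "open S" "finite A" "\<And>i. i \<in> A \<Longrightarrow> Ck_on k S (f i)"
  shows "Ck_on k S (\<lambda>x. \<Sum>i\<in>A. f i x)"
  using assms(2,3) by (induction A) (auto intro!: Ck_on_add[OF assms(1)] Ck_on_const)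

lemma smooth_on_derivative:
  assumes "smooth_on S f"
  shows "smooth_on S (\<lambda>x. frechet_derivative f (at x) v)"
  using assms unfolding smooth_on_def by (metis Ck_on.simps(2))

lemma smooth_on_has_derivative:
  assumes "smooth_on S f" "x \<in> S"
  shows "(f has_derivative frechet_derivative f (at x)) (at x)"
  using assms Ck_on_SucE[of 0] unfolding smooth_on_def by blast

lemma smooth_on_continuous_on: "smooth_on S f \<Longrightarrow> continuous_on S f"
  unfolding smooth_on_def by (metis Ck_on.simps(1))

lemma smooth_on_subset: "smooth_on S f \<Longrightarrow> T \<subseteq> S \<Longrightarrow> smooth_on T f"
  unfolding smooth_on_def using Ck_on_subset by blast

lemma smooth_on_mult:
  fixes f g :: "'a::euclidean_space \<Rightarrow> real"
  shows "open S \<Longrightarrow> smooth_on S f \<Longrightarrow> smooth_on S g \<Longrightarrow> smooth_on S (\<lambda>x. f x * g x)"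
  unfolding smooth_on_def by (auto intro: Ck_on_mult)

lemma smooth_on_add: "open S \<Longrightarrow> smooth_on S f \<Longrightarrow> smooth_on S g \<Longrightarrow> smooth_on S (\<lambda>x. f x + g x)"
  unfolding smooth_on_def by (auto intro: Ck_on_add)

lemma smooth_on_compose_linear:
  "open S \<Longrightarrow> bounded_linear L \<Longrightarrow> smooth_on S f \<Longrightarrow> smooth_on S (\<lambda>x. L (f x))"
  unfolding smooth_on_def by (auto intro: Ck_on_compose_linear)

lemma smooth_on_const: "smooth_on S (\<lambda>x. c)"
  unfolding smooth_on_def by (auto intro: Ck_on_const)

lemma smooth_on_diff:
  fixes f g :: "'a::euclidean_space \<Rightarrow> real"
  assumes "open S" "smooth_on S f" "smooth_on S g"
  shows "smooth_on S (\<lambda>x. f x - g x)"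
  using smooth_on_add[OF assms(1,2) smooth_on_compose_linear[OF assms(1) bounded_linear_minus[OF bounded_linear_ident] assms(3)]]
  by simp

lemma smooth_on_inverse:
  fixes f :: "'a::euclidean_space \<Rightarrow> real"
  shows "open S \<Longrightarrow> smooth_on S f \<Longrightarrow> (\<And>x. x \<in> S \<Longrightarrow> f x \<noteq> 0) \<Longrightarrow> smooth_on S (\<lambda>x. inverse (f x))"
  unfolding smooth_on_def by (auto intro: Ck_on_inverse)

text \<open>If the derivative of \<open>\<Phi>\<close> is a smooth function of the value of \<open>\<Phi>\<close>, as it is for an inverse map,
  then every derivative of \<open>a \<circ> \<Phi>\<close> is again of the form \<open>a' \<circ> \<Phi>\<close> with \<open>a'\<close> smooth, and an induction on
  the order of differentiability applies to all such compositions at once.\<close>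

lemma smooth_on_compose_inverse:
  fixes a :: "'a::euclidean_space \<Rightarrow> real" and \<Phi> :: "'b::euclidean_space \<Rightarrow> 'a"
  assumes V: "open V" and W: "open W" and \<Phi>: "\<Phi> ` W \<subseteq> V"
    and d: "\<And>y. y \<in> W \<Longrightarrow> (\<Phi> has_derivative (\<lambda>v. \<Sum>e\<in>Basis. B e v (\<Phi> y) *\<^sub>R e)) (at y)"
    and B: "\<And>e v. e \<in> Basis \<Longrightarrow> smooth_on V (B e v)"
    and a: "smooth_on V a"
  shows "smooth_on W (\<lambda>y. a (\<Phi> y))"
proof -
  have "Ck_on k W (\<lambda>y. a (\<Phi> y))" for k
    using a
  proof (induction k arbitrary: a)
    case 0
    have "continuous_on W \<Phi>"
      using d has_derivative_continuous by (blast intro: continuous_at_imp_continuous_on)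
    then show ?case using continuous_on_compose2[OF smooth_on_continuous_on[OF 0]] \<Phi> by simp
  next
    case (Suc k)
    let ?a = "\<lambda>q. \<lambda>v. \<Sum>e\<in>Basis. B e v q * frechet_derivative a (at q) e"
    have "((\<lambda>y. a (\<Phi> y)) has_derivative ?a (\<Phi> y)) (at y)" if "y \<in> W" for y
    proof -
      have da: "(a has_derivative frechet_derivative a (at (\<Phi> y))) (at (\<Phi> y))"
        using smooth_on_has_derivative[OF Suc.prems] \<Phi> that by blast
      then interpret bounded_linear "frechet_derivative a (at (\<Phi> y))" by (rule has_derivative_bounded_linear)
      show ?thesis
        using has_derivative_compose[OF d[OF that] da] by (simp add: sum scaleR)
    qed
    moreover have "smooth_on V (\<lambda>q. ?a q v)" for v
    proof -
      have "smooth_on V (\<lambda>q. B e v q * frechet_derivative a (at q) e)" if "e \<in> Basis" for e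
        by (intro smooth_on_mult V B that smooth_on_derivative Suc.prems)
      then show ?thesis unfolding smooth_on_def by (intro allI Ck_on_sum[OF V finite_Basis]) auto
    qed
    then have "Ck_on k W (\<lambda>y. ?a (\<Phi> y) v)" for v by (rule Suc.IH)
    ultimately show ?case by (intro Ck_on_deriv[OF W, where f' = "\<lambda>y. ?a (\<Phi> y)"])
  qed
  then show ?thesis by (simp add: smooth_on_def)
qed

lemma Basis_real2: "(Basis :: (real^2) set) = {axis 1 1, axis 2 1}"
  by (auto simp: Basis_vec_def UNIV_2)

lemma axis_12_neq: "axis 1 1 \<noteq> (axis 2 1 :: real^2)"
  by (simp add: axis_eq_axis)

lemma real2_expand: "(w :: real^2) = w $ 1 *\<^sub>R axis 1 1 + w $ 2 *\<^sub>R axis 2 1"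
  by (simp add: vec_eq_iff forall_2 axis_def)

text \<open>The inverse function theorem, with smoothness: by Cramer's rule the derivative of the inverse is
  a smooth function of the point in the source.\<close>

lemma smooth_local_inverse_plane:
  fixes p1 p2 :: "real^2 \<Rightarrow> real" and V :: "(real^2) set"
  defines "p \<equiv> \<lambda>q. p1 q *\<^sub>R axis 1 1 + p2 q *\<^sub>R axis 2 1 :: real^2"
  assumes V: "open V" "q0 \<in> V" and s1: "smooth_on V p1" and s2: "smooth_on V p2"
    and J: "frechet_derivative p1 (at q0) (axis 1 1) * frechet_derivative p2 (at q0) (axis 2 1)
          - frechet_derivative p1 (at q0) (axis 2 1) * frechet_derivative p2 (at q0) (axis 1 1) \<noteq> 0"
  obtains W \<Phi> where "open W" "p q0 \<in> W" "\<Phi> ` W \<subseteq> V" "\<And>y. y \<in> W \<Longrightarrow> p (\<Phi> y) = y" "\<Phi> (p q0) = q0"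
    "\<And>y. y \<in> W \<Longrightarrow> \<Phi> differentiable (at y)"
    "\<And>a::real^2 \<Rightarrow> real. smooth_on V a \<Longrightarrow> smooth_on W (\<lambda>y. a (\<Phi> y))"
proof -
  define P where "P = (\<lambda>i j q. frechet_derivative (if i = (1::2) then p1 else p2) (at q) (axis (j::2) (1::real)))"
  define Jac where "Jac = (\<lambda>q. P 1 1 q * P 2 2 q - P 1 2 q * P 2 1 q)"
  have sP: "smooth_on V (P i j)" for i j
    unfolding P_def using s1 s2 by (auto intro: smooth_on_derivative)
  have sJ: "smooth_on V Jac" unfolding Jac_def by (intro smooth_on_diff smooth_on_mult sP V)
  define V' where "V' = {q \<in> V. Jac q \<noteq> 0}"
  have "openin (top_of_set V) (V \<inter> Jac -` (- {0}))"
    by (rule continuous_openin_preimage_gen[OF smooth_on_continuous_on[OF sJ]]) auto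
  then have "open (V \<inter> Jac -` (- {0}))" using V(1) openin_open_trans by blast
  moreover have "V \<inter> Jac -` (- {0}) = V'" by (auto simp: V'_def)
  ultimately have V': "open V'" by simp
  have q0: "q0 \<in> V'" using V J by (simp add: V'_def Jac_def P_def)
  define p' where "p' = (\<lambda>q (w::real^2). (w $ 1 * P 1 1 q + w $ 2 * P 1 2 q) *\<^sub>R axis 1 1 + (w $ 1 * P 2 1 q + w $ 2 * P 2 2 q) *\<^sub>R (axis 2 1 :: real^2))"
  have lin: "bounded_linear (p' q)" for q
    unfolding p'_def by (intro bounded_linear_add bounded_linear_scaleR_const bounded_linear_mult_const bounded_linear_vec_nth)
  have dp: "(p has_derivative p' q) (at q)" if "q \<in> V" for q
  proof -
    have d: "(p1 has_derivative frechet_derivative p1 (at q)) (at q)" "(p2 has_derivative frechet_derivative p2 (at q)) (at q)"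
      using smooth_on_has_derivative[OF s1 that] smooth_on_has_derivative[OF s2 that] .
    interpret d1: bounded_linear "frechet_derivative p1 (at q)" by (rule has_derivative_bounded_linear[OF d(1)])
    interpret d2: bounded_linear "frechet_derivative p2 (at q)" by (rule has_derivative_bounded_linear[OF d(2)])
    have "(p has_derivative (\<lambda>w. frechet_derivative p1 (at q) w *\<^sub>R axis 1 1 + frechet_derivative p2 (at q) w *\<^sub>R axis 2 1)) (at q)"
      unfolding p_def by (intro has_derivative_add has_derivative_scaleR_left d)
    moreover have "(\<lambda>w. frechet_derivative p1 (at q) w *\<^sub>R axis 1 1 + frechet_derivative p2 (at q) w *\<^sub>R axis 2 1) = p' q"
    proof
      fix w show "frechet_derivative p1 (at q) w *\<^sub>R axis 1 1 + frechet_derivative p2 (at q) w *\<^sub>R axis 2 1 = p' q w"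
        by (subst (1 2) real2_expand[of w]) (simp add: p'_def P_def d1.add d2.add d1.scaleR d2.scaleR)
    qed
    ultimately show ?thesis by simp
  qed
  define q' where "q' = (\<lambda>q (v::real^2). ((v $ 1 * P 2 2 q - v $ 2 * P 1 2 q) * inverse (Jac q)) *\<^sub>R axis 1 1
      + ((v $ 2 * P 1 1 q - v $ 1 * P 2 1 q) * inverse (Jac q)) *\<^sub>R (axis 2 1 :: real^2))"
  have linq: "bounded_linear (q' q)" for q
    unfolding q'_def by (intro bounded_linear_add bounded_linear_sub bounded_linear_scaleR_const bounded_linear_mult_const bounded_linear_vec_nth)
  have c: "(x *\<^sub>R axis 1 1 + y *\<^sub>R axis 2 1 :: real^2) $ 1 = x" "(x *\<^sub>R axis 1 1 + y *\<^sub>R axis 2 1 :: real^2) $ 2 = y" for x y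
    by (simp_all add: axis_def)
  have inv1: "p' q (q' q v) = v" and inv2: "q' q (p' q v) = v" if "q \<in> V'" for q and v :: "real^2"
  proof -
    have J0: "Jac q \<noteq> 0" using that by (simp add: V'_def)
    have J1: "(P 1 1 q * P 2 2 q - P 1 2 q * P 2 1 q) * inverse (Jac q) = 1" using J0 by (simp add: Jac_def)
    have "(v $ 1 * P 2 2 q - v $ 2 * P 1 2 q) * inverse (Jac q) * P 1 1 q + (v $ 2 * P 1 1 q - v $ 1 * P 2 1 q) * inverse (Jac q) * P 1 2 q
      = v $ 1 * ((P 1 1 q * P 2 2 q - P 1 2 q * P 2 1 q) * inverse (Jac q))" by (simp add: algebra_simps)
    moreover have "(v $ 1 * P 2 2 q - v $ 2 * P 1 2 q) * inverse (Jac q) * P 2 1 q + (v $ 2 * P 1 1 q - v $ 1 * P 2 1 q) * inverse (Jac q) * P 2 2 q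
      = v $ 2 * ((P 1 1 q * P 2 2 q - P 1 2 q * P 2 1 q) * inverse (Jac q))" by (simp add: algebra_simps)
    ultimately show "p' q (q' q v) = v"
      unfolding p'_def q'_def c J1 by (simp flip: real2_expand)
    have "((v $ 1 * P 1 1 q + v $ 2 * P 1 2 q) * P 2 2 q - (v $ 1 * P 2 1 q + v $ 2 * P 2 2 q) * P 1 2 q) * inverse (Jac q)
       = v $ 1 * ((P 1 1 q * P 2 2 q - P 1 2 q * P 2 1 q) * inverse (Jac q))" by (simp add: algebra_simps)
    moreover have "((v $ 1 * P 2 1 q + v $ 2 * P 2 2 q) * P 1 1 q - (v $ 1 * P 1 1 q + v $ 2 * P 1 2 q) * P 2 1 q) * inverse (Jac q)
       = v $ 2 * ((P 1 1 q * P 2 2 q - P 1 2 q * P 2 1 q) * inverse (Jac q))" by (simp add: algebra_simps)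
    ultimately show "q' q (p' q v) = v"
      unfolding p'_def q'_def c J1 by (simp flip: real2_expand)
  qed
  obtain U' W \<Phi> g' where U': "open U'" "U' \<subseteq> V'" "q0 \<in> U'" and W: "open W" "p q0 \<in> W"
    and hom: "homeomorphism U' W p \<Phi>"
    and d\<Phi>: "\<And>y. y \<in> W \<Longrightarrow> (\<Phi> has_derivative (g' y)) (at y)"
    and g': "\<And>y. y \<in> W \<Longrightarrow> g' y = inv (blinfun_apply (Blinfun (p' (\<Phi> y))))"
    and "\<And>y. y \<in> W \<Longrightarrow> bij (blinfun_apply (Blinfun (p' (\<Phi> y))))"
  proof (rule inverse_function_theorem[of V' p "\<lambda>q. Blinfun (p' q)" q0 "Blinfun (q' q0)"])
    show "continuous_on V' (\<lambda>q. Blinfun (p' q))"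
    proof (rule continuous_on_blinfun_componentwise)
      fix i :: "real^2" assume "i \<in> Basis"
      have "continuous_on V' (\<lambda>q. p' q i)"
        unfolding p'_def
        by (intro continuous_intros continuous_on_subset[OF smooth_on_continuous_on[OF sP]]) (auto simp: V'_def)
      then show "continuous_on V' (\<lambda>q. blinfun_apply (Blinfun (p' q)) i)"
        by (simp add: bounded_linear_Blinfun_apply[OF lin])
    qed
    show "Blinfun (q' q0) o\<^sub>L Blinfun (p' q0) = id_blinfun"
      by (rule blinfun_eqI)
        (simp add: bounded_linear_Blinfun_apply[OF lin] bounded_linear_Blinfun_apply[OF linq] inv2[OF q0])
  qed (use V' q0 dp in \<open>auto simp: bounded_linear_Blinfun_apply[OF lin] V'_def\<close>)
  have \<Phi>: "\<Phi> y \<in> V'" "p (\<Phi> y) = y" if "y \<in> W" for y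
    using hom U'(2) that by (auto simp: homeomorphism_def)
  have g'q': "g' y = q' (\<Phi> y)" if "y \<in> W" for y
  proof
    fix v
    have "inj (p' (\<Phi> y))" using inv2[OF \<Phi>(1)[OF that]] by (metis injI)
    then have "inv (p' (\<Phi> y)) v = q' (\<Phi> y) v" using inv1[OF \<Phi>(1)[OF that]] by (metis inv_f_eq)
    then show "g' y v = q' (\<Phi> y) v" using g'[OF that] by (simp add: bounded_linear_Blinfun_apply[OF lin])
  qed
  define B where "B = (\<lambda>(e::real^2) v q. q' q v \<bullet> e)"
  have sB: "smooth_on V' (B e v)" if "e \<in> Basis" for e v
  proof -
    have sP': "smooth_on V' (P i j)" for i j by (rule smooth_on_subset[OF sP]) (auto simp: V'_def)
    have "smooth_on V' (\<lambda>q. (v $ 1 * P 2 2 q - v $ 2 * P 1 2 q) * inverse (Jac q))"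
      "smooth_on V' (\<lambda>q. (v $ 2 * P 1 1 q - v $ 1 * P 2 1 q) * inverse (Jac q))"
      by (intro smooth_on_mult V' smooth_on_diff smooth_on_const sP' smooth_on_inverse smooth_on_subset[OF sJ]; force simp: V'_def)+
    moreover have "q' q v \<bullet> axis 1 1 = (v $ 1 * P 2 2 q - v $ 2 * P 1 2 q) * inverse (Jac q)"
      "q' q v \<bullet> axis 2 1 = (v $ 2 * P 1 1 q - v $ 1 * P 2 1 q) * inverse (Jac q)" for q
      unfolding q'_def inner_axis c by simp_all
    ultimately show ?thesis using that unfolding Basis_real2 B_def by auto
  qed
  have d\<Phi>': "(\<Phi> has_derivative (\<lambda>v. \<Sum>e\<in>Basis. B e v (\<Phi> y) *\<^sub>R e)) (at y)" if "y \<in> W" for y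
    using d\<Phi>[OF that] unfolding g'q'[OF that] B_def by (simp add: euclidean_representation)
  have sm: "smooth_on W (\<lambda>y. a (\<Phi> y))" if "smooth_on V a" for a :: "real^2 \<Rightarrow> real"
    by (rule smooth_on_compose_inverse[OF V' W(1) _ d\<Phi>' sB smooth_on_subset[OF that]])
      (use \<Phi> in \<open>auto simp: V'_def\<close>)
  show thesis
  proof (rule that[OF W _ _ _ _ sm])
    show "\<Phi> ` W \<subseteq> V" using \<Phi> by (auto simp: V'_def)
    show "\<Phi> (p q0) = q0" using hom U'(3) by (auto simp: homeomorphism_def)
    show "\<Phi> differentiable (at y)" if "y \<in> W" for y using d\<Phi>[OF that] by (auto simp: differentiable_def)
  qed (use \<Phi> in auto)
qed

section \<open>Mixed derivatives and the strong minimum principle\<close>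

lemma has_real_derivative_along_line:
  fixes f :: "'a::real_normed_vector \<Rightarrow> real"
  assumes "(f has_derivative f') (at (a + t *\<^sub>R v))"
  shows "((\<lambda>t. f (a + t *\<^sub>R v)) has_real_derivative f' v) (at t)"
proof -
  have "((\<lambda>t. a + t *\<^sub>R v) has_derivative (\<lambda>h. h *\<^sub>R v)) (at t)"
    by (auto intro!: derivative_eq_intros)
  from has_derivative_compose[OF this assms]
  have "((\<lambda>t. f (a + t *\<^sub>R v)) has_derivative (\<lambda>h. f' (h *\<^sub>R v))) (at t)" .
  moreover have "f' (h *\<^sub>R v) = f' v * h" for h
    using linear_scale[OF has_derivative_linear[OF assms], of h v] by simp
  ultimately show ?thesis by (simp add: has_field_derivative_def)
qed

text \<open>The mean value theorem, once in each direction.\<close>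

lemma second_difference:
  fixes f :: "'a::euclidean_space \<Rightarrow> real"
  assumes C: "Ck_on 2 S f" and r: "r > 0"
    and S: "\<And>s t. 0 \<le> s \<Longrightarrow> s \<le> r \<Longrightarrow> 0 \<le> t \<Longrightarrow> t \<le> r \<Longrightarrow> x + s *\<^sub>R v + t *\<^sub>R w \<in> S"
  obtains s t where "0 < s" "s < r" "0 < t" "t < r"
    "f (x + r *\<^sub>R v + r *\<^sub>R w) - f (x + r *\<^sub>R v) - (f (x + r *\<^sub>R w) - f x)
      = r * r * frechet_derivative (\<lambda>y. frechet_derivative f (at y) v) (at (x + s *\<^sub>R v + t *\<^sub>R w)) w"
proof -
  let ?f1 = "\<lambda>y. frechet_derivative f (at y) v"
  have d1: "(f has_derivative frechet_derivative f (at y)) (at y)" if "y \<in> S" for y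
    using C that by (auto simp: numeral_2_eq_2 frechet_derivative_works)
  have d2: "(?f1 has_derivative frechet_derivative ?f1 (at y)) (at y)" if "y \<in> S" for y
    using C that by (auto simp: numeral_2_eq_2 frechet_derivative_works)
  have "((\<lambda>s. f (x + r *\<^sub>R w + s *\<^sub>R v) - f (x + s *\<^sub>R v)) has_real_derivative
      ?f1 (x + r *\<^sub>R w + s *\<^sub>R v) - ?f1 (x + s *\<^sub>R v)) (at s)" if "0 \<le> s" "s \<le> r" for s
    using S[of s r] S[of s 0] that r
    by (intro DERIV_diff has_real_derivative_along_line d1) (simp_all add: add_ac)
  then have "\<exists>s>0. s < r \<and> f (x + r *\<^sub>R w + r *\<^sub>R v) - f (x + r *\<^sub>R v) - (f (x + r *\<^sub>R w + 0 *\<^sub>R v) - f (x + 0 *\<^sub>R v))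
      = (r - 0) * (?f1 (x + r *\<^sub>R w + s *\<^sub>R v) - ?f1 (x + s *\<^sub>R v))"
    by (rule MVT2[OF r])
  then obtain s where s: "0 < s" "s < r"
    "f (x + r *\<^sub>R w + r *\<^sub>R v) - f (x + r *\<^sub>R v) - (f (x + r *\<^sub>R w + 0 *\<^sub>R v) - f (x + 0 *\<^sub>R v))
      = (r - 0) * (?f1 (x + r *\<^sub>R w + s *\<^sub>R v) - ?f1 (x + s *\<^sub>R v))"
    by (elim exE conjE) (rule that)
  have "((\<lambda>t. ?f1 (x + s *\<^sub>R v + t *\<^sub>R w)) has_real_derivative
      frechet_derivative ?f1 (at (x + s *\<^sub>R v + t *\<^sub>R w)) w) (at t)" if "0 \<le> t" "t \<le> r" for t
    using S[of s t] that s(1,2) by (intro has_real_derivative_along_line d2) simp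
  then have "\<exists>t>0. t < r \<and> ?f1 (x + s *\<^sub>R v + r *\<^sub>R w) - ?f1 (x + s *\<^sub>R v + 0 *\<^sub>R w)
      = (r - 0) * frechet_derivative ?f1 (at (x + s *\<^sub>R v + t *\<^sub>R w)) w"
    by (rule MVT2[OF r])
  then obtain t where t: "0 < t" "t < r"
    "?f1 (x + s *\<^sub>R v + r *\<^sub>R w) - ?f1 (x + s *\<^sub>R v + 0 *\<^sub>R w)
      = (r - 0) * frechet_derivative ?f1 (at (x + s *\<^sub>R v + t *\<^sub>R w)) w"
    by (elim exE conjE) (rule that)
  show thesis
  proof (rule that[OF s(1,2) t(1,2)])
    have "f (x + r *\<^sub>R v + r *\<^sub>R w) - f (x + r *\<^sub>R v) - (f (x + r *\<^sub>R w) - f x)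
       = r * (?f1 (x + s *\<^sub>R v + r *\<^sub>R w) - ?f1 (x + s *\<^sub>R v))"
      using s(3) by (simp add: add_ac)
    also have "?f1 (x + s *\<^sub>R v + r *\<^sub>R w) - ?f1 (x + s *\<^sub>R v) = r * frechet_derivative ?f1 (at (x + s *\<^sub>R v + t *\<^sub>R w)) w"
      using t(3) by simp
    finally show "f (x + r *\<^sub>R v + r *\<^sub>R w) - f (x + r *\<^sub>R v) - (f (x + r *\<^sub>R w) - f x)
      = r * r * frechet_derivative ?f1 (at (x + s *\<^sub>R v + t *\<^sub>R w)) w" by simp
  qed
qed

text \<open>The second difference is symmetric in the two directions, and divided by \<open>r^2\<close> it tends to
  either of the two mixed derivatives.\<close>

lemma mixed_derivatives_commute:
  fixes f :: "'a::euclidean_space \<Rightarrow> real"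
  assumes S: "open S" "x \<in> S" and C: "Ck_on 2 S f"
  shows "frechet_derivative (\<lambda>y. frechet_derivative f (at y) v) (at x) w
       = frechet_derivative (\<lambda>y. frechet_derivative f (at y) w) (at x) v"
proof (rule ccontr)
  let ?A = "\<lambda>z. frechet_derivative (\<lambda>y. frechet_derivative f (at y) v) (at z) w"
  let ?B = "\<lambda>z. frechet_derivative (\<lambda>y. frechet_derivative f (at y) w) (at z) v"
  assume neq: "?A x \<noteq> ?B x"
  define e where "e = \<bar>?A x - ?B x\<bar> / 2"
  have e: "e > 0" using neq by (simp add: e_def)
  have "continuous_on S ?A" "continuous_on S ?B" using C by (auto simp: numeral_2_eq_2)
  then have "isCont ?A x" "isCont ?B x" using S by (auto simp: continuous_on_eq_continuous_at)
  then obtain dA dB where d: "dA > 0" "dB > 0"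
    "\<And>z. dist z x < dA \<Longrightarrow> dist (?A z) (?A x) < e" "\<And>z. dist z x < dB \<Longrightarrow> dist (?B z) (?B x) < e"
    using e unfolding continuous_at_eps_delta by metis
  obtain dS where dS: "dS > 0" "ball x dS \<subseteq> S" using S open_contains_ball by blast
  define d where "d = min dS (min dA dB)"
  define r where "r = d / (2 * (norm v + norm w + 1))"
  have d0: "d > 0" using d dS by (simp add: d_def)
  have nv: "norm v + norm w + 1 > 0" by (smt (verit) norm_ge_zero)
  have r: "r > 0" using d0 nv by (simp add: r_def)
  have close: "dist (x + s *\<^sub>R a + t *\<^sub>R b) x < d"
    if "0 \<le> s" "s \<le> r" "0 \<le> t" "t \<le> r" and ab: "norm a + norm b = norm v + norm w" for s t a b
  proof -
    have "dist (x + s *\<^sub>R a + t *\<^sub>R b) x = norm (s *\<^sub>R a + t *\<^sub>R b)" by (simp add: dist_norm add.assoc)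
    also have "\<dots> \<le> s * norm a + t * norm b" using that by (intro order_trans[OF norm_triangle_ineq]) auto
    also have "\<dots> \<le> r * norm a + r * norm b" using that by (intro add_mono mult_right_mono) auto
    also have "\<dots> = r * (norm v + norm w)" using ab by (simp flip: distrib_left)
    also have "\<dots> \<le> r * (norm v + norm w + 1)" using r by (intro mult_left_mono) auto
    also have "\<dots> = d / 2" using nv unfolding r_def by (simp add: divide_simps)
    finally show ?thesis using d0 by simp
  qed
  have inS: "x + s *\<^sub>R a + t *\<^sub>R b \<in> S"
    if "0 \<le> s" "s \<le> r" "0 \<le> t" "t \<le> r" "norm a + norm b = norm v + norm w" for s t a b
    using close[OF that] dS by (auto simp: d_def dist_commute)
  obtain s t where 1: "0 < s" "s < r" "0 < t" "t < r"
    "f (x + r *\<^sub>R v + r *\<^sub>R w) - f (x + r *\<^sub>R v) - (f (x + r *\<^sub>R w) - f x) = r * r * ?A (x + s *\<^sub>R v + t *\<^sub>R w)"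
    by (rule second_difference[OF C r, of x v w]) (use inS in auto)
  obtain s' t' where 2: "0 < s'" "s' < r" "0 < t'" "t' < r"
    "f (x + r *\<^sub>R w + r *\<^sub>R v) - f (x + r *\<^sub>R w) - (f (x + r *\<^sub>R v) - f x) = r * r * ?B (x + s' *\<^sub>R w + t' *\<^sub>R v)"
    by (rule second_difference[OF C r, of x w v]) (use inS in auto)
  have "r * r * ?A (x + s *\<^sub>R v + t *\<^sub>R w) = r * r * ?B (x + s' *\<^sub>R w + t' *\<^sub>R v)"
  proof -
    have swap: "x + r *\<^sub>R w + r *\<^sub>R v = x + r *\<^sub>R v + r *\<^sub>R w" by (simp add: add_ac)
    have "f (x + r *\<^sub>R v + r *\<^sub>R w) - f (x + r *\<^sub>R v) - (f (x + r *\<^sub>R w) - f x)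
      = f (x + r *\<^sub>R w + r *\<^sub>R v) - f (x + r *\<^sub>R w) - (f (x + r *\<^sub>R v) - f x)"
      unfolding swap by simp
    from 1(5)[symmetric, THEN trans, OF trans[OF this 2(5)]] show ?thesis .
  qed
  then have eq: "?A (x + s *\<^sub>R v + t *\<^sub>R w) = ?B (x + s' *\<^sub>R w + t' *\<^sub>R v)" using r by simp
  have "dist (?A (x + s *\<^sub>R v + t *\<^sub>R w)) (?A x) < e"
    by (rule d(3)) (use close[of s t v w] 1 in \<open>auto simp: d_def\<close>)
  moreover have "dist (?B (x + s' *\<^sub>R w + t' *\<^sub>R v)) (?B x) < e"
    by (rule d(4)) (use close[of s' t' w v] 2 in \<open>auto simp: d_def\<close>)
  moreover have "\<not> (dist c a < \<bar>a - b\<bar> / 2 \<and> dist c b < \<bar>a - b\<bar> / 2)" for a b c :: real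
    unfolding dist_real_def[of a b, symmetric] using dist_triangle3[of a b c] by linarith
  ultimately show False unfolding eq e_def by blast
qed

lemma second_derivative_at_minimum:
  fixes \<phi> \<phi>' :: "real \<Rightarrow> real"
  assumes d: "d > 0" and 1: "\<And>t. \<bar>t\<bar> < d \<Longrightarrow> (\<phi> has_real_derivative \<phi>' t) (at t)"
    and 2: "(\<phi>' has_real_derivative l) (at 0)" and min: "\<And>t. \<bar>t\<bar> < d \<Longrightarrow> \<phi> 0 \<le> \<phi> t"
  shows "\<phi>' 0 = 0" "l \<ge> 0"
proof -
  show 0: "\<phi>' 0 = 0"
    by (rule DERIV_local_min[OF 1[of 0] d]) (use d min in auto)
  show "l \<ge> 0"
  proof (rule ccontr)
    assume "\<not> l \<ge> 0"
    then obtain e where e: "e > 0" "\<And>h. 0 < h \<Longrightarrow> h < e \<Longrightarrow> \<phi>' (0 + h) < \<phi>' 0"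
      using DERIV_neg_dec_right[OF 2] by auto
    define t where "t = min d e / 2"
    have t: "0 < t" "t < d" "t < e" using d e by (auto simp: t_def)
    obtain z where z: "0 < z" "z < t" "\<phi> t - \<phi> 0 = (t - 0) * \<phi>' z"
      using MVT2[of 0 t \<phi> \<phi>'] 1 t by auto
    have "\<phi>' z < 0" using e(2)[of z] z t 0 by simp
    then have "\<phi> t - \<phi> 0 < 0" using z t by (simp add: mult_pos_neg)
    then show False using min[of t] t by simp
  qed
qed

text \<open>The operator is the Laplacian plus the second derivative in the direction of the vector field
  \<open>n\<close>, so it is uniformly elliptic without a further condition. If \<open>g\<close> were positive somewhere near its zero \<open>y0\<close>,
  a largest ball on which \<open>g > 0\<close> would touch the zero set. On the outer half of that ball \<open>g\<close> stays
  above a multiple of a strict subsolution that vanishes on the sphere with nonzero slope, which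
  contradicts that the gradient of \<open>g\<close> vanishes at the touching point, an interior minimum.\<close>

theorem hopf_strong_minimum_principle:
  fixes g :: "real^2 \<Rightarrow> real" and n :: "real^2 \<Rightarrow> real^2" and y0 :: "real^2"
  defines "g1 \<equiv> \<lambda>v y. frechet_derivative g (at y) v"
  defines "g2 \<equiv> \<lambda>v y. frechet_derivative (g1 v) (at y) v"
  assumes B: "ball y0 r \<subseteq> B" "r > 0" and C2: "Ck_on 2 B g" and C: "C \<ge> 0"
    and nonneg: "\<And>y. y \<in> B \<Longrightarrow> g y \<ge> 0" and g0: "g y0 = 0"
    and n: "\<And>y. y \<in> B \<Longrightarrow> norm (n y) \<le> C"
    and ineq: "\<And>y. y \<in> B \<Longrightarrow> g2 (axis 1 1) y + g2 (axis 2 1) y + g2 (n y) y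
        \<le> C * (\<bar>g1 (axis 1 1) y\<bar> + \<bar>g1 (axis 2 1) y\<bar>)"
    and y1: "y1 \<in> ball y0 (r/2)"
  shows "g y1 = 0"
proof (rule ccontr)
  assume "g y1 \<noteq> 0"
  have y1B: "y \<in> B" if "dist y1 y \<le> dist y1 y0" for y
  proof -
    have "dist y0 y \<le> dist y1 y0 + dist y1 y" by (metis dist_commute dist_triangle)
    then show ?thesis using that y1 B by (auto simp: dist_commute)
  qed
  have gy1: "g y1 > 0" using \<open>g y1 \<noteq> 0\<close> nonneg[OF y1B[of y1]] by simp
  have cg: "continuous_on B g" using C2
    by (auto simp: numeral_2_eq_2 intro!: continuous_at_imp_continuous_on differentiable_imp_continuous_within)
  have dg: "(g has_derivative frechet_derivative g (at y)) (at y)" if "y \<in> B" for y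
    using C2 that by (auto simp: numeral_2_eq_2 frechet_derivative_works)
  have dg1: "(g1 v has_derivative frechet_derivative (g1 v) (at y)) (at y)" if "y \<in> B" for y v
    using C2 that unfolding g1_def by (auto simp: numeral_2_eq_2 frechet_derivative_works)
  have line1: "((\<lambda>t. g (y + t *\<^sub>R v)) has_real_derivative g1 v (y + t *\<^sub>R v)) (at t)" if "y + t *\<^sub>R v \<in> B" for y v t
    unfolding g1_def by (rule has_real_derivative_along_line[OF dg[OF that]])
  have line2: "((\<lambda>t. g1 v (y + t *\<^sub>R v)) has_real_derivative g2 v y) (at 0)" if "y \<in> B" for y v
    unfolding g2_def using has_real_derivative_along_line[of "g1 v" "frechet_derivative (g1 v) (at y)" y 0 v] dg1[OF that]
    by simp
  \<comment> \<open>A largest ball around \<open>y1\<close> on which \<open>g\<close> is positive touches the zero set at \<open>ys\<close>.\<close>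
  define Z where "Z = cball y1 (dist y1 y0) \<inter> g -` {0}"
  have "closedin (top_of_set (cball y1 (dist y1 y0))) Z"
    unfolding Z_def by (rule continuous_closedin_preimage[OF continuous_on_subset[OF cg]]) (use y1B in auto)
  then have "compact Z" using compact_cball closedin_compact by blast
  moreover have "y0 \<in> Z" using g0 by (simp add: Z_def)
  ultimately obtain ys where ys: "ys \<in> Z" "\<And>y. y \<in> Z \<Longrightarrow> dist y1 ys \<le> dist y1 y"
    using distance_attains_inf[of Z y1] compact_imp_closed by blast
  define R where "R = dist y1 ys"
  have R: "R > 0" using ys(1) gy1 by (auto simp: R_def Z_def)
  have Rle: "R \<le> dist y1 y0" using ys(2)[OF \<open>y0 \<in> Z\<close>] by (simp add: R_def)
  have RB: "y \<in> B" if "dist y1 y \<le> R" for y using that Rle y1B by auto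
  have gpos: "g y > 0" if "dist y1 y < R" for y
  proof -
    have "g y \<noteq> 0" using ys(2)[of y] that Rle by (auto simp: Z_def R_def)
    then show ?thesis using nonneg[OF RB[of y]] that by simp
  qed
  have gys: "g ys = 0" "ys \<in> B" using ys(1) RB[of ys] by (auto simp: Z_def R_def)
  \<comment> \<open>The exponent is large enough for the second derivatives of the barrier, of order \<open>\<alpha>\<^sup>2 R\<^sup>2\<close>, to
    dominate the remaining terms, of order \<open>\<alpha> (1 + C\<^sup>2 + C R)\<close>, on the outer half of the ball.\<close>
  define \<alpha> where "\<alpha> = (2 * (2 + C\<^sup>2) + 4 * C * R + 1) / R\<^sup>2"
  have \<alpha>: "\<alpha> > 0"
  proof -
    have "0 \<le> 4 * C * R" using C R by simp
    then have "2 * (2 + C\<^sup>2) + 4 * C * R + 1 > 0"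
      by (intro add_nonneg_pos[OF add_nonneg_nonneg]) auto
    then show ?thesis using R by (simp add: \<alpha>_def)
  qed
  define w where "w = (\<lambda>y. exp (- \<alpha> * ((y - y1) \<bullet> (y - y1))) - exp (- \<alpha> * R\<^sup>2))"
  define E where "E = (\<lambda>y::real^2. exp (- \<alpha> * ((y - y1) \<bullet> (y - y1))))"
  define w1 where "w1 = (\<lambda>v y. - 2 * \<alpha> * ((y - y1) \<bullet> v) * E y)"
  define w2 where "w2 = (\<lambda>v y. (4 * \<alpha>\<^sup>2 * ((y - y1) \<bullet> v)\<^sup>2 - 2 * \<alpha> * (v \<bullet> v)) * E y)"
  have dE: "((\<lambda>t. E (y + t *\<^sub>R v)) has_real_derivative - 2 * \<alpha> * ((y + t *\<^sub>R v - y1) \<bullet> v) * E (y + t *\<^sub>R v)) (at t)" for y v t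
  proof -
    have 1: "(y + t *\<^sub>R v - y1) \<bullet> (y + t *\<^sub>R v - y1) = (y - y1) \<bullet> (y - y1) + 2 * t * ((y - y1) \<bullet> v) + t\<^sup>2 * (v \<bullet> v)" for t
      by (simp add: inner_simps inner_commute power2_eq_square algebra_simps)
    have 2: "(y + t *\<^sub>R v - y1) \<bullet> v = (y - y1) \<bullet> v + t * (v \<bullet> v)" by (simp add: inner_simps algebra_simps)
    show ?thesis unfolding E_def 1 2 by (auto intro!: derivative_eq_intros simp: algebra_simps)
  qed
  have lw1: "((\<lambda>t. w (y + t *\<^sub>R v)) has_real_derivative w1 v (y + t *\<^sub>R v)) (at t)" for y v t
    using DERIV_diff[OF dE[of y v t] DERIV_const[of "exp (- \<alpha> * R\<^sup>2)"]] by (simp add: w_def w1_def E_def)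
  have lw2: "((\<lambda>t. w1 v (y + t *\<^sub>R v)) has_real_derivative w2 v y) (at 0)" for y v
  proof -
    have "((\<lambda>t. (y + t *\<^sub>R v - y1) \<bullet> v) has_real_derivative v \<bullet> v) (at 0)"
      by (simp add: inner_simps) (auto intro!: derivative_eq_intros)
    then have "((\<lambda>t. - 2 * \<alpha> * ((y + t *\<^sub>R v - y1) \<bullet> v) * E (y + t *\<^sub>R v)) has_real_derivative
        - 2 * \<alpha> * (v \<bullet> v) * E (y + 0 *\<^sub>R v) + (- 2 * \<alpha> * ((y + 0 *\<^sub>R v - y1) \<bullet> v) * E (y + 0 *\<^sub>R v)) * (- 2 * \<alpha> * ((y + 0 *\<^sub>R v - y1) \<bullet> v))) (at 0)"
      by (intro DERIV_mult[OF DERIV_cmult dE])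
    then show ?thesis unfolding w1_def w2_def by (simp add: power2_eq_square algebra_simps)
  qed
  have cw: "continuous_on A w" for A unfolding w_def by (intro continuous_intros)
  have w_le: "w y \<le> 1" for y
  proof -
    have "exp (- \<alpha> * ((y - y1) \<bullet> (y - y1))) \<le> 1" using \<alpha> by (simp add: mult_nonneg_nonneg)
    then show ?thesis unfolding w_def by (smt (verit) exp_gt_zero)
  qed
  have w_outer: "w y = 0" if "dist y1 y = R" for y
    using that by (simp add: w_def dist_norm norm_minus_commute flip: power2_norm_eq_inner)
  obtain m where m: "m > 0" "\<And>y. dist y1 y = R / 2 \<Longrightarrow> m \<le> g y"
  proof -
    have "sphere y1 (R/2) \<noteq> {}" using R by simp
    moreover have "continuous_on (sphere y1 (R/2)) g"
      by (rule continuous_on_subset[OF cg]) (use RB R in auto)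
    ultimately obtain z where "z \<in> sphere y1 (R/2)" "\<forall>y\<in>sphere y1 (R/2). g z \<le> g y"
      using continuous_attains_inf[OF compact_sphere] by blast
    then show ?thesis using that[of "g z"] gpos[of z] R by auto
  qed
  define K where "K = cball y1 R - ball y1 (R/2)"
  have "compact K" unfolding K_def by (intro compact_diff) auto
  have KB: "K \<subseteq> B" using RB by (auto simp: K_def)
  have barrier: "m * w y \<le> g y" if "y \<in> K" for y
  proof -
    have "continuous_on K (\<lambda>y. g y - m * w y)"
      by (intro continuous_intros cw continuous_on_subset[OF cg KB])
    moreover have "K \<noteq> {}" using that by auto
    ultimately have "\<exists>p\<in>K. \<forall>y\<in>K. g p - m * w p \<le> g y - m * w y"
      by (intro continuous_attains_inf[OF \<open>compact K\<close>])
    then obtain p where p: "p \<in> K" "\<And>y. y \<in> K \<Longrightarrow> g p - m * w p \<le> g y - m * w y" by auto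
    have "g p - m * w p \<ge> 0"
    proof (rule ccontr)
      assume neg: "\<not> g p - m * w p \<ge> 0"
      have "dist y1 p \<noteq> R" using neg w_outer nonneg[of p] KB p(1) by auto
      moreover have "dist y1 p \<noteq> R / 2"
      proof
        assume "dist y1 p = R / 2"
        moreover have "m * w p \<le> m * 1" using m(1) w_le by (intro mult_left_mono) auto
        ultimately show False using neg m(2)[of p] by simp
      qed
      ultimately have pd: "R / 2 < dist y1 p" "dist y1 p < R" using p(1) by (auto simp: K_def)
      have pB: "p \<in> B" using p(1) KB by auto
      define d where "d = min (dist y1 p - R / 2) (R - dist y1 p)"
      have d: "d > 0" using pd by (simp add: d_def)
      have crit: "g1 v p = m * w1 v p \<and> m * w2 v p \<le> g2 v p" for v
      proof -
        define \<delta> where "\<delta> = d / (norm v + 1)"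
        have nv: "norm v + 1 > 0" by (smt (verit) norm_ge_zero)
        have \<delta>: "\<delta> > 0" using d nv by (simp add: \<delta>_def)
        have tK: "p + t *\<^sub>R v \<in> K" if "\<bar>t\<bar> < \<delta>" for t
        proof -
          have "\<bar>t\<bar> * norm v \<le> \<bar>t\<bar> * (norm v + 1)" by (intro mult_left_mono) auto
          also have "\<dots> \<le> \<delta> * (norm v + 1)" using that nv by (intro mult_right_mono) auto
          also have "\<dots> = d" using nv by (simp add: \<delta>_def)
          finally have "dist p (p + t *\<^sub>R v) \<le> d" by (simp add: dist_norm)
          moreover have "dist y1 (p + t *\<^sub>R v) \<le> dist y1 p + dist p (p + t *\<^sub>R v)" by (rule dist_triangle)
          moreover have "dist y1 p \<le> dist y1 (p + t *\<^sub>R v) + dist p (p + t *\<^sub>R v)" by (metis dist_triangle dist_commute)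
          ultimately show ?thesis by (auto simp: K_def d_def)
        qed
        let ?\<phi> = "\<lambda>t. g (p + t *\<^sub>R v) - m * w (p + t *\<^sub>R v)"
        let ?\<phi>' = "\<lambda>t. g1 v (p + t *\<^sub>R v) - m * w1 v (p + t *\<^sub>R v)"
        have 1: "(?\<phi> has_real_derivative ?\<phi>' t) (at t)" if "\<bar>t\<bar> < \<delta>" for t
          using tK[OF that] KB by (intro DERIV_diff line1 DERIV_cmult lw1) auto
        have 2: "(?\<phi>' has_real_derivative (g2 v p - m * w2 v p)) (at 0)"
          by (intro DERIV_diff line2 pB DERIV_cmult lw2)
        have 3: "?\<phi> 0 \<le> ?\<phi> t" if "\<bar>t\<bar> < \<delta>" for t using p(2)[OF tK[OF that]] by simp
        from second_derivative_at_minimum[OF \<delta> 1 2 3] show ?thesis by simp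
      qed
      define z where "z = p - y1"
      define \<rho> where "\<rho> = norm z"
      have \<rho>: "R / 2 < \<rho>" "\<rho> < R" using pd by (auto simp: \<rho>_def z_def dist_norm norm_minus_commute)
      have zz: "(z $ 1)\<^sup>2 + (z $ 2)\<^sup>2 = \<rho>\<^sup>2" unfolding \<rho>_def power2_norm_eq_inner by (simp add: inner_vec_def sum_2 power2_eq_square)
      have za: "\<bar>z $ 1\<bar> \<le> \<rho>" "\<bar>z $ 2\<bar> \<le> \<rho>" unfolding \<rho>_def by (rule component_le_norm_cart)+
      have E0: "E p > 0" by (simp add: E_def)
      have "w2 (axis 1 1) p + w2 (axis 2 1) p + w2 (n p) p
          = (4 * \<alpha>\<^sup>2 * \<rho>\<^sup>2 + 4 * \<alpha>\<^sup>2 * (z \<bullet> n p)\<^sup>2 - 2 * \<alpha> * (2 + (norm (n p))\<^sup>2)) * E p"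
        unfolding w2_def z_def[symmetric] zz[symmetric] power2_norm_eq_inner
        by (simp add: inner_axis axis_def inner_vec_def sum_2 algebra_simps)
      also have "\<dots> \<ge> (4 * \<alpha>\<^sup>2 * (R/2)\<^sup>2 - 2 * \<alpha> * (2 + C\<^sup>2)) * E p"
      proof -
        have "4 * \<alpha>\<^sup>2 * (R/2)\<^sup>2 \<le> 4 * \<alpha>\<^sup>2 * \<rho>\<^sup>2" using \<rho> R by (intro mult_left_mono power_mono) auto
        then have "4 * \<alpha>\<^sup>2 * (R/2)\<^sup>2 \<le> 4 * \<alpha>\<^sup>2 * \<rho>\<^sup>2 + 4 * \<alpha>\<^sup>2 * (z \<bullet> n p)\<^sup>2"
          by (rule add_increasing2[rotated]) simp
        moreover have "2 * \<alpha> * (2 + (norm (n p))\<^sup>2) \<le> 2 * \<alpha> * (2 + C\<^sup>2)"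
          using n[OF pB] \<alpha> by (intro mult_left_mono add_left_mono power_mono) auto
        ultimately have "4 * \<alpha>\<^sup>2 * (R/2)\<^sup>2 - 2 * \<alpha> * (2 + C\<^sup>2)
          \<le> 4 * \<alpha>\<^sup>2 * \<rho>\<^sup>2 + 4 * \<alpha>\<^sup>2 * (z \<bullet> n p)\<^sup>2 - 2 * \<alpha> * (2 + (norm (n p))\<^sup>2)" by (rule diff_mono)
        then show ?thesis by (rule mult_right_mono) (use E0 in simp)
      qed
      finally have L: "(4 * \<alpha>\<^sup>2 * (R/2)\<^sup>2 - 2 * \<alpha> * (2 + C\<^sup>2)) * E p \<le> w2 (axis 1 1) p + w2 (axis 2 1) p + w2 (n p) p" .
      have "\<bar>w1 (axis 1 1) p\<bar> + \<bar>w1 (axis 2 1) p\<bar> = 2 * \<alpha> * (\<bar>z $ 1\<bar> + \<bar>z $ 2\<bar>) * E p"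
        unfolding w1_def z_def[symmetric] using \<alpha> E0 by (simp add: inner_axis abs_mult algebra_simps)
      also have "\<dots> \<le> 2 * \<alpha> * (2 * R) * E p" using za \<rho> \<alpha> E0 by (intro mult_right_mono mult_left_mono) auto
      finally have "C * (\<bar>w1 (axis 1 1) p\<bar> + \<bar>w1 (axis 2 1) p\<bar>) \<le> C * (2 * \<alpha> * (2 * R) * E p)"
        using C by (rule mult_left_mono)
      also have "\<dots> = (2 * \<alpha> * (2 * C * R)) * E p" by simp
      also have "\<dots> < (4 * \<alpha>\<^sup>2 * (R/2)\<^sup>2 - 2 * \<alpha> * (2 + C\<^sup>2)) * E p"
      proof (rule mult_strict_right_mono[OF _ E0])
        have "\<alpha> * R\<^sup>2 = 2 * (2 + C\<^sup>2) + 4 * C * R + 1" using R by (simp add: \<alpha>_def)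
        then have "\<alpha> * (\<alpha> * R\<^sup>2) = \<alpha> * (2 * (2 + C\<^sup>2) + 4 * C * R + 1)" by simp
        then show "2 * \<alpha> * (2 * C * R) < 4 * \<alpha>\<^sup>2 * (R/2)\<^sup>2 - 2 * \<alpha> * (2 + C\<^sup>2)"
          using \<alpha> by (simp add: power2_eq_square algebra_simps)
      qed
      also note L
      finally have "m * (C * (\<bar>w1 (axis 1 1) p\<bar> + \<bar>w1 (axis 2 1) p\<bar>)) < m * (w2 (axis 1 1) p + w2 (axis 2 1) p + w2 (n p) p)"
        using m(1) by (rule mult_strict_left_mono)
      also have "\<dots> \<le> g2 (axis 1 1) p + g2 (axis 2 1) p + g2 (n p) p"
        using crit by (simp add: distrib_left add_mono)
      also have "\<dots> \<le> C * (\<bar>g1 (axis 1 1) p\<bar> + \<bar>g1 (axis 2 1) p\<bar>)" by (rule ineq[OF pB])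
      also have "\<dots> = m * (C * (\<bar>w1 (axis 1 1) p\<bar> + \<bar>w1 (axis 2 1) p\<bar>))"
        using crit m(1) by (simp add: abs_mult algebra_simps)
      finally show False by simp
    qed
    then show ?thesis using p(2)[OF that] by simp
  qed
  \<comment> \<open>The gradient of \<open>g\<close> vanishes at \<open>ys\<close>, but the barrier below \<open>g\<close> has positive slope inwards there.\<close>
  define v where "v = y1 - ys"
  have nv: "norm v = R" by (simp add: v_def R_def dist_norm)
  have g1ys: "g1 v ys = 0"
  proof -
    have "dist y0 ys < r"
    proof -
      have "dist y0 ys \<le> dist y1 y0 + dist y1 ys" by (metis dist_commute dist_triangle)
      then show ?thesis using Rle y1 by (auto simp: R_def dist_commute)
    qed
    then have "ys \<in> ball y0 r" by simp
    then obtain e where e: "e > 0" "ball ys e \<subseteq> ball y0 r" by (rule openE[OF open_ball]) (rule that)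
    have "ys + t *\<^sub>R v \<in> B" if "\<bar>t\<bar> < e / R" for t
    proof -
      have "dist ys (ys + t *\<^sub>R v) < e" using that R by (simp add: dist_norm nv field_simps)
      then show ?thesis using e B by auto
    qed
    then have "g1 v (ys + 0 *\<^sub>R v) = 0"
      by (intro second_derivative_at_minimum(1)[of "e / R" "\<lambda>t. g (ys + t *\<^sub>R v)" "\<lambda>t. g1 v (ys + t *\<^sub>R v)", OF _ line1 line2[OF gys(2)]])
        (use e R gys nonneg in auto)
    then show ?thesis by simp
  qed
  let ?\<chi> = "\<lambda>t. g (ys + t *\<^sub>R v) - m * w (ys + t *\<^sub>R v)"
  have "(?\<chi> has_real_derivative (g1 v (ys + 0 *\<^sub>R v) - m * w1 v (ys + 0 *\<^sub>R v))) (at 0)"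
    using gys by (intro DERIV_diff line1 DERIV_cmult lw1) simp
  moreover have "g1 v (ys + 0 *\<^sub>R v) - m * w1 v (ys + 0 *\<^sub>R v) < 0"
  proof -
    have "w1 v ys = 2 * \<alpha> * (v \<bullet> v) * E ys" unfolding w1_def v_def by (simp add: inner_simps algebra_simps)
    moreover have "v \<bullet> v > 0" using nv R by (metis inner_gt_zero_iff norm_zero less_irrefl)
    ultimately have "w1 v ys > 0" using \<alpha> by (simp add: E_def)
    then show ?thesis using g1ys m(1) by simp
  qed
  ultimately obtain e where e: "e > 0" "\<And>h. 0 < h \<Longrightarrow> h < e \<Longrightarrow> ?\<chi> (0 + h) < ?\<chi> 0"
    using DERIV_neg_dec_right by blast
  define h where "h = min e (1 / 2) / 2"
  have h: "0 < h" "h < e" "h \<le> 1 / 2" using e by (auto simp: h_def)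
  have "ys + h *\<^sub>R v \<in> K"
  proof -
    have "y1 - (ys + h *\<^sub>R v) = (1 - h) *\<^sub>R v" by (simp add: v_def algebra_simps)
    then have "dist y1 (ys + h *\<^sub>R v) = (1 - h) * R" using h nv by (simp add: dist_norm)
    moreover have "0 \<le> h * R" "h * R \<le> 1 / 2 * R" using h R by (auto intro!: mult_right_mono)
    ultimately show ?thesis using R by (auto simp: K_def left_diff_distrib)
  qed
  from barrier[OF this] have "?\<chi> h \<ge> 0" by simp
  moreover have "?\<chi> 0 = 0" using gys w_outer[of ys] by (simp add: R_def)
  ultimately show False using e(2)[OF h(1,2)] by simp
qed

section \<open>Surfaces as local graphs\<close>

definition orthonormal_frame :: "real^3 \<Rightarrow> real^3 \<Rightarrow> real^3 \<Rightarrow> bool" where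
  "orthonormal_frame a b c \<longleftrightarrow>
     norm a = 1 \<and> norm b = 1 \<and> norm c = 1 \<and> a \<bullet> b = 0 \<and> a \<bullet> c = 0 \<and> b \<bullet> c = 0"

definition pderiv2 :: "2 \<Rightarrow> (real^2 \<Rightarrow> real) \<Rightarrow> real^2 \<Rightarrow> real" where
  "pderiv2 i f y = frechet_derivative f (at y) (axis i 1)"

text \<open>The ratio of the area element of the graph of \<open>f\<close> to that of the plane.\<close>

definition slope_factor :: "(real^2 \<Rightarrow> real) \<Rightarrow> real^2 \<Rightarrow> real" where
  "slope_factor f y = sqrt (1 + (pderiv2 1 f y)\<^sup>2 + (pderiv2 2 f y)\<^sup>2)"

definition graph_over :: "real^3 \<Rightarrow> real^3 \<Rightarrow> real^3 \<Rightarrow> real^3 \<Rightarrow> (real^2 \<Rightarrow> real) \<Rightarrow> real^2 \<Rightarrow> real^3" where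
  "graph_over p a b c f y = p + y $ 1 *\<^sub>R a + y $ 2 *\<^sub>R b + f y *\<^sub>R c"

text \<open>The horizontal components of the upward unit normal, up to sign. Their divergence is, again up
  to sign, twice the mean curvature.\<close>

abbreviation unit_slope :: "2 \<Rightarrow> (real^2 \<Rightarrow> real) \<Rightarrow> real^2 \<Rightarrow> real" where
  "unit_slope i f \<equiv> \<lambda>y. pderiv2 i f y / slope_factor f y"

abbreviation div_unit_slope :: "(real^2 \<Rightarrow> real) \<Rightarrow> real^2 \<Rightarrow> real" where
  "div_unit_slope f y \<equiv> pderiv2 1 (unit_slope 1 f) y + pderiv2 2 (unit_slope 2 f) y"

lemma frame_inner:
  assumes "orthonormal_frame a b c"
  shows "a \<bullet> a = 1" "b \<bullet> b = 1" "c \<bullet> c = 1" "a \<bullet> b = 0" "b \<bullet> a = 0" "a \<bullet> c = 0" "c \<bullet> a = 0" "b \<bullet> c = 0" "c \<bullet> b = 0"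
  using assms by (auto simp: orthonormal_frame_def norm_eq_1 inner_commute)

lemma frame_expand:
  assumes f: "orthonormal_frame a b c"
  shows "x = (x \<bullet> a) *\<^sub>R a + (x \<bullet> b) *\<^sub>R b + (x \<bullet> c) *\<^sub>R c"
proof -
  note i = frame_inner[OF f]
  have d: "a \<noteq> b" "a \<noteq> c" "b \<noteq> c" "a \<noteq> 0" "b \<noteq> 0" "c \<noteq> 0" using i by auto
  have "pairwise orthogonal {a, b, c}" using i by (auto simp: pairwise_def orthogonal_def)
  then have ind: "independent {a, b, c}" using d by (intro pairwise_orthogonal_independent) auto
  have "card {a, b, c} = 3" using d by auto
  then have "UNIV \<subseteq> span {a, b, c}" using ind by (intro card_ge_dim_independent) auto
  moreover define z where "z = x - ((x \<bullet> a) *\<^sub>R a + (x \<bullet> b) *\<^sub>R b + (x \<bullet> c) *\<^sub>R c)"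
  moreover have "orthogonal z y" if "y \<in> {a, b, c}" for y
    using that i by (auto simp: z_def orthogonal_def inner_simps)
  ultimately have "orthogonal z z" by (intro orthogonal_to_span[of z "{a, b, c}"]) auto
  then have "z = 0" by (simp add: orthogonal_def)
  then show ?thesis by (simp add: z_def)
qed

lemma frame_inner_expand:
  assumes f: "orthonormal_frame a b c"
  shows "x \<bullet> y = (x \<bullet> a) * (y \<bullet> a) + (x \<bullet> b) * (y \<bullet> b) + (x \<bullet> c) * (y \<bullet> c)"
proof -
  have "x \<bullet> y = ((x \<bullet> a) *\<^sub>R a + (x \<bullet> b) *\<^sub>R b + (x \<bullet> c) *\<^sub>R c) \<bullet> y"
    by (rule arg_cong[OF frame_expand[OF f, of x]])
  then show ?thesis by (simp only: inner_add_left inner_scaleR_left inner_commute[of y])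
qed

text \<open>The components of a normal vector of a graph from its orthogonality to the two coordinate
  tangent vectors, which are \<open>a + s *\<^sub>R c\<close> and \<open>b + t *\<^sub>R c\<close> for slopes \<open>s\<close> and \<open>t\<close>.\<close>

lemma frame_normal:
  assumes f: "orthonormal_frame a b c" and n: "n \<bullet> (a + s *\<^sub>R c) = 0" "n \<bullet> (b + t *\<^sub>R c) = 0"
  shows "n = (n \<bullet> c) *\<^sub>R (c - s *\<^sub>R a - t *\<^sub>R b)"
proof -
  have "n \<bullet> a = - s * (n \<bullet> c)" "n \<bullet> b = - t * (n \<bullet> c)" using n by (simp_all add: inner_simps algebra_simps)
  then show ?thesis by (subst frame_expand[OF f, of n]) (simp add: algebra_simps)
qed

text \<open>The orthogonal projections of \<open>a\<close> and \<open>b\<close> to the tangent plane form the dual basis of the coordinate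
  tangent vectors, so the left-hand side is the trace of \<open>D\<close> on the tangent plane, which the
  basis of principal directions computes as \<open>- (k1 + k2)\<close>.\<close>

lemma trace_of_shape_operator:
  assumes f: "orthonormal_frame a b c" and D: "linear D"
    and e: "norm e1 = 1" "norm e2 = 1" "e1 \<bullet> e2 = 0" "- D e1 = k1 *\<^sub>R e1" "- D e2 = k2 *\<^sub>R e2"
    and n: "norm n = 1" "n \<bullet> e1 = 0" "n \<bullet> e2 = 0" "n \<bullet> (a + s *\<^sub>R c) = 0" "n \<bullet> (b + t *\<^sub>R c) = 0"
  shows "D (a + s *\<^sub>R c) \<bullet> a + D (b + t *\<^sub>R c) \<bullet> b = - (k1 + k2)"
proof -
  interpret D: linear D by (rule D)
  have f2: "orthonormal_frame e1 e2 n" using e n by (simp add: orthonormal_frame_def inner_commute)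
  have De: "D e1 = - k1 *\<^sub>R e1" "D e2 = - k2 *\<^sub>R e2" using e(4,5) by (metis minus_minus scaleR_minus_left)+
  have tr: "D x \<bullet> y = - k1 * ((x \<bullet> e1) * (e1 \<bullet> y)) - k2 * ((x \<bullet> e2) * (e2 \<bullet> y))" if "n \<bullet> x = 0" for x y
  proof -
    have "x = (x \<bullet> e1) *\<^sub>R e1 + (x \<bullet> e2) *\<^sub>R e2" using frame_expand[OF f2, of x] that by (simp add: inner_commute)
    then have "D x = (x \<bullet> e1) *\<^sub>R D e1 + (x \<bullet> e2) *\<^sub>R D e2" by (metis D.add D.scale)
    then show ?thesis by (simp add: De inner_simps)
  qed
  have nc: "n \<bullet> c \<noteq> 0"
  proof
    assume "n \<bullet> c = 0"
    then have "n = 0" using frame_normal[OF f n(4,5)] by simp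
    then show False using n(1) by simp
  qed
  have one: "((a + s *\<^sub>R c) \<bullet> e) * (e \<bullet> a) + ((b + t *\<^sub>R c) \<bullet> e) * (e \<bullet> b) = 1"
    if "n \<bullet> e = 0" "norm e = 1" for e
  proof -
    have "(n \<bullet> c) * (e \<bullet> c - s * (e \<bullet> a) - t * (e \<bullet> b)) = n \<bullet> e"
      by (subst (2) frame_normal[OF f n(4,5)]) (simp add: inner_simps inner_commute)
    then have *: "e \<bullet> c = s * (e \<bullet> a) + t * (e \<bullet> b)" using nc that(1) by simp
    have "1 = e \<bullet> e" using that(2) by (simp add: norm_eq_1)
    also have "\<dots> = (e \<bullet> a) * (e \<bullet> a) + (e \<bullet> b) * (e \<bullet> b) + (e \<bullet> c) * (e \<bullet> c)" by (rule frame_inner_expand[OF f])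
    also have "\<dots> = (e \<bullet> a) * (e \<bullet> a) + (e \<bullet> b) * (e \<bullet> b) + (e \<bullet> c) * (s * (e \<bullet> a) + t * (e \<bullet> b))" by (simp only: *)
    finally show ?thesis by (simp add: inner_simps inner_commute algebra_simps)
  qed
  have "D (a + s *\<^sub>R c) \<bullet> a + D (b + t *\<^sub>R c) \<bullet> b
     = - k1 * (((a + s *\<^sub>R c) \<bullet> e1) * (e1 \<bullet> a) + ((b + t *\<^sub>R c) \<bullet> e1) * (e1 \<bullet> b))
       - k2 * (((a + s *\<^sub>R c) \<bullet> e2) * (e2 \<bullet> a) + ((b + t *\<^sub>R c) \<bullet> e2) * (e2 \<bullet> b))"
    unfolding tr[OF n(4)] tr[OF n(5)] by (simp add: algebra_simps)
  then show ?thesis using one[OF n(2) e(1)] one[OF n(3) e(2)] by simp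
qed

lemma slope_factor_pos: "slope_factor f y > 0" and slope_factor_square:
  "(slope_factor f y)\<^sup>2 = 1 + (pderiv2 1 f y)\<^sup>2 + (pderiv2 2 f y)\<^sup>2"
proof -
  have "1 + (pderiv2 1 f y)\<^sup>2 + (pderiv2 2 f y)\<^sup>2 > 0" by (intro add_pos_nonneg) auto
  then show "slope_factor f y > 0" "(slope_factor f y)\<^sup>2 = 1 + (pderiv2 1 f y)\<^sup>2 + (pderiv2 2 f y)\<^sup>2"
    by (simp_all add: slope_factor_def)
qed

lemma graph_over_derivative:
  assumes "(f has_derivative f') (at y)"
  shows "(graph_over p a b c f has_derivative (\<lambda>v. v $ 1 *\<^sub>R a + v $ 2 *\<^sub>R b + f' v *\<^sub>R c)) (at y)"
proof -
  have n: "((\<lambda>y. y $ i) has_derivative (\<lambda>v. v $ i)) (at y)" for i :: 2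
    by (rule bounded_linear_imp_has_derivative[OF bounded_linear_vec_nth])
  have "((\<lambda>y. p + y $ 1 *\<^sub>R a + y $ 2 *\<^sub>R b + f y *\<^sub>R c) has_derivative
      (\<lambda>v. 0 + v $ 1 *\<^sub>R a + v $ 2 *\<^sub>R b + f' v *\<^sub>R c)) (at y)"
    by (intro has_derivative_add has_derivative_const has_derivative_scaleR_left n assms)
  then show ?thesis by (simp add: graph_over_def[abs_def])
qed

text \<open>The projection of a chart to the coordinates of the frame is a local diffeomorphism, because a
  vector of its kernel is tangent and parallel to \<open>c\<close>. Composing with its inverse gives \<open>f\<close>.
  The components of the normal along \<open>a\<close> and \<open>b\<close> are \<open>- \<sigma>\<close> times those of \<open>Df / W\<close>, so the divergence of \<open>Df / W\<close> is
  up to the sign \<open>\<sigma>\<close> the trace of the derivative of the normal.\<close>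

lemma surface_local_graph:
  assumes Hs: "H_surface H M N" and chart: "surface_chart M U X" and q0: "q0 \<in> U" "q0 $ 2 > 0"
    and frame: "orthonormal_frame a b c" and Nc: "N (X q0) \<bullet> c \<noteq> 0"
  obtains W f \<sigma> where "open W" "((X q0 - p) \<bullet> a) *\<^sub>R axis 1 1 + ((X q0 - p) \<bullet> b) *\<^sub>R axis 2 1 \<in> W"
    "graph_over p a b c f (((X q0 - p) \<bullet> a) *\<^sub>R axis 1 1 + ((X q0 - p) \<bullet> b) *\<^sub>R axis 2 1) = X q0"
    "smooth_on W f" "\<sigma> = 1 \<or> \<sigma> = -1"
    "\<And>y. y \<in> W \<Longrightarrow> graph_over p a b c f y \<in> M"
    "\<And>y. y \<in> W \<Longrightarrow> N (graph_over p a b c f y)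
        = (\<sigma> / slope_factor f y) *\<^sub>R (c - pderiv2 1 f y *\<^sub>R a - pderiv2 2 f y *\<^sub>R b)"
    "\<And>y. y \<in> W \<Longrightarrow> div_unit_slope f y = 2 * \<sigma> * H (N (graph_over p a b c f y))"
proof -
  have U: "open U" and sX: "smooth_on U X" and inj: "\<And>q. q \<in> U \<Longrightarrow> inj (frechet_derivative X (at q))"
    and "openin (top_of_set M) (X ` (U \<inter> half_plane))"
    using chart unfolding surface_chart_def by auto
  then have XM: "X ` (U \<inter> half_plane) \<subseteq> M" by (intro openin_imp_subset)
  have cN: "continuous_on M N" and N1: "\<And>x. x \<in> M \<Longrightarrow> norm (N x) = 1"
    and NT: "\<And>x v. x \<in> M \<Longrightarrow> v \<in> tangent_plane M x \<Longrightarrow> N x \<bullet> v = 0"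
    and mc: "\<And>x. x \<in> M \<Longrightarrow> has_mean_curvature M N x (H (N x))"
    using Hs unfolding H_surface_def gauss_map_def by auto
  define U0 where "U0 = U \<inter> {q. q $ 2 > 0}"
  have U0: "open U0" unfolding U0_def by (intro open_Int U open_halfspace_component_gt_cart)
  have U0M: "X q \<in> M" if "q \<in> U0" for q using that XM by (auto simp: U0_def half_plane_def)
  have tang: "frechet_derivative X (at q) w \<in> tangent_plane M (X q)" if "q \<in> U0" for q w
    unfolding tangent_plane_def mem_Collect_eq using that chart
    by (intro exI[of _ X] exI[of _ q] exI[of _ w] exI[of _ U] conjI) (auto simp: U0_def half_plane_def)
  define \<sigma> where "\<sigma> = sgn (N (X q0) \<bullet> c)"
  have \<sigma>: "\<sigma> = 1 \<or> \<sigma> = -1" using Nc by (auto simp: \<sigma>_def sgn_if)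
  define V where "V = {q \<in> U0. \<sigma> * (N (X q) \<bullet> c) > 0}"
  have "continuous_on U0 (\<lambda>q. \<sigma> * (N (X q) \<bullet> c))"
    by (intro continuous_intros continuous_on_compose2[OF cN continuous_on_subset[OF smooth_on_continuous_on[OF sX]]])
      (use U0M in \<open>auto simp: U0_def\<close>)
  then have "openin (top_of_set U0) (U0 \<inter> (\<lambda>q. \<sigma> * (N (X q) \<bullet> c)) -` {0<..})"
    by (rule continuous_openin_preimage_gen) simp
  then have "open (U0 \<inter> (\<lambda>q. \<sigma> * (N (X q) \<bullet> c)) -` {0<..})" using U0 openin_open_trans by blast
  moreover have "U0 \<inter> (\<lambda>q. \<sigma> * (N (X q) \<bullet> c)) -` {0<..} = V" by (auto simp: V_def)
  ultimately have V: "open V" by simp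
  have q0V: "q0 \<in> V" using q0 Nc by (auto simp: V_def U0_def \<sigma>_def sgn_if)
  have VU: "V \<subseteq> U" "V \<subseteq> U0" by (auto simp: V_def U0_def)
  have sXv: "smooth_on V (\<lambda>q. (X q - p) \<bullet> v)" for v
  proof -
    have "smooth_on V (\<lambda>q. X q \<bullet> v - p \<bullet> v)"
      by (intro smooth_on_diff V smooth_on_const smooth_on_compose_linear[OF V bounded_linear_inner_left] smooth_on_subset[OF sX VU(1)])
    then show ?thesis by (simp add: inner_diff_left)
  qed
  have dX: "(X has_derivative frechet_derivative X (at q)) (at q)" if "q \<in> V" for q
    using smooth_on_has_derivative[OF sX] VU that by auto
  let ?A = "\<lambda>q. frechet_derivative X (at q)"
  have dXv: "frechet_derivative (\<lambda>q. (X q - p) \<bullet> v) (at q) = (\<lambda>w. ?A q w \<bullet> v)" if "q \<in> V" for q v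
  proof -
    have "((\<lambda>q. (X q - p) \<bullet> v) has_derivative (\<lambda>w. ?A q w \<bullet> v)) (at q)"
      using dX[OF that] by (auto intro!: derivative_eq_intros)
    then show ?thesis using frechet_derivative_at by force
  qed
  have lA: "linear (?A q)" if "q \<in> V" for q using has_derivative_linear[OF dX[OF that]] .
  have ker: "w = 0" if "?A q0 w \<bullet> a = 0" "?A q0 w \<bullet> b = 0" for w
  proof -
    have eq: "?A q0 w = (?A q0 w \<bullet> c) *\<^sub>R c" using frame_expand[OF frame, of "?A q0 w"] that by simp
    have "N (X q0) \<bullet> ?A q0 w = 0" using NT U0M tang q0V VU by blast
    then have "(?A q0 w \<bullet> c) * (N (X q0) \<bullet> c) = 0" by (subst (asm) eq) simp
    then have "?A q0 w = 0" using Nc eq by simp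
    then have "?A q0 w = ?A q0 0" using linear_0[OF lA[OF q0V]] by simp
    then show ?thesis using inj[OF q0(1)] injD by metis
  qed
  have J: "?A q0 (axis 1 1) \<bullet> a * (?A q0 (axis 2 1) \<bullet> b) - ?A q0 (axis 2 1) \<bullet> a * (?A q0 (axis 1 1) \<bullet> b) \<noteq> 0"
    (is "?P11 * ?P22 - ?P12 * ?P21 \<noteq> 0")
  proof
    assume J0: "?P11 * ?P22 - ?P12 * ?P21 = 0"
    have lin: "?A q0 (s *\<^sub>R axis 1 1 - t *\<^sub>R axis 2 1) \<bullet> v = s * (?A q0 (axis 1 1) \<bullet> v) - t * (?A q0 (axis 2 1) \<bullet> v)" for s t v
      by (simp add: linear_diff[OF lA[OF q0V]] linear_scale[OF lA[OF q0V]] inner_diff_left)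
    have z: "s = 0 \<and> t = 0" if "s *\<^sub>R axis 1 1 - t *\<^sub>R axis 2 1 = (0 :: real^2)" for s t
      using that by (auto simp: vec_eq_iff forall_2 axis_def)
    have "?P22 = 0 \<and> ?P21 = 0" by (intro z ker) (use J0 in \<open>simp_all add: lin algebra_simps\<close>)
    moreover have "?P12 = 0 \<and> ?P11 = 0" by (intro z ker) (use J0 in \<open>simp_all add: lin algebra_simps\<close>)
    ultimately have "axis 1 1 = (0 :: real^2)" by (intro ker) auto
    then show False by (simp add: axis_eq_0_iff)
  qed
  obtain W :: "(real^2) set" and \<Phi> where W: "open W" and y0: "((X q0 - p) \<bullet> a) *\<^sub>R axis 1 1 + ((X q0 - p) \<bullet> b) *\<^sub>R axis 2 1 \<in> W"
    and \<Phi>V: "\<Phi> ` W \<subseteq> V"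
    and p\<Phi>: "\<And>y. y \<in> W \<Longrightarrow> ((X (\<Phi> y) - p) \<bullet> a) *\<^sub>R axis 1 1 + ((X (\<Phi> y) - p) \<bullet> b) *\<^sub>R axis 2 1 = y"
    and \<Phi>0: "\<Phi> (((X q0 - p) \<bullet> a) *\<^sub>R axis 1 1 + ((X q0 - p) \<bullet> b) *\<^sub>R axis 2 1) = q0"
    and d\<Phi>: "\<And>y. y \<in> W \<Longrightarrow> \<Phi> differentiable (at y)"
    and s\<Phi>: "\<And>g::real^2 \<Rightarrow> real. smooth_on V g \<Longrightarrow> smooth_on W (\<lambda>y. g (\<Phi> y))"
    by (rule smooth_local_inverse_plane[OF V q0V sXv[of a] sXv[of b]])
      (use J in \<open>simp add: dXv[OF q0V]\<close>, rule that, assumption+)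
  define f where "f = (\<lambda>y. (X (\<Phi> y) - p) \<bullet> c)"
  let ?\<Gamma> = "graph_over p a b c f"
  have sf: "smooth_on W f" unfolding f_def by (rule s\<Phi>[OF sXv])
  have \<Gamma>X: "?\<Gamma> y = X (\<Phi> y)" if "y \<in> W" for y
  proof -
    have c: "(s *\<^sub>R axis 1 1 + t *\<^sub>R axis 2 1 :: real^2) $ 1 = s" "(s *\<^sub>R axis 1 1 + t *\<^sub>R axis 2 1 :: real^2) $ 2 = t" for s t
      by (simp_all add: axis_def)
    have "y $ 1 = (X (\<Phi> y) - p) \<bullet> a" "y $ 2 = (X (\<Phi> y) - p) \<bullet> b"
      using arg_cong[OF p\<Phi>[OF that], of "\<lambda>z. z $ 1"] arg_cong[OF p\<Phi>[OF that], of "\<lambda>z. z $ 2"] unfolding c by simp_all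
    then have "?\<Gamma> y = p + (((X (\<Phi> y) - p) \<bullet> a) *\<^sub>R a + ((X (\<Phi> y) - p) \<bullet> b) *\<^sub>R b + ((X (\<Phi> y) - p) \<bullet> c) *\<^sub>R c)"
      unfolding graph_over_def f_def by (simp only: add.assoc)
    also have "\<dots> = p + (X (\<Phi> y) - p)"
      by (rule arg_cong[OF frame_expand[OF frame, symmetric]])
    finally show ?thesis by simp
  qed
  have \<Phi>in: "\<Phi> y \<in> V" if "y \<in> W" for y using \<Phi>V that by blast
  have \<Gamma>M: "?\<Gamma> y \<in> M" if "y \<in> W" for y
    unfolding \<Gamma>X[OF that] using U0M VU(2) \<Phi>in[OF that] by blast
  have d\<Gamma>: "(?\<Gamma> has_derivative (\<lambda>v. v $ 1 *\<^sub>R a + v $ 2 *\<^sub>R b + frechet_derivative f (at y) v *\<^sub>R c)) (at y)" if "y \<in> W" for y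
    by (rule graph_over_derivative[OF smooth_on_has_derivative[OF sf that]])
  have \<Gamma>12: "N (?\<Gamma> y) \<bullet> (a + pderiv2 1 f y *\<^sub>R c) = 0" "N (?\<Gamma> y) \<bullet> (b + pderiv2 2 f y *\<^sub>R c) = 0" if y: "y \<in> W" for y
  proof -
    obtain \<Phi>' where "(\<Phi> has_derivative \<Phi>') (at y)" using d\<Phi>[OF y] by (auto simp: differentiable_def)
    moreover have "\<Phi> y \<in> V" by (rule \<Phi>in[OF y])
    ultimately have "((\<lambda>y. X (\<Phi> y)) has_derivative (\<lambda>v. ?A (\<Phi> y) (\<Phi>' v))) (at y)"
      using has_derivative_compose dX by blast
    then have "(?\<Gamma> has_derivative (\<lambda>v. ?A (\<Phi> y) (\<Phi>' v))) (at y)"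
      by (rule has_derivative_transform_within_open[OF _ W y]) (simp add: \<Gamma>X)
    from has_derivative_unique[OF this d\<Gamma>[OF y]]
    have "?A (\<Phi> y) (\<Phi>' v) = v $ 1 *\<^sub>R a + v $ 2 *\<^sub>R b + frechet_derivative f (at y) v *\<^sub>R c" for v by metis
    then have "N (?\<Gamma> y) \<bullet> (v $ 1 *\<^sub>R a + v $ 2 *\<^sub>R b + frechet_derivative f (at y) v *\<^sub>R c) = 0" for v
      using NT[OF \<Gamma>M[OF y]] tang \<open>\<Phi> y \<in> V\<close> VU(2) \<Gamma>X[OF y] by (metis subsetD)
    from this[of "axis 1 1"] this[of "axis 2 1"]
    show "N (?\<Gamma> y) \<bullet> (a + pderiv2 1 f y *\<^sub>R c) = 0" "N (?\<Gamma> y) \<bullet> (b + pderiv2 2 f y *\<^sub>R c) = 0"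
      by (simp_all add: pderiv2_def axis_def)
  qed
  have N_eq: "N (?\<Gamma> y) = (\<sigma> / slope_factor f y) *\<^sub>R (c - pderiv2 1 f y *\<^sub>R a - pderiv2 2 f y *\<^sub>R b)" if "y \<in> W" for y
  proof -
    let ?n = "N (?\<Gamma> y)" and ?w = "slope_factor f y"
    have eq: "?n = (?n \<bullet> c) *\<^sub>R (c - pderiv2 1 f y *\<^sub>R a - pderiv2 2 f y *\<^sub>R b)"
      by (rule frame_normal[OF frame \<Gamma>12[OF that]])
    have na: "?n \<bullet> a = - (pderiv2 1 f y * (?n \<bullet> c))" "?n \<bullet> b = - (pderiv2 2 f y * (?n \<bullet> c))"
      using \<Gamma>12[OF that] by (simp_all add: inner_simps)
    have "1 = ?n \<bullet> ?n" using N1[OF \<Gamma>M[OF that]] by (simp add: norm_eq_1)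
    also have "\<dots> = (?n \<bullet> a) * (?n \<bullet> a) + (?n \<bullet> b) * (?n \<bullet> b) + (?n \<bullet> c) * (?n \<bullet> c)"
      by (rule frame_inner_expand[OF frame])
    also have "\<dots> = (?w * (?n \<bullet> c))\<^sup>2"
      unfolding na power_mult_distrib slope_factor_square by (simp add: power2_eq_square algebra_simps)
    finally have sq: "(?w * (?n \<bullet> c))\<^sup>2 = 1" by simp
    have pos: "\<sigma> * (?n \<bullet> c) > 0" using \<Phi>in[OF that] unfolding \<Gamma>X[OF that] V_def by simp
    have "?w * (?n \<bullet> c) = \<sigma>"
    proof -
      have "?w * (\<sigma> * (?n \<bullet> c)) > 0" using pos slope_factor_pos[of f y] by (rule_tac mult_pos_pos)
      moreover have "(?w * (\<sigma> * (?n \<bullet> c)))\<^sup>2 = 1" using sq \<sigma> by (auto simp: power_mult_distrib)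
      ultimately have "?w * (\<sigma> * (?n \<bullet> c)) = 1" by (auto simp: power2_eq_1_iff)
      then show ?thesis using \<sigma> by auto
    qed
    then have "?n \<bullet> c = \<sigma> / ?w" using slope_factor_pos[of f y] by (simp add: field_simps)
    then show ?thesis using eq by simp
  qed
  have H_eq: "div_unit_slope f y = 2 * \<sigma> * H (N (?\<Gamma> y))" if y: "y \<in> W" for y
  proof -
    let ?n = "N (?\<Gamma> y)"
    obtain k1 k2 D e1 e2 where D: "(N has_derivative D) (at (?\<Gamma> y) within M)"
      and e: "e1 \<in> tangent_plane M (?\<Gamma> y)" "e2 \<in> tangent_plane M (?\<Gamma> y)"
        "norm e1 = 1" "norm e2 = 1" "e1 \<bullet> e2 = 0" "- D e1 = k1 *\<^sub>R e1" "- D e2 = k2 *\<^sub>R e2"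
      and Hk: "H ?n = (k1 + k2) / 2"
      using mc[OF \<Gamma>M[OF y]] unfolding has_mean_curvature_def principal_curvatures_def by blast
    let ?d = "\<lambda>v. v $ 1 *\<^sub>R a + v $ 2 *\<^sub>R b + frechet_derivative f (at y) v *\<^sub>R c"
    have "((\<lambda>y. N (?\<Gamma> y)) has_derivative (\<lambda>v. D (?d v))) (at y within W)"
      by (rule has_derivative_in_compose[OF has_derivative_at_withinI[OF d\<Gamma>[OF y]] has_derivative_subset[OF D]])
        (use \<Gamma>M in auto)
    then have dn: "((\<lambda>y. N (?\<Gamma> y)) has_derivative (\<lambda>v. D (?d v))) (at y)"
      using at_within_open[OF y W] by simp
    have inner_n: "N (?\<Gamma> y) \<bullet> a = - (\<sigma> * (pderiv2 1 f y / slope_factor f y))"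
      "N (?\<Gamma> y) \<bullet> b = - (\<sigma> * (pderiv2 2 f y / slope_factor f y))" if "y \<in> W" for y
      by (simp_all add: N_eq[OF that] inner_simps frame_inner[OF frame])
    have comp: "pderiv2 i g y = - \<sigma> * (D (?d (axis i 1)) \<bullet> v)"
      if g: "\<And>z. z \<in> W \<Longrightarrow> N (?\<Gamma> z) \<bullet> v = - (\<sigma> * g z)" for i g v
    proof -
      have "((\<lambda>z. - \<sigma> * (N (?\<Gamma> z) \<bullet> v)) has_derivative (\<lambda>h. - \<sigma> * (D (?d h) \<bullet> v))) (at y)"
        by (intro has_derivative_mult_right has_derivative_inner_left dn)
      then have "(g has_derivative (\<lambda>h. - \<sigma> * (D (?d h) \<bullet> v))) (at y)"
        by (rule has_derivative_transform_within_open[OF _ W y]) (use \<sigma> in \<open>auto simp: g\<close>)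
      then have "- \<sigma> * (D (?d (axis i 1)) \<bullet> v) = frechet_derivative g (at y) (axis i 1)"
        by (rule fun_cong[OF frechet_derivative_at])
      then show ?thesis by (simp only: pderiv2_def)
    qed
    have "div_unit_slope f y
        = - \<sigma> * (D (?d (axis 1 1)) \<bullet> a + D (?d (axis 2 1)) \<bullet> b)"
      using comp[of a "\<lambda>y. pderiv2 1 f y / slope_factor f y" 1] comp[of b "\<lambda>y. pderiv2 2 f y / slope_factor f y" 2] inner_n
      by (simp add: algebra_simps)
    also have "?d (axis 1 1) = a + pderiv2 1 f y *\<^sub>R c" by (simp add: pderiv2_def axis_def)
    also have "?d (axis 2 1) = b + pderiv2 2 f y *\<^sub>R c" by (simp add: pderiv2_def axis_def)
    also have "D (a + pderiv2 1 f y *\<^sub>R c) \<bullet> a + D (b + pderiv2 2 f y *\<^sub>R c) \<bullet> b = - (k1 + k2)"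
      by (rule trace_of_shape_operator[OF frame has_derivative_linear[OF D] e(3-7) N1[OF \<Gamma>M[OF y]]
          NT[OF \<Gamma>M[OF y] e(1)] NT[OF \<Gamma>M[OF y] e(2)] \<Gamma>12[OF y]])
    also have "k1 + k2 = 2 * H ?n" using Hk by simp
    finally show ?thesis by simp
  qed
  show thesis
    by (rule that[OF W y0 _ sf \<sigma> \<Gamma>M N_eq H_eq]) (use \<Gamma>X[OF y0] \<Phi>0 in simp)
qed

section \<open>The mean curvature equation and its linearization\<close>

lemma smooth_on_pderiv2: "smooth_on W f \<Longrightarrow> smooth_on W (pderiv2 i f)"
  unfolding pderiv2_def[abs_def] by (rule smooth_on_derivative)

lemma smooth_on_Ck: "smooth_on W f \<Longrightarrow> Ck_on k W f"
  by (simp add: smooth_on_def)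

lemma pderiv2_commute:
  assumes "open W" "smooth_on W f" "y \<in> W"
  shows "pderiv2 i (pderiv2 j f) y = pderiv2 j (pderiv2 i f) y"
  using mixed_derivatives_commute[OF assms(1,3) smooth_on_Ck[OF assms(2)]] by (simp add: pderiv2_def[abs_def])

lemma pderiv2_cong:
  assumes "open W" "y \<in> W" "\<And>z. z \<in> W \<Longrightarrow> f z = g z" "f differentiable (at y)"
  shows "pderiv2 i g y = pderiv2 i f y"
  using frechet_derivative_cong_open(2)[OF assms] by (simp add: pderiv2_def)

lemma smooth_on_differentiable: "smooth_on W f \<Longrightarrow> y \<in> W \<Longrightarrow> f differentiable (at y)"
  using smooth_on_has_derivative by (auto simp: differentiable_def)

lemma pderiv2_along_line:
  assumes "smooth_on W f" "y \<in> W"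
  shows "((\<lambda>t. f (y + t *\<^sub>R axis i 1)) has_real_derivative pderiv2 i f y) (at 0)"
  unfolding pderiv2_def
  by (rule has_real_derivative_along_line) (use smooth_on_has_derivative[OF assms] in simp)

lemma normalized_gradient_has_derivative:
  assumes W: "smooth_on W f" "y \<in> W"
  shows "((unit_slope j f) has_derivative
    (\<lambda>v. frechet_derivative (pderiv2 j f) (at y) v / slope_factor f y
       - pderiv2 j f y * (pderiv2 1 f y * frechet_derivative (pderiv2 1 f) (at y) v
           + pderiv2 2 f y * frechet_derivative (pderiv2 2 f) (at y) v) / slope_factor f y ^ 3)) (at y)"
proof -
  note d = smooth_on_has_derivative[OF smooth_on_pderiv2[OF W(1)] W(2)]
  let ?p = "pderiv2 1 f y" and ?q = "pderiv2 2 f y" and ?w = "slope_factor f y"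
  let ?p' = "frechet_derivative (pderiv2 1 f) (at y)" and ?q' = "frechet_derivative (pderiv2 2 f) (at y)"
  have w: "?w > 0" by (rule slope_factor_pos)
  have S: "((\<lambda>y. 1 + (pderiv2 1 f y)\<^sup>2 + (pderiv2 2 f y)\<^sup>2) has_derivative (\<lambda>v. 2 * (?p * ?p' v + ?q * ?q' v))) (at y)"
    by (rule has_derivative_eq_rhs, (rule derivative_eq_intros d refl)+) (auto simp: fun_eq_iff)
  have "(sqrt has_derivative (\<lambda>h. inverse ?w / 2 * h)) (at (1 + (pderiv2 1 f y)\<^sup>2 + (pderiv2 2 f y)\<^sup>2))"
    unfolding slope_factor_def has_field_derivative_def[symmetric]
    by (rule DERIV_real_sqrt) (simp add: add_pos_nonneg)
  from has_derivative_compose[OF S this]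
  have dw: "(slope_factor f has_derivative (\<lambda>v. inverse ?w / 2 * (2 * (?p * ?p' v + ?q * ?q' v)))) (at y)"
    by (simp add: slope_factor_def[abs_def])
  have "((unit_slope j f) has_derivative
    (\<lambda>v. (frechet_derivative (pderiv2 j f) (at y) v * ?w - pderiv2 j f y * (inverse ?w / 2 * (2 * (?p * ?p' v + ?q * ?q' v)))) / (?w * ?w))) (at y)"
    by (rule has_derivative_divide'[OF d dw]) (use w in simp)
  then show ?thesis
    by (rule has_derivative_eq_rhs) (use w in \<open>auto simp: fun_eq_iff field_simps power3_eq_cube\<close>)
qed

lemma pderiv2_normalized_gradient:
  assumes "smooth_on W f" "y \<in> W"
  shows "pderiv2 i (unit_slope j f) y = pderiv2 i (pderiv2 j f) y / slope_factor f y
       - pderiv2 j f y * (pderiv2 1 f y * pderiv2 i (pderiv2 1 f) y + pderiv2 2 f y * pderiv2 i (pderiv2 2 f) y)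
          / slope_factor f y ^ 3"
  using fun_cong[OF frechet_derivative_at[OF normalized_gradient_has_derivative[OF assms, of j]], of "axis i 1"]
  by (simp add: pderiv2_def)

text \<open>Multiplying by \<open>W\<^sup>3\<close> gives the nondivergence form of the mean curvature operator, which is
  polynomial in the derivatives of \<open>f\<close> and hence easy to differentiate once more.\<close>

lemma mean_curvature_equation_expanded:
  assumes W: "open W" "smooth_on W f" "y \<in> W"
  shows "(1 + (pderiv2 2 f y)\<^sup>2) * pderiv2 1 (pderiv2 1 f) y + (1 + (pderiv2 1 f y)\<^sup>2) * pderiv2 2 (pderiv2 2 f) y
      - 2 * pderiv2 1 f y * pderiv2 2 f y * pderiv2 2 (pderiv2 1 f) y
    = div_unit_slope f y
      * slope_factor f y ^ 3"
proof -
  let ?w = "slope_factor f y" and ?p = "pderiv2 1 f y" and ?q = "pderiv2 2 f y"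
  let ?r = "pderiv2 1 (pderiv2 1 f) y" and ?s = "pderiv2 2 (pderiv2 1 f) y" and ?t = "pderiv2 2 (pderiv2 2 f) y"
  have sym: "pderiv2 1 (pderiv2 2 f) y = ?s" by (rule pderiv2_commute[OF W])
  have w: "?w > 0" by (rule slope_factor_pos)
  have "div_unit_slope f y * ?w ^ 3
     = (?r + ?t) * ?w\<^sup>2 - (?p * (?p * ?r + ?q * ?s) + ?q * (?p * ?s + ?q * ?t))"
    unfolding pderiv2_normalized_gradient[OF W(2,3)] sym
    using w by (simp add: field_simps power3_eq_cube power2_eq_square)
  then show ?thesis unfolding slope_factor_square by (simp add: algebra_simps power2_eq_square)
qed

lemma continuous_on_slope_factor: "smooth_on W f \<Longrightarrow> continuous_on W (slope_factor f)"
  unfolding slope_factor_def[abs_def]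
  by (intro continuous_intros smooth_on_continuous_on[OF smooth_on_pderiv2])

lemma continuous_on_directional_derivative:
  fixes G :: "'a::euclidean_space \<Rightarrow> real" and m v :: "'b::topological_space \<Rightarrow> 'a"
  assumes G: "Ck_on 1 S G" and m: "continuous_on W m" "m ` W \<subseteq> S" and v: "continuous_on W v"
  shows "continuous_on W (\<lambda>y. frechet_derivative G (at (m y)) (v y))"
proof -
  have e: "continuous_on W (\<lambda>y. frechet_derivative G (at (m y)) e)" for e
    using continuous_on_compose2[OF _ m, of "\<lambda>x. frechet_derivative G (at x) e"] G by simp
  have "frechet_derivative G (at (m y)) (v y) = (\<Sum>e\<in>Basis. (v y \<bullet> e) * frechet_derivative G (at (m y)) e)" if "y \<in> W" for y
  proof -
    have "(G has_derivative frechet_derivative G (at (m y))) (at (m y))"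
      using Ck_on_SucE[of 0 S G] G m(2) that by auto
    then interpret linear "frechet_derivative G (at (m y))" by (rule has_derivative_linear)
    show ?thesis by (subst euclidean_representation[of "v y", symmetric]) (simp only: sum scale real_scaleR_def)
  qed
  moreover have "continuous_on W (\<lambda>y. \<Sum>e\<in>Basis. (v y \<bullet> e) * frechet_derivative G (at (m y)) e)"
    by (intro continuous_intros v e)
  ultimately show ?thesis by (simp cong: continuous_on_cong)
qed

text \<open>Differentiate the expanded equation in the second variable. Every term that does not contain a
  second derivative of \<open>pderiv2 2 f\<close> contains a first one, also on the right-hand side, since
  \<open>G\<close> depends on the point only through the slopes of \<open>f\<close>. Collecting them gives \<open>\<alpha>\<close> and \<open>\<beta>\<close>.\<close>

lemma linearized_mean_curvature_equation:
  fixes a b c :: "real^3" and \<sigma> :: real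
  assumes W: "open W" "smooth_on W f" and G: "Ck_on 1 S G"
    and n: "n = (\<lambda>y. (\<sigma> / slope_factor f y) *\<^sub>R (c - pderiv2 1 f y *\<^sub>R a - pderiv2 2 f y *\<^sub>R b))"
    and nS: "n ` W \<subseteq> S"
    and eq: "\<And>y. y \<in> W \<Longrightarrow> div_unit_slope f y = 2 * \<sigma> * G (n y)"
  obtains \<alpha> \<beta> :: "real^2 \<Rightarrow> real" where "continuous_on W \<alpha>" "continuous_on W \<beta>"
    "\<And>y. y \<in> W \<Longrightarrow> (1 + (pderiv2 2 f y)\<^sup>2) * pderiv2 1 (pderiv2 1 (pderiv2 2 f)) y
        + (1 + (pderiv2 1 f y)\<^sup>2) * pderiv2 2 (pderiv2 2 (pderiv2 2 f)) y
        - 2 * pderiv2 1 f y * pderiv2 2 f y * pderiv2 2 (pderiv2 1 (pderiv2 2 f)) y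
      = \<alpha> y * pderiv2 1 (pderiv2 2 f) y + \<beta> y * pderiv2 2 (pderiv2 2 f) y"
proof -
  define w where "w = slope_factor f"
  define f1 where "f1 = pderiv2 1 f"
  define f2 where "f2 = pderiv2 2 f"
  define f11 where "f11 = pderiv2 1 f1"
  define f12 where "f12 = pderiv2 2 f1"
  define f22 where "f22 = pderiv2 2 f2"
  note fs = f1_def f2_def f11_def f12_def f22_def
  have sm: "smooth_on W f1" "smooth_on W f2" "smooth_on W f11" "smooth_on W f12" "smooth_on W f22"
    unfolding fs by (intro smooth_on_pderiv2 W(2))+
  note co = sm[THEN smooth_on_continuous_on] continuous_on_slope_factor[OF W(2), folded w_def]
  have w0: "w y > 0" for y unfolding w_def by (rule slope_factor_pos)
  have w0': "w y \<noteq> 0" for y using w0[of y] by simp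
  define m where "m = (\<lambda>y. c - f1 y *\<^sub>R a - f2 y *\<^sub>R b)"
  have n': "n = (\<lambda>y. (\<sigma> / w y) *\<^sub>R m y)" unfolding n w_def m_def fs ..
  have cm: "continuous_on W m" unfolding m_def by (intro continuous_intros co)
  have cn: "continuous_on W n" unfolding n' by (intro continuous_intros co cm) (use w0' in auto)
  have cGn: "continuous_on W (\<lambda>y. G (n y))"
    by (rule continuous_on_compose2[OF _ cn nS]) (use Ck_on_SucD[of 0 S G] G in simp)
  \<comment> \<open>The derivative of the normal \<open>n\<close> in the second direction is \<open>f12 *\<^sub>R va + f22 *\<^sub>R vb\<close>.\<close>
  define va where "va = (\<lambda>y. - (\<sigma> * f1 y / w y ^ 3) *\<^sub>R m y - (\<sigma> / w y) *\<^sub>R a)"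
  define vb where "vb = (\<lambda>y. - (\<sigma> * f2 y / w y ^ 3) *\<^sub>R m y - (\<sigma> / w y) *\<^sub>R b)"
  let ?DG = "\<lambda>y. frechet_derivative G (at (n y))"
  define \<alpha> where "\<alpha> = (\<lambda>y. 2 * \<sigma> * (3 * G (n y) * w y * f1 y + w y ^ 3 * ?DG y (va y)) - (2 * f1 y * f22 y - 2 * f2 y * f12 y))"
  define \<beta> where "\<beta> = (\<lambda>y. 2 * \<sigma> * (3 * G (n y) * w y * f2 y + w y ^ 3 * ?DG y (vb y)) - (2 * f2 y * f11 y - 2 * f1 y * f12 y))"
  have cva: "continuous_on W va" "continuous_on W vb"
    unfolding va_def vb_def by (intro continuous_intros co cm; use w0' in auto)+
  have c\<alpha>: "continuous_on W \<alpha>" unfolding \<alpha>_def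
    by (intro continuous_intros co cGn continuous_on_directional_derivative[OF G cn nS cva(1)])
  have c\<beta>: "continuous_on W \<beta>" unfolding \<beta>_def
    by (intro continuous_intros co cGn continuous_on_directional_derivative[OF G cn nS cva(2)])
  have main: "(1 + (f2 y)\<^sup>2) * pderiv2 1 (pderiv2 1 f2) y + (1 + (f1 y)\<^sup>2) * pderiv2 2 f22 y
      - 2 * f1 y * f2 y * pderiv2 2 (pderiv2 1 f2) y = \<alpha> y * pderiv2 1 f2 y + \<beta> y * f22 y" if y: "y \<in> W" for y
  proof -
    define l where "l = (\<lambda>t. y + t *\<^sub>R axis 2 1 :: real^2)"
    have l0: "l 0 = y" by (simp add: l_def)
    have line: "((\<lambda>t. h (l t)) has_real_derivative pderiv2 2 h y) (at 0)" if "smooth_on W h" for h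
      unfolding l_def by (rule pderiv2_along_line[OF that y])
    have f12': "pderiv2 1 f2 z = f12 z" if "z \<in> W" for z
      unfolding fs by (rule pderiv2_commute[OF W that])
    have d111: "pderiv2 2 f11 y = pderiv2 1 (pderiv2 1 f2) y"
    proof -
      have "pderiv2 2 f11 y = pderiv2 1 f12 y"
        unfolding f11_def f12_def by (rule pderiv2_commute[OF W(1) sm(1) y])
      also have "\<dots> = pderiv2 1 (pderiv2 1 f2) y"
        by (rule pderiv2_cong[OF W(1) y f12' smooth_on_differentiable[OF smooth_on_pderiv2[OF sm(2)] y]])
      finally show ?thesis .
    qed
    have d112: "pderiv2 2 f12 y = pderiv2 2 (pderiv2 1 f2) y"
      by (rule pderiv2_cong[OF W(1) y f12' smooth_on_differentiable[OF smooth_on_pderiv2[OF sm(2)] y]])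
    have D1: "((\<lambda>t. f1 (l t)) has_real_derivative f12 y) (at 0)" unfolding f12_def by (rule line[OF sm(1)])
    have D2: "((\<lambda>t. f2 (l t)) has_real_derivative f22 y) (at 0)" unfolding f22_def by (rule line[OF sm(2)])
    have D3: "((\<lambda>t. f11 (l t)) has_real_derivative pderiv2 1 (pderiv2 1 f2) y) (at 0)"
      unfolding d111[symmetric] by (rule line[OF sm(3)])
    have D4: "((\<lambda>t. f12 (l t)) has_real_derivative pderiv2 2 (pderiv2 1 f2) y) (at 0)"
      unfolding d112[symmetric] by (rule line[OF sm(4)])
    have D5: "((\<lambda>t. f22 (l t)) has_real_derivative pderiv2 2 f22 y) (at 0)" by (rule line[OF sm(5)])
    define w' where "w' = (f1 y * f12 y + f2 y * f22 y) / w y"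
    have Dw: "((\<lambda>t. w (l t)) has_real_derivative w') (at 0)"
    proof -
      have "((\<lambda>t. 1 + (f1 (l t))\<^sup>2 + (f2 (l t))\<^sup>2) has_real_derivative 2 * (f1 y * f12 y + f2 y * f22 y)) (at 0)"
        by (rule DERIV_cong, (rule derivative_eq_intros D1 D2 refl)+) (simp add: l0)
      moreover have "(sqrt has_real_derivative inverse (w y) / 2) (at (1 + (f1 (l 0))\<^sup>2 + (f2 (l 0))\<^sup>2))"
        using DERIV_real_sqrt[of "1 + (f1 y)\<^sup>2 + (f2 y)\<^sup>2"] by (simp add: l0 w_def slope_factor_def fs add_pos_nonneg)
      ultimately have dS: "((\<lambda>t. sqrt (1 + (f1 (l t))\<^sup>2 + (f2 (l t))\<^sup>2)) has_real_derivative inverse (w y) / 2 * (2 * (f1 y * f12 y + f2 y * f22 y))) (at 0)"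
        by (rule DERIV_chain2[rotated])
      have wl: "w (l t) = sqrt (1 + (f1 (l t))\<^sup>2 + (f2 (l t))\<^sup>2)" for t
        unfolding w_def slope_factor_def fs by (rule refl)
      have k: "inverse (w y) / 2 * (2 * (f1 y * f12 y + f2 y * f22 y)) = w'"
        unfolding w'_def by (simp only: divide_inverse mult_ac) simp
      show ?thesis unfolding wl using dS unfolding k .
    qed
    have DA: "((\<lambda>t. (1 + (f2 (l t))\<^sup>2) * f11 (l t) + (1 + (f1 (l t))\<^sup>2) * f22 (l t) - 2 * f1 (l t) * f2 (l t) * f12 (l t))
       has_real_derivative
        (2 * f2 y * f22 y * f11 y + (1 + (f2 y)\<^sup>2) * pderiv2 1 (pderiv2 1 f2) y + 2 * f1 y * f12 y * f22 y + (1 + (f1 y)\<^sup>2) * pderiv2 2 f22 y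
         - 2 * (f12 y * f2 y * f12 y + f1 y * f22 y * f12 y + f1 y * f2 y * pderiv2 2 (pderiv2 1 f2) y))) (at 0)"
      by (rule DERIV_cong, (rule derivative_eq_intros D1 D2 D3 D4 D5 refl)+) (simp add: l0 algebra_simps)
    have Dn: "((\<lambda>t. n (l t)) has_derivative (\<lambda>h. h *\<^sub>R (f12 y *\<^sub>R va y + f22 y *\<^sub>R vb y))) (at 0)"
    proof -
      note d = D1[unfolded has_field_derivative_def] D2[unfolded has_field_derivative_def]
      have dm: "((\<lambda>t. m (l t)) has_derivative (\<lambda>h. 0 - (f12 y * h) *\<^sub>R a - (f22 y * h) *\<^sub>R b)) (at 0)"
        unfolding m_def by (intro has_derivative_diff has_derivative_const has_derivative_scaleR_left d)
      have dq: "((\<lambda>t. \<sigma> / w (l t)) has_real_derivative - (\<sigma> * w' / (w y)\<^sup>2)) (at 0)"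
        by (rule DERIV_cong, (rule derivative_eq_intros Dw refl)+) (use w0'[of y] in \<open>simp_all add: w0' l0 power2_eq_square\<close>)
      have "((\<lambda>t. (\<sigma> / w (l t)) *\<^sub>R m (l t)) has_derivative
         (\<lambda>h. (\<sigma> / w (l 0)) *\<^sub>R (0 - (f12 y * h) *\<^sub>R a - (f22 y * h) *\<^sub>R b) + (- (\<sigma> * w' / (w y)\<^sup>2) * h) *\<^sub>R m (l 0))) (at 0)"
        by (rule has_derivative_scaleR[OF dq[unfolded has_field_derivative_def] dm])
      then show ?thesis unfolding n'
      proof (rule has_derivative_eq_rhs, intro ext)
        fix h
        have k: "\<sigma> * w' / (w y)\<^sup>2 = f12 y * (\<sigma> * f1 y / w y ^ 3) + f22 y * (\<sigma> * f2 y / w y ^ 3)"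
          using w0'[of y] by (simp add: w'_def field_simps power2_eq_square power3_eq_cube)
        show "(\<sigma> / w (l 0)) *\<^sub>R (0 - (f12 y * h) *\<^sub>R a - (f22 y * h) *\<^sub>R b) + (- (\<sigma> * w' / (w y)\<^sup>2) * h) *\<^sub>R m (l 0)
            = h *\<^sub>R (f12 y *\<^sub>R va y + f22 y *\<^sub>R vb y)"
          unfolding k va_def vb_def l0 by (simp add: algebra_simps)
      qed
    qed
    have DGn: "((\<lambda>t. G (n (l t))) has_real_derivative f12 y * ?DG y (va y) + f22 y * ?DG y (vb y)) (at 0)"
    proof -
      have dG: "(G has_derivative ?DG y) (at (n (l 0)))"
        using Ck_on_SucE[of 0 S G "n y"] G nS y by (auto simp: l0)
      interpret linear "?DG y" by (rule has_derivative_linear[OF dG])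
      show ?thesis unfolding has_field_derivative_def
        by (rule has_derivative_eq_rhs[OF has_derivative_compose[OF Dn dG]])
          (simp add: fun_eq_iff add scale algebra_simps)
    qed
    have DB: "((\<lambda>t. 2 * \<sigma> * G (n (l t)) * w (l t) ^ 3) has_real_derivative
        2 * \<sigma> * (3 * G (n y) * w y * (f1 y * f12 y + f2 y * f22 y) + w y ^ 3 * (f12 y * ?DG y (va y) + f22 y * ?DG y (vb y)))) (at 0)"
    proof -
      have e: "of_nat 3 * (w' * w y ^ (3 - Suc 0)) = 3 * w y * (f1 y * f12 y + f2 y * f22 y)"
        using w0'[of y] by (simp add: w'_def power2_eq_square)
      show ?thesis
        using DERIV_mult[OF DERIV_cmult[OF DGn, of "2 * \<sigma>"] DERIV_power[OF Dw, of 3]]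
        unfolding l0 e by (rule DERIV_cong) (simp add: algebra_simps)
    qed
    have "((\<lambda>t. 2 * \<sigma> * G (n (l t)) * w (l t) ^ 3)
       has_real_derivative
        (2 * f2 y * f22 y * f11 y + (1 + (f2 y)\<^sup>2) * pderiv2 1 (pderiv2 1 f2) y + 2 * f1 y * f12 y * f22 y + (1 + (f1 y)\<^sup>2) * pderiv2 2 f22 y
         - 2 * (f12 y * f2 y * f12 y + f1 y * f22 y * f12 y + f1 y * f2 y * pderiv2 2 (pderiv2 1 f2) y))) (at 0)"
    proof (rule has_field_derivative_transform_within_open[OF DA, of "l -` W"])
      show "open (l -` W)" by (rule open_vimage[OF W(1)]) (unfold l_def, intro continuous_intros)
      fix t assume "t \<in> l -` W"
      then show "(1 + (f2 (l t))\<^sup>2) * f11 (l t) + (1 + (f1 (l t))\<^sup>2) * f22 (l t) - 2 * f1 (l t) * f2 (l t) * f12 (l t)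
          = 2 * \<sigma> * G (n (l t)) * w (l t) ^ 3"
        using mean_curvature_equation_expanded[OF W, of "l t"] eq[of "l t"] unfolding w_def fs by simp
    qed (use y l0 in simp)
    from DERIV_unique[OF this DB] show ?thesis
      unfolding \<alpha>_def \<beta>_def f12'[OF y] by (simp add: algebra_simps)
  qed
  show thesis
    by (rule that[OF c\<alpha> c\<beta>]) (use main in \<open>simp add: f1_def f2_def f22_def\<close>)
qed

section \<open>Interior tangent planes are not vertical\<close>

lemma second_directional_derivative_plane:
  assumes W: "open W" "smooth_on W g" "y \<in> W"
  shows "frechet_derivative (\<lambda>z. frechet_derivative g (at z) (s *\<^sub>R axis 1 1 + t *\<^sub>R axis 2 1)) (at y) (s *\<^sub>R axis 1 1 + t *\<^sub>R axis 2 1)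
    = s\<^sup>2 * pderiv2 1 (pderiv2 1 g) y + 2 * s * t * pderiv2 2 (pderiv2 1 g) y + t\<^sup>2 * pderiv2 2 (pderiv2 2 g) y"
proof -
  have lin: "frechet_derivative h (at z) (s *\<^sub>R axis 1 1 + t *\<^sub>R axis 2 1) = s * pderiv2 1 h z + t * pderiv2 2 h z"
    if "smooth_on W h" "z \<in> W" for h z
  proof -
    interpret linear "frechet_derivative h (at z)"
      by (rule has_derivative_linear[OF smooth_on_has_derivative[OF that]])
    show ?thesis by (simp add: add scale pderiv2_def)
  qed
  note sm = smooth_on_pderiv2[OF W(2)]
  let ?h = "\<lambda>z. s * pderiv2 1 g z + t * pderiv2 2 g z"
  have sh: "smooth_on W ?h"
    by (intro smooth_on_add smooth_on_mult smooth_on_const sm W(1))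
  have p: "pderiv2 i ?h y = s * pderiv2 i (pderiv2 1 g) y + t * pderiv2 i (pderiv2 2 g) y" for i
  proof -
    note d = smooth_on_has_derivative[OF sm W(3)]
    have "(?h has_derivative (\<lambda>v. s * frechet_derivative (pderiv2 1 g) (at y) v + t * frechet_derivative (pderiv2 2 g) (at y) v)) (at y)"
      by (intro has_derivative_add has_derivative_mult_right d)
    from fun_cong[OF frechet_derivative_at[OF this], of "axis i 1"] show ?thesis by (simp add: pderiv2_def)
  qed
  have "frechet_derivative (\<lambda>z. frechet_derivative g (at z) (s *\<^sub>R axis 1 1 + t *\<^sub>R axis 2 1)) (at y) = frechet_derivative ?h (at y)"
    by (rule frechet_derivative_cong_open(2)[OF W(1,3) _ smooth_on_differentiable[OF sh W(3)]])
      (simp add: lin[OF W(2)])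
  then show ?thesis
    using lin[OF sh W(3)] pderiv2_commute[OF W, of 1 2] by (simp add: p power2_eq_square algebra_simps)
qed

lemma pderiv2_cmult:
  assumes "f differentiable (at y)"
  shows "pderiv2 i (\<lambda>y. k * f y) y = k * pderiv2 i f y"
proof -
  have "((\<lambda>y. k * f y) has_derivative (\<lambda>v. k * frechet_derivative f (at y) v)) (at y)"
    by (intro has_derivative_mult_right) (use assms frechet_derivative_works in blast)
  from fun_cong[OF frechet_derivative_at[OF this], of "axis i 1"] show ?thesis by (simp add: pderiv2_def)
qed

text \<open>Each section is injective and continuous, hence monotone. It increases if and only if
  \<open>\<Delta> s = F s \<delta> - F s (- \<delta>)\<close> is positive, and \<open>\<Delta>\<close> is continuous without zeros, so the direction is
  the same for all sections.\<close>

lemma monotone_sections_of_injective_graph: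
  fixes F F' :: "real \<Rightarrow> real \<Rightarrow> real"
  assumes \<delta>: "\<delta> > 0" and inj: "\<And>s. \<bar>s\<bar> \<le> \<delta> \<Longrightarrow> inj_on (F s) {-\<delta>..\<delta>}"
    and c1: "\<And>t. \<bar>t\<bar> \<le> \<delta> \<Longrightarrow> continuous_on {-\<delta>..\<delta>} (\<lambda>s. F s t)"
    and d: "\<And>s t. \<bar>s\<bar> \<le> \<delta> \<Longrightarrow> \<bar>t\<bar> \<le> \<delta> \<Longrightarrow> (F s has_real_derivative F' s t) (at t)"
  obtains \<tau> :: real where "\<tau> = 1 \<or> \<tau> = -1" "\<And>s t. \<bar>s\<bar> < \<delta> \<Longrightarrow> \<bar>t\<bar> < \<delta> \<Longrightarrow> \<tau> * F' s t \<ge> 0"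
proof -
  define \<Delta> where "\<Delta> = (\<lambda>s. F s \<delta> - F s (-\<delta>))"
  have c\<Delta>: "continuous_on {-\<delta>..\<delta>} \<Delta>" unfolding \<Delta>_def by (intro continuous_intros c1) (use \<delta> in auto)
  have nz: "\<Delta> s \<noteq> 0" if "s \<in> {-\<delta>..\<delta>}" for s
  proof
    assume "\<Delta> s = 0"
    then have eq: "F s \<delta> = F s (-\<delta>)" by (simp add: \<Delta>_def)
    have "\<bar>s\<bar> \<le> \<delta>" using that by auto
    from inj_onD[OF inj[OF this] eq] have "\<delta> = -\<delta>" using \<delta> by simp
    then show False using \<delta> by simp
  qed
  have conn: "connected (\<Delta> ` {-\<delta>..\<delta>})" by (rule connected_continuous_image[OF c\<Delta>]) simp
  have same: "\<Delta> s > 0" if "\<Delta> s' > 0" "s \<in> {-\<delta>..\<delta>}" "s' \<in> {-\<delta>..\<delta>}" for s s'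
  proof (rule ccontr)
    assume "\<not> \<Delta> s > 0"
    moreover have "{\<Delta> s..\<Delta> s'} \<subseteq> \<Delta> ` {-\<delta>..\<delta>}" by (rule connected_contains_Icc[OF conn]) (use that in auto)
    ultimately have "0 \<in> \<Delta> ` {-\<delta>..\<delta>}" using that by auto
    then show False using nz by auto
  qed
  define \<tau> where "\<tau> = sgn (\<Delta> 0)"
  have \<tau>: "\<tau> = 1 \<or> \<tau> = -1" using nz[of 0] \<delta> by (auto simp: \<tau>_def sgn_if)
  have pos: "\<tau> * \<Delta> s > 0" if "s \<in> {-\<delta>..\<delta>}" for s
  proof (cases "\<Delta> 0 > 0")
    case True
    then show ?thesis using same[OF True that] \<delta> by (simp add: \<tau>_def)
  next
    case False
    then have "\<Delta> 0 < 0" using nz[of 0] \<delta> by (simp add: less_le)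
    moreover have "\<not> \<Delta> s > 0"
    proof
      assume "\<Delta> s > 0"
      from same[OF this _ that, of 0] show False using False \<delta> by simp
    qed
    then have "\<Delta> s < 0" using nz[OF that] by simp
    ultimately show ?thesis by (simp add: \<tau>_def)
  qed
  have "\<tau> * F' s t \<ge> 0" if s: "\<bar>s\<bar> < \<delta>" and t: "\<bar>t\<bar> < \<delta>" for s t
  proof (rule ccontr)
    assume neg: "\<not> \<tau> * F' s t \<ge> 0"
    let ?\<phi> = "\<lambda>t. \<tau> * F s t"
    have d\<phi>: "(?\<phi> has_real_derivative \<tau> * F' s t) (at t)" if "\<bar>t\<bar> \<le> \<delta>" for t
      by (rule DERIV_cmult[OF d]) (use s that in auto)
    have c\<phi>: "continuous_on {-\<delta>..\<delta>} ?\<phi>"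
      by (intro continuous_at_imp_continuous_on ballI DERIV_isCont[OF d\<phi>]) auto
    have i\<phi>: "inj_on ?\<phi> {-\<delta>..\<delta>}"
    proof (rule inj_onI)
      fix t t' assume tt: "t \<in> {-\<delta>..\<delta>}" "t' \<in> {-\<delta>..\<delta>}" "?\<phi> t = ?\<phi> t'"
      then have "F s t = F s t'" using \<tau> by auto
      moreover have "\<bar>s\<bar> \<le> \<delta>" using s by simp
      ultimately show "t = t'" using inj_onD[OF inj] tt(1,2) by metis
    qed
    have "s \<in> {-\<delta>..\<delta>}" using s by auto
    from pos[OF this] have "?\<phi> (-\<delta>) < ?\<phi> \<delta>" by (simp add: \<Delta>_def right_diff_distrib)
    moreover have "(?\<phi> (-\<delta>) < ?\<phi> t \<and> ?\<phi> t < ?\<phi> \<delta>) \<or> (?\<phi> \<delta> < ?\<phi> t \<and> ?\<phi> t < ?\<phi> (-\<delta>))"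
      by (rule continuous_inj_imp_mono[OF _ _ c\<phi> i\<phi>]) (use t in auto)
    ultimately have 1: "?\<phi> t < ?\<phi> \<delta>" by linarith
    have "\<exists>e>0. \<forall>h>0. h < e \<longrightarrow> ?\<phi> (t + h) < ?\<phi> t"
      by (rule DERIV_neg_dec_right[OF d\<phi>]) (use neg t in auto)
    then obtain e where e: "e > 0" "\<And>h. 0 < h \<Longrightarrow> h < e \<Longrightarrow> ?\<phi> (t + h) < ?\<phi> t" by auto
    define k where "k = min e (\<delta> - t)"
    have "0 < k" "k \<le> e" "k \<le> \<delta> - t" using e t by (auto simp: k_def)
    moreover define h where "h = k / 2"
    ultimately have h: "0 < h" "h < e" "t + h < \<delta>" by simp_all
    have "(?\<phi> t < ?\<phi> (t + h) \<and> ?\<phi> (t + h) < ?\<phi> \<delta>) \<or> (?\<phi> \<delta> < ?\<phi> (t + h) \<and> ?\<phi> (t + h) < ?\<phi> t)"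
      by (rule continuous_inj_imp_mono[OF _ h(3) continuous_on_subset[OF c\<phi>] inj_on_subset[OF i\<phi>]]) (use h t in auto)
    then show False using e(2)[OF h(1,2)] 1 by linarith
  qed
  then show thesis by (rule that[OF \<tau>])
qed

lemma bounded_on_compact:
  fixes f :: "'a::topological_space \<Rightarrow> 'b::real_normed_vector"
  assumes "compact K" "continuous_on K f"
  obtains B where "B \<ge> 0" "\<And>x. x \<in> K \<Longrightarrow> norm (f x) \<le> B"
proof -
  have "bounded (f ` K)" by (rule compact_imp_bounded[OF compact_continuous_image[OF assms(2,1)]])
  then obtain B where "\<forall>x\<in>f ` K. norm x \<le> B" by (auto simp: bounded_iff)
  then have "norm (f x) \<le> max B 0" if "x \<in> K" for x using that by (simp add: le_max_iff_disj)
  then show thesis by (intro that[of "max B 0"] max.cobounded2)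
qed

text \<open>At a point with vertical tangent plane take the normal as the third axis \<open>c\<close> of the frame and \<open>\<nu>\<close> as
  the second one, so that the surface is locally the graph of some \<open>f\<close> and \<open>pderiv2 2 f\<close> vanishes at the
  point. By the graph property it does not change sign, so up to a sign it satisfies the hypotheses
  of Hopf's principle and vanishes nearby. Then \<open>f\<close> is constant along a vertical line, against the graph
  property.\<close>

lemma interior_normal_not_vertical:
  assumes Hs: "H_surface H M N" and C1: "C1_on_sphere H" and chart: "surface_chart M U X" and q0: "q0 \<in> U" "q0 $ 2 > 0"
    and \<nu>: "norm \<nu> = 1" and graph: "\<And>x t. x \<in> M \<Longrightarrow> x + t *\<^sub>R \<nu> \<in> M \<Longrightarrow> t = 0"
  shows "N (X q0) \<bullet> \<nu> \<noteq> 0"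
proof
  assume vert: "N (X q0) \<bullet> \<nu> = 0"
  have "q0 \<in> U \<inter> half_plane" using q0 by (simp add: half_plane_def)
  moreover have "openin (top_of_set M) (X ` (U \<inter> half_plane))" using chart by (simp add: surface_chart_def)
  then have "X ` (U \<inter> half_plane) \<subseteq> M" by (rule openin_imp_subset)
  ultimately have Xq0: "X q0 \<in> M" by blast
  have N1: "norm (N x) = 1" if "x \<in> M" for x using Hs that unfolding H_surface_def gauss_map_def by auto
  define c where "c = N (X q0)"
  define a where "a = cross3 \<nu> c"
  have c1: "norm c = 1" unfolding c_def by (rule N1[OF Xq0])
  have \<nu>c: "\<nu> \<bullet> c = 0" using vert by (simp add: c_def inner_commute)
  have "(norm a)\<^sup>2 = 1" using norm_cross_dot[of \<nu> c] \<nu> c1 \<nu>c by (simp add: a_def)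
  then have "sqrt ((norm a)\<^sup>2) = 1" by simp
  then have "norm a = 1" by simp
  then have frame: "orthonormal_frame a \<nu> c"
    using \<nu> c1 \<nu>c by (simp add: orthonormal_frame_def a_def dot_cross_self)
  have Nc: "N (X q0) \<bullet> c \<noteq> 0" using c1 by (simp add: c_def[symmetric] norm_eq_1)
  let ?y0 = "((X q0 - X q0) \<bullet> a) *\<^sub>R axis 1 1 + ((X q0 - X q0) \<bullet> \<nu>) *\<^sub>R axis 2 1 :: real^2"
  obtain W f \<sigma> where W: "open W" and y0W: "?y0 \<in> W" and \<Gamma>y0: "graph_over (X q0) a \<nu> c f ?y0 = X q0"
    and sf: "smooth_on W f" and \<sigma>: "\<sigma> = 1 \<or> \<sigma> = -1"
    and \<Gamma>M: "\<And>y. y \<in> W \<Longrightarrow> graph_over (X q0) a \<nu> c f y \<in> M"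
    and N_eq: "\<And>y. y \<in> W \<Longrightarrow> N (graph_over (X q0) a \<nu> c f y)
        = (\<sigma> / slope_factor f y) *\<^sub>R (c - pderiv2 1 f y *\<^sub>R a - pderiv2 2 f y *\<^sub>R \<nu>)"
    and H_eq: "\<And>y. y \<in> W \<Longrightarrow> div_unit_slope f y = 2 * \<sigma> * H (N (graph_over (X q0) a \<nu> c f y))"
    by (rule surface_local_graph[OF Hs chart q0 frame Nc, of "X q0"]) (rule that, assumption+)
  have "?y0 = 0" by simp
  with y0W \<Gamma>y0 have W0: "0 \<in> W" and \<Gamma>0: "graph_over (X q0) a \<nu> c f 0 = X q0" by auto
  obtain S G where SG: "open S \<and> sphere 0 1 \<subseteq> S \<and> Ck_on 1 S G \<and> (\<forall>x\<in>sphere 0 1. G x = H x)"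
    using C1 unfolding C1_on_sphere_def by (elim exE) (rule that)
  then have S: "open S" "sphere 0 1 \<subseteq> S" and G: "Ck_on 1 S G" and GH: "\<And>x. x \<in> sphere 0 1 \<Longrightarrow> G x = H x"
    by (simp_all del: Ck_on.simps One_nat_def)
  define n where "n = (\<lambda>y. (\<sigma> / slope_factor f y) *\<^sub>R (c - pderiv2 1 f y *\<^sub>R a - pderiv2 2 f y *\<^sub>R \<nu>))"
  have n_sphere: "n y \<in> sphere 0 1" if "y \<in> W" for y
    using N1[OF \<Gamma>M[OF that]] unfolding n_def N_eq[OF that, symmetric] by simp
  obtain \<alpha> \<beta> where \<alpha>\<beta>: "continuous_on W \<alpha>" "continuous_on W \<beta>"
    and lin: "\<And>y. y \<in> W \<Longrightarrow> (1 + (pderiv2 2 f y)\<^sup>2) * pderiv2 1 (pderiv2 1 (pderiv2 2 f)) y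
        + (1 + (pderiv2 1 f y)\<^sup>2) * pderiv2 2 (pderiv2 2 (pderiv2 2 f)) y
        - 2 * pderiv2 1 f y * pderiv2 2 f y * pderiv2 2 (pderiv2 1 (pderiv2 2 f)) y
      = \<alpha> y * pderiv2 1 (pderiv2 2 f) y + \<beta> y * pderiv2 2 (pderiv2 2 f) y"
  proof (rule linearized_mean_curvature_equation[OF W sf G n_def])
    show "n ` W \<subseteq> S" using n_sphere S by auto
    show "div_unit_slope f y = 2 * \<sigma> * G (n y)" if "y \<in> W" for y
      using H_eq[OF that] N_eq[OF that] GH[OF n_sphere[OF that]] by (simp add: n_def)
  qed (rule that)
  obtain r where r: "r > 0" "cball 0 r \<subseteq> W" using W W0 open_contains_cball by blast
  define \<delta> where "\<delta> = r / 2"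
  have \<delta>: "\<delta> > 0" using r by (simp add: \<delta>_def)
  define l where "l = (\<lambda>s t. s *\<^sub>R axis 1 1 + t *\<^sub>R axis 2 1 :: real^2)"
  have lW: "l s t \<in> W" if "\<bar>s\<bar> \<le> \<delta>" "\<bar>t\<bar> \<le> \<delta>" for s t
  proof -
    have "norm (l s t) \<le> \<bar>s\<bar> + \<bar>t\<bar>" unfolding l_def by (rule order_trans[OF norm_triangle_ineq]) simp
    then show ?thesis using that r by (auto simp: \<delta>_def)
  qed
  have lc: "l s t $ 1 = s" "l s t $ 2 = t" for s t by (simp_all add: l_def axis_def)
  let ?h = "pderiv2 2 f"
  have sh: "smooth_on W ?h" by (rule smooth_on_pderiv2[OF sf])
  have dl: "((\<lambda>t. f (l s t)) has_real_derivative ?h (l s t)) (at t)" if "\<bar>s\<bar> \<le> \<delta>" "\<bar>t\<bar> \<le> \<delta>" for s t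
    unfolding l_def pderiv2_def
    by (rule has_real_derivative_along_line) (use smooth_on_has_derivative[OF sf lW[OF that]] in \<open>simp add: l_def\<close>)
  have inj: "inj_on (\<lambda>t. f (l s t)) {-\<delta>..\<delta>}" if "\<bar>s\<bar> \<le> \<delta>" for s
  proof (rule inj_onI)
    fix t t' assume t: "t \<in> {-\<delta>..\<delta>}" "t' \<in> {-\<delta>..\<delta>}" "f (l s t) = f (l s t')"
    have "graph_over (X q0) a \<nu> c f (l s t') = graph_over (X q0) a \<nu> c f (l s t) + (t' - t) *\<^sub>R \<nu>"
      unfolding graph_over_def lc t(3) by (simp add: algebra_simps)
    then have "t' - t = 0" using graph \<Gamma>M lW that t by (metis abs_le_iff atLeastAtMost_iff minus_le_iff)
    then show "t = t'" by simp
  qed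
  obtain \<tau> :: real where \<tau>: "\<tau> = 1 \<or> \<tau> = -1" and mono: "\<And>s t. \<bar>s\<bar> < \<delta> \<Longrightarrow> \<bar>t\<bar> < \<delta> \<Longrightarrow> \<tau> * ?h (l s t) \<ge> 0"
  proof (rule monotone_sections_of_injective_graph[OF \<delta> inj _ dl])
    show "continuous_on {-\<delta>..\<delta>} (\<lambda>s. f (l s t))" if "\<bar>t\<bar> \<le> \<delta>" for t
      by (rule continuous_on_compose2[OF smooth_on_continuous_on[OF sf]])
        (use lW that in \<open>auto simp: l_def intro!: continuous_intros\<close>)
  qed (assumption | rule that)+
  define g where "g = (\<lambda>y. \<tau> * ?h y)"
  have sg: "smooth_on W g" unfolding g_def by (intro smooth_on_mult W smooth_on_const sh)
  have pg: "pderiv2 i g y = \<tau> * pderiv2 i ?h y" if "y \<in> W" for i y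
    unfolding g_def by (rule pderiv2_cmult[OF smooth_on_differentiable[OF sh that]])
  have pgg: "pderiv2 j (pderiv2 i g) y = \<tau> * pderiv2 j (pderiv2 i ?h) y" if "y \<in> W" for i j y
  proof -
    note s = smooth_on_pderiv2[OF sh, of i]
    have "pderiv2 j (pderiv2 i g) y = pderiv2 j (\<lambda>y. \<tau> * pderiv2 i ?h y) y"
      by (rule pderiv2_cong[OF W that]) (auto simp: pg intro!: smooth_on_differentiable[OF _ that] smooth_on_mult W smooth_on_const s)
    also have "\<dots> = \<tau> * pderiv2 j (pderiv2 i ?h) y"
      by (rule pderiv2_cmult[OF smooth_on_differentiable[OF s that]])
    finally show ?thesis .
  qed
  define B where "B = ball (0 :: real^2) \<delta>"
  have cBW: "cball 0 \<delta> \<subseteq> W" using r by (auto simp: \<delta>_def)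
  have BW: "B \<subseteq> W" using cBW by (auto simp: B_def)
  \<comment> \<open>The mean curvature operator is the Laplacian plus the second derivative along the rotated
    gradient of \<open>f\<close>.\<close>
  define m where "m = (\<lambda>y. pderiv2 2 f y *\<^sub>R axis 1 1 + (- pderiv2 1 f y) *\<^sub>R axis 2 1 :: real^2)"
  have cm: "continuous_on W m" unfolding m_def
    by (intro continuous_intros smooth_on_continuous_on[OF smooth_on_pderiv2[OF sf]])
  note cs = continuous_on_subset[OF _ cBW]
  obtain Ca where Ca: "Ca \<ge> 0" "\<And>x. x \<in> cball 0 \<delta> \<Longrightarrow> norm (\<alpha> x) \<le> Ca"
    by (rule bounded_on_compact[OF compact_cball cs[OF \<alpha>\<beta>(1)]]) (rule that)
  obtain Cb where Cb: "Cb \<ge> 0" "\<And>x. x \<in> cball 0 \<delta> \<Longrightarrow> norm (\<beta> x) \<le> Cb"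
    by (rule bounded_on_compact[OF compact_cball cs[OF \<alpha>\<beta>(2)]]) (rule that)
  obtain Cm where Cm: "Cm \<ge> 0" "\<And>x. x \<in> cball 0 \<delta> \<Longrightarrow> norm (m x) \<le> Cm"
    by (rule bounded_on_compact[OF compact_cball cs[OF cm]]) (rule that)
  define C where "C = Ca + Cb + Cm"
  have C: "C \<ge> 0" "Ca \<le> C" "Cb \<le> C" "Cm \<le> C" using Ca Cb Cm by (auto simp: C_def)
  have zero: "g y = 0" if "y \<in> ball 0 (\<delta> / 2)" for y
  proof (rule hopf_strong_minimum_principle[where B = B and ?y0.0 = 0 and r = \<delta> and C = C and n = m])
    show "Ck_on 2 B g" by (rule smooth_on_Ck[OF smooth_on_subset[OF sg BW]])
    show "0 \<le> g y" if "y \<in> B" for y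
    proof -
      have "\<bar>y $ i\<bar> < \<delta>" for i using component_le_norm_cart[of y i] that by (auto simp: B_def)
      then show ?thesis using mono[of "y $ 1" "y $ 2"] unfolding g_def l_def real2_expand[of y, symmetric] by simp
    qed
    show "g 0 = 0"
    proof -
      have "N (X q0) \<bullet> \<nu> = - (\<sigma> / slope_factor f 0 * ?h 0)"
        using N_eq[OF W0] unfolding \<Gamma>0 by (simp add: inner_simps frame_inner[OF frame])
      then show ?thesis using vert \<sigma> slope_factor_pos[of f 0] by (auto simp: g_def)
    qed
    show "norm (m y) \<le> C" if "y \<in> B" for y
      using Cm(2)[of y] C that by (auto simp: B_def)
    show "frechet_derivative (\<lambda>z. frechet_derivative g (at z) (axis 1 1)) (at y) (axis 1 1) +
         frechet_derivative (\<lambda>z. frechet_derivative g (at z) (axis 2 1)) (at y) (axis 2 1) +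
         frechet_derivative (\<lambda>z. frechet_derivative g (at z) (m y)) (at y) (m y)
         \<le> C * (\<bar>frechet_derivative g (at y) (axis 1 1)\<bar> + \<bar>frechet_derivative g (at y) (axis 2 1)\<bar>)" if y: "y \<in> B" for y
    proof -
      have yW: "y \<in> W" using y BW by auto
      have yc: "y \<in> cball 0 \<delta>" using y by (auto simp: B_def)
      have m2: "frechet_derivative (\<lambda>z. frechet_derivative g (at z) (m y)) (at y) (m y)
         = (pderiv2 2 f y)\<^sup>2 * pderiv2 1 (pderiv2 1 g) y + 2 * pderiv2 2 f y * (- pderiv2 1 f y) * pderiv2 2 (pderiv2 1 g) y
           + (- pderiv2 1 f y)\<^sup>2 * pderiv2 2 (pderiv2 2 g) y"
        unfolding m_def by (rule second_directional_derivative_plane[OF W sg yW])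
      have "pderiv2 1 (pderiv2 1 g) y + pderiv2 2 (pderiv2 2 g) y + frechet_derivative (\<lambda>z. frechet_derivative g (at z) (m y)) (at y) (m y)
        = \<tau> * ((1 + (pderiv2 2 f y)\<^sup>2) * pderiv2 1 (pderiv2 1 ?h) y
        + (1 + (pderiv2 1 f y)\<^sup>2) * pderiv2 2 (pderiv2 2 ?h) y
        - 2 * pderiv2 1 f y * pderiv2 2 f y * pderiv2 2 (pderiv2 1 ?h) y)"
        unfolding m2 pgg[OF yW] by (simp add: algebra_simps)
      also have "\<dots> = \<alpha> y * pderiv2 1 g y + \<beta> y * pderiv2 2 g y"
        unfolding lin[OF yW] pg[OF yW] by (simp add: algebra_simps)
      also have "\<dots> \<le> C * \<bar>pderiv2 1 g y\<bar> + C * \<bar>pderiv2 2 g y\<bar>"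
      proof (rule add_mono)
        have "\<bar>\<alpha> y * pderiv2 1 g y\<bar> \<le> C * \<bar>pderiv2 1 g y\<bar>"
          unfolding abs_mult using Ca(2)[OF yc] C by (intro mult_right_mono) auto
        then show "\<alpha> y * pderiv2 1 g y \<le> C * \<bar>pderiv2 1 g y\<bar>" by linarith
        have "\<bar>\<beta> y * pderiv2 2 g y\<bar> \<le> C * \<bar>pderiv2 2 g y\<bar>"
          unfolding abs_mult using Cb(2)[OF yc] C by (intro mult_right_mono) auto
        then show "\<beta> y * pderiv2 2 g y \<le> C * \<bar>pderiv2 2 g y\<bar>" by linarith
      qed
      finally show ?thesis by (simp add: pderiv2_def[abs_def] distrib_left)
    qed
  qed (use \<delta> C that in \<open>auto simp: B_def\<close>)
  have "((\<lambda>t. f (l 0 t)) has_real_derivative ?h (l 0 t)) (at t)" if "0 \<le> t" "t \<le> \<delta> / 4" for t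
    by (rule dl) (use \<delta> that in auto)
  then have "\<exists>z>0. z < \<delta> / 4 \<and> f (l 0 (\<delta> / 4)) - f (l 0 0) = (\<delta> / 4 - 0) * ?h (l 0 z)"
    by (rule MVT2[rotated]) (use \<delta> in auto)
  then obtain z where z: "0 < z" "z < \<delta> / 4" "f (l 0 (\<delta> / 4)) - f (l 0 0) = (\<delta> / 4 - 0) * ?h (l 0 z)"
    by (elim exE conjE) (rule that)
  have "g (l 0 z) = 0" by (rule zero) (use z \<delta> in \<open>simp add: l_def\<close>)
  then have "?h (l 0 z) = 0" using \<tau> by (auto simp: g_def)
  then have "f (l 0 (\<delta> / 4)) = f (l 0 0)" using z(3) by simp
  from inj_onD[OF inj[of 0] this] have "\<delta> / 4 = 0" using \<delta> by simp
  then show False using \<delta> by simp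
qed

section \<open>The part of a graph that lies above the plane\<close>

definition plane_point :: "real^3 \<Rightarrow> real^3 \<Rightarrow> real^3 \<Rightarrow> real^2 \<Rightarrow> real^3" where
  "plane_point p a b y = p + y $ 1 *\<^sub>R a + y $ 2 *\<^sub>R b"

definition plane_coords :: "real^3 \<Rightarrow> real^3 \<Rightarrow> real^3 \<Rightarrow> real^3 \<Rightarrow> real^2" where
  "plane_coords p a b x = ((x - p) \<bullet> a) *\<^sub>R axis 1 1 + ((x - p) \<bullet> b) *\<^sub>R axis 2 1"

lemma plane_coords_nth: "plane_coords p a b x $ 1 = (x - p) \<bullet> a" "plane_coords p a b x $ 2 = (x - p) \<bullet> b"
  by (simp_all add: plane_coords_def axis_def)

lemma graph_over_plane_point: "graph_over p a b c f y = plane_point p a b y + f y *\<^sub>R c"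
  by (simp add: graph_over_def plane_point_def)

text \<open>The last assumption only fixes the origin \<open>p\<close>: with the whole graph at positive second coordinate, the graph
  parametrization itself becomes a surface chart, of which only the part in the half plane counts.\<close>

locale graph_surface =
  fixes H :: "real^3 \<Rightarrow> real" and M :: "(real^3) set" and N :: "real^3 \<Rightarrow> real^3" and p a b \<nu> :: "real^3"
    and A :: "(real^3) set" and h :: "real^3 \<Rightarrow> real" and K :: real
  assumes Hs: "H_surface H M N" and C1: "C1_on_sphere H" and cM: "compact M"
    and frame: "orthonormal_frame a b \<nu>"
    and bd: "surface_boundary M \<subseteq> {x. (x - p) \<bullet> \<nu> = 0}"
    and A: "A \<subseteq> {x. (x - p) \<bullet> \<nu> = 0}" and M: "M = (\<lambda>q. q + h q *\<^sub>R \<nu>) ` A"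
    and K: "K > 0" "\<And>x. x \<in> sphere 0 1 \<Longrightarrow> \<bar>H x\<bar> \<le> K"
    and positive: "\<And>q. q \<in> A \<Longrightarrow> (q - p) \<bullet> b > 0"
begin

definition u :: "real^2 \<Rightarrow> real" where
  "u y = h (plane_point p a b y)"

definition D :: "(real^2) set" where
  "D = {y. plane_point p a b y \<in> A \<and> u y > 0}"

lemmas fi = frame_inner[OF frame]

lemma M_decompose:
  assumes "x \<in> M"
  shows "x - ((x - p) \<bullet> \<nu>) *\<^sub>R \<nu> \<in> A" and "h (x - ((x - p) \<bullet> \<nu>) *\<^sub>R \<nu>) = (x - p) \<bullet> \<nu>"
proof -
  obtain q where q: "q \<in> A" "x = q + h q *\<^sub>R \<nu>" using assms M by auto
  have "(q - p) \<bullet> \<nu> = 0" using q A by auto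
  then have "(x - p) \<bullet> \<nu> = h q" using q fi by (simp add: inner_simps)
  then show "x - ((x - p) \<bullet> \<nu>) *\<^sub>R \<nu> \<in> A" "h (x - ((x - p) \<bullet> \<nu>) *\<^sub>R \<nu>) = (x - p) \<bullet> \<nu>" using q by auto
qed

lemma M_graph: "x \<in> M \<Longrightarrow> x + t *\<^sub>R \<nu> \<in> M \<Longrightarrow> t = 0"
proof -
  assume x: "x \<in> M" and xt: "x + t *\<^sub>R \<nu> \<in> M"
  have e: "(x + t *\<^sub>R \<nu> - p) \<bullet> \<nu> = (x - p) \<bullet> \<nu> + t" using fi by (simp add: inner_simps)
  have "x + t *\<^sub>R \<nu> - ((x - p) \<bullet> \<nu> + t) *\<^sub>R \<nu> = x - ((x - p) \<bullet> \<nu>) *\<^sub>R \<nu>" by (simp add: algebra_simps)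
  then have "h (x + t *\<^sub>R \<nu> - ((x - p) \<bullet> \<nu> + t) *\<^sub>R \<nu>) = h (x - ((x - p) \<bullet> \<nu>) *\<^sub>R \<nu>)" by (rule arg_cong)
  then show "t = 0" using M_decompose(2)[OF x] M_decompose(2)[OF xt, unfolded e] by linarith
qed

lemma plane_point_inner:
  "(plane_point p a b y + t *\<^sub>R \<nu> - p) \<bullet> a = y $ 1" "(plane_point p a b y + t *\<^sub>R \<nu> - p) \<bullet> b = y $ 2"
  "(plane_point p a b y + t *\<^sub>R \<nu> - p) \<bullet> \<nu> = t"
  using fi by (simp_all add: plane_point_def inner_simps)

lemma coords_plane_point: "plane_coords p a b (plane_point p a b y + t *\<^sub>R \<nu>) = y"
  unfolding plane_coords_def plane_point_inner by (rule real2_expand[symmetric])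

lemma graph_in_M_iff:
  "graph_over p a b \<nu> f y \<in> M \<longleftrightarrow> plane_point p a b y \<in> A \<and> f y = u y"
proof
  assume "graph_over p a b \<nu> f y \<in> M"
  from M_decompose[OF this[unfolded graph_over_plane_point]]
  show "plane_point p a b y \<in> A \<and> f y = u y" unfolding plane_point_inner u_def by simp
next
  assume "plane_point p a b y \<in> A \<and> f y = u y"
  then show "graph_over p a b \<nu> f y \<in> M" unfolding M graph_over_plane_point u_def by auto
qed

lemma plane_point_coords:
  assumes "(x - p) \<bullet> \<nu> = t"
  shows "plane_point p a b (plane_coords p a b x) + t *\<^sub>R \<nu> = x"
proof -
  have "p + (((x - p) \<bullet> a) *\<^sub>R a + ((x - p) \<bullet> b) *\<^sub>R b + ((x - p) \<bullet> \<nu>) *\<^sub>R \<nu>) = p + (x - p)"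
    by (rule arg_cong[OF frame_expand[OF frame, symmetric]])
  then show ?thesis unfolding plane_point_def plane_coords_nth assms by (simp add: add.assoc)
qed

lemma above_plane:
  assumes "x \<in> M" "(x - p) \<bullet> \<nu> > 0"
  shows "plane_coords p a b x \<in> D" "graph_over p a b \<nu> u (plane_coords p a b x) = x" "u (plane_coords p a b x) = (x - p) \<bullet> \<nu>"
proof -
  define y where "y = plane_coords p a b x"
  have x: "graph_over p a b \<nu> (\<lambda>_. (x - p) \<bullet> \<nu>) y = x"
    unfolding graph_over_plane_point y_def by (rule plane_point_coords) simp
  then have "plane_point p a b y \<in> A" "(x - p) \<bullet> \<nu> = u y"
    using graph_in_M_iff[of "\<lambda>_. (x - p) \<bullet> \<nu>" y] assms(1) by simp_all
  then show "plane_coords p a b x \<in> D" "graph_over p a b \<nu> u (plane_coords p a b x) = x" "u (plane_coords p a b x) = (x - p) \<bullet> \<nu>"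
    using x assms(2) unfolding D_def y_def[symmetric] by (auto simp: graph_over_plane_point)
qed

text \<open>A point of \<open>M\<close> above the plane does not belong to the boundary, so every chart around it maps an
  interior point of the half plane to it, and its tangent plane is not vertical. The local graph that this
  yields over the plane must coincide with \<open>u\<close>, since a point of \<open>M\<close> determines its foot in \<open>A\<close>.\<close>

lemma local_regularity:
  assumes y0: "y0 \<in> D"
  obtains T where "open T" "y0 \<in> T" "T \<subseteq> D" "smooth_on T u"
    "\<And>y. y \<in> T \<Longrightarrow> \<bar>div_unit_slope u y\<bar> \<le> 2 * K"
proof -
  define x0 where "x0 = graph_over p a b \<nu> u y0"
  have x0M: "x0 \<in> M" using y0 graph_in_M_iff[of u y0] by (simp add: D_def x0_def)
  have x0\<nu>: "(x0 - p) \<bullet> \<nu> > 0" using y0 unfolding x0_def graph_over_plane_point plane_point_inner D_def by simp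
  have "smooth_surface M" using Hs by (simp add: H_surface_def)
  then obtain U X where chart: "surface_chart M U X" and "x0 \<in> X ` (U \<inter> half_plane)"
    using x0M unfolding smooth_surface_def by blast
  then obtain q0 where q0: "q0 \<in> U" "q0 $ 2 \<ge> 0" "X q0 = x0" by (auto simp: half_plane_def)
  have "q0 $ 2 \<noteq> 0"
  proof
    assume "q0 $ 2 = 0"
    then have "X q0 \<in> surface_boundary M" using chart q0(1) unfolding surface_boundary_def by blast
    then show False using bd q0(3) x0\<nu> by auto
  qed
  then have q02: "q0 $ 2 > 0" using q0(2) by simp
  have "norm \<nu> = 1" using frame by (simp add: orthonormal_frame_def)
  have "N (X q0) \<bullet> \<nu> \<noteq> 0"
    by (rule interior_normal_not_vertical[OF Hs C1 chart q0(1) q02 \<open>norm \<nu> = 1\<close> M_graph])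
  then obtain W f \<sigma> where W: "open W" and y0W: "((X q0 - p) \<bullet> a) *\<^sub>R axis 1 1 + ((X q0 - p) \<bullet> b) *\<^sub>R axis 2 1 \<in> W"
    and sf: "smooth_on W f" and \<sigma>: "\<sigma> = 1 \<or> \<sigma> = -1"
    and \<Gamma>M: "\<And>y. y \<in> W \<Longrightarrow> graph_over p a b \<nu> f y \<in> M"
    and H_eq: "\<And>y. y \<in> W \<Longrightarrow> div_unit_slope f y = 2 * \<sigma> * H (N (graph_over p a b \<nu> f y))"
    by (rule surface_local_graph[OF Hs chart q0(1) q02 frame, of p]) (rule that, assumption+)
  have "((X q0 - p) \<bullet> a) *\<^sub>R axis 1 1 + ((X q0 - p) \<bullet> b) *\<^sub>R axis 2 1 = y0"
    unfolding q0(3) x0_def graph_over_plane_point plane_coords_def[symmetric] by (rule coords_plane_point)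
  then have y0W: "y0 \<in> W" using y0W by simp
  have fu: "plane_point p a b y \<in> A" "f y = u y" if "y \<in> W" for y
    using \<Gamma>M[OF that] graph_in_M_iff[of f y] by simp_all
  define T where "T = W \<inter> f -` {0<..}"
  have "openin (top_of_set W) T"
    unfolding T_def by (rule continuous_openin_preimage_gen[OF smooth_on_continuous_on[OF sf]]) simp
  then have T: "open T" using W openin_open_trans by blast
  have TW: "T \<subseteq> W" by (auto simp: T_def)
  have fT: "f y = u y" if "y \<in> T" for y using fu that TW by auto
  have y0T: "y0 \<in> T" using y0 y0W fu(2)[OF y0W] by (simp add: T_def D_def)
  have TD: "T \<subseteq> D" using fu by (auto simp: T_def D_def)
  have sfT: "smooth_on T f" by (rule smooth_on_subset[OF sf TW])
  have su: "smooth_on T u"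
    using sfT unfolding smooth_on_def using Ck_on_cong[OF T _ fT] by auto
  have pu: "pderiv2 i u y = pderiv2 i f y" if "y \<in> T" for i y
    by (rule pderiv2_cong[OF T that fT smooth_on_differentiable[OF sfT that]])
  have div_eq: "pderiv2 i (unit_slope i u) y = pderiv2 i (unit_slope i f) y"
    if "y \<in> T" for i y
  proof (rule pderiv2_cong[OF T that])
    show "pderiv2 i f z / slope_factor f z = pderiv2 i u z / slope_factor u z" if "z \<in> T" for z
      by (simp add: slope_factor_def pu[OF that])
    show "(unit_slope i f) differentiable (at y)"
      using normalized_gradient_has_derivative[OF sfT that] unfolding differentiable_def by blast
  qed
  have "\<bar>div_unit_slope u y\<bar> \<le> 2 * K" if "y \<in> T" for y
  proof -
    have y: "y \<in> W" using that TW by auto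
    have "N (graph_over p a b \<nu> f y) \<in> sphere 0 1"
      using \<Gamma>M[OF y] Hs unfolding H_surface_def gauss_map_def by blast
    then have "\<bar>H (N (graph_over p a b \<nu> f y))\<bar> \<le> K" by (rule K(2))
    then show ?thesis unfolding div_eq[OF that] H_eq[OF y] abs_mult using \<sigma> by auto
  qed
  then show thesis by (rule that[OF T y0T TD su])
qed

lemma open_D: "open D"
  by (subst open_subopen) (metis local_regularity)

lemma smooth_u: "smooth_on D u"
  unfolding smooth_on_def by (intro allI Ck_on_local) (metis local_regularity smooth_on_Ck)

lemma divergence_bound:
  assumes "y \<in> D"
  shows "\<bar>div_unit_slope u y\<bar> \<le> 2 * K"
proof -
  obtain T where "y \<in> T" "\<And>z. z \<in> T \<Longrightarrow> \<bar>div_unit_slope u z\<bar> \<le> 2 * K"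
    by (rule local_regularity[OF assms]) (rule that)
  then show ?thesis by simp
qed

lemma compact_superlevel:
  assumes "t > 0"
  shows "compact {y \<in> D. t \<le> u y}"
proof -
  have "closed {x. t \<le> (x - p) \<bullet> \<nu>}" by (intro closed_Collect_le continuous_intros)
  then have "compact (M \<inter> {x. t \<le> (x - p) \<bullet> \<nu>})" using cM by (rule compact_Int_closed[rotated])
  moreover have "continuous_on S (plane_coords p a b)" for S
    unfolding plane_coords_def[abs_def] by (intro continuous_intros)
  ultimately have "compact (plane_coords p a b ` (M \<inter> {x. t \<le> (x - p) \<bullet> \<nu>}))" by (intro compact_continuous_image)
  moreover have "plane_coords p a b ` (M \<inter> {x. t \<le> (x - p) \<bullet> \<nu>}) = {y \<in> D. t \<le> u y}"
  proof (intro equalityI subsetI)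
    fix y assume "y \<in> plane_coords p a b ` (M \<inter> {x. t \<le> (x - p) \<bullet> \<nu>})"
    then obtain x where "x \<in> M" "t \<le> (x - p) \<bullet> \<nu>" "y = plane_coords p a b x" by auto
    then show "y \<in> {y \<in> D. t \<le> u y}" using above_plane[of x] assms by auto
  next
    fix y assume y: "y \<in> {y \<in> D. t \<le> u y}"
    have "graph_over p a b \<nu> u y \<in> M" using y graph_in_M_iff[of u y] by (simp add: D_def)
    moreover have "t \<le> (graph_over p a b \<nu> u y - p) \<bullet> \<nu>" unfolding graph_over_plane_point plane_point_inner using y by simp
    moreover have "y = plane_coords p a b (graph_over p a b \<nu> u y)" unfolding graph_over_plane_point coords_plane_point ..
    ultimately show "y \<in> plane_coords p a b ` (M \<inter> {x. t \<le> (x - p) \<bullet> \<nu>})" by blast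
  qed
  ultimately show ?thesis by simp
qed

end

definition pair_to_vec :: "real \<times> real \<Rightarrow> real^2" where
  "pair_to_vec p = fst p *\<^sub>R axis 1 1 + snd p *\<^sub>R axis 2 1"

lemma pair_to_vec_nth: "pair_to_vec p $ 1 = fst p" "pair_to_vec p $ 2 = snd p"
  by (simp_all add: pair_to_vec_def axis_def)

lemma continuous_on_pair_to_vec: "continuous_on S pair_to_vec"
  unfolding pair_to_vec_def[abs_def] by (intro continuous_intros)

text \<open>The analysis takes place on pairs of reals, where iterated integrals are available, and the
  charts on \<open>real^2\<close>; this carries integrals from one to the other.\<close>

lemma lborel_real2: "(lborel :: (real^2) measure) = distr lborel borel pair_to_vec"
proof (rule lborel_eqI)
  have meas: "pair_to_vec \<in> measurable lborel borel"
    using borel_measurable_continuous_onI[OF continuous_on_pair_to_vec] by simp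
  fix l u :: "real^2" assume le: "\<And>b. b \<in> Basis \<Longrightarrow> l \<bullet> b \<le> u \<bullet> b"
  have c: "l $ 1 \<le> u $ 1" "l $ 2 \<le> u $ 2"
    using le[of "axis 1 1"] le[of "axis 2 1"] by (simp_all add: Basis_real2 inner_axis)
  have B: "(Basis :: (real \<times> real) set) = {(1, 0), (0, 1)}" by (auto simp: Basis_prod_def)
  have pre: "pair_to_vec -` box l u = box (l $ 1, l $ 2) (u $ 1, u $ 2)"
    by (auto simp: mem_box_cart forall_2 pair_to_vec_nth mem_box B)
  have "emeasure (distr lborel borel pair_to_vec) (box l u) = emeasure lborel (box (l $ 1, l $ 2) (u $ 1, u $ 2))"
    using emeasure_distr[OF meas, of "box l u"] by (simp add: pre)
  also have "\<dots> = ennreal (\<Prod>b\<in>Basis. ((u $ 1, u $ 2) - (l $ 1, l $ 2)) \<bullet> b)"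
    by (rule emeasure_lborel_box) (use c in \<open>auto simp: B\<close>)
  also have "(\<Prod>b\<in>Basis. ((u $ 1, u $ 2) - (l $ 1, l $ 2)) \<bullet> b) = (\<Prod>b\<in>Basis. (u - l) \<bullet> b)"
    using axis_12_neq by (simp add: B Basis_real2 inner_axis)
  finally show "emeasure (distr lborel borel pair_to_vec) (box l u) = (\<Prod>b\<in>Basis. (u - l) \<bullet> b)" .
qed simp

lemma smooth_on_bounded_linear: "open S \<Longrightarrow> bounded_linear L \<Longrightarrow> smooth_on S L"
  unfolding smooth_on_def by (auto intro: Ck_on_bounded_linear)

lemma norm_cross_graph_tangents:
  assumes f: "orthonormal_frame a b c"
  shows "norm (cross3 (a + s *\<^sub>R c) (b + t *\<^sub>R c)) = sqrt (1 + s\<^sup>2 + t\<^sup>2)"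
proof -
  note i = frame_inner[OF f]
  have 1: "(norm (a + s *\<^sub>R c))\<^sup>2 = 1 + s\<^sup>2" "(norm (b + t *\<^sub>R c))\<^sup>2 = 1 + t\<^sup>2" "(a + s *\<^sub>R c) \<bullet> (b + t *\<^sub>R c) = s * t"
    unfolding power2_norm_eq_inner using i by (simp_all add: inner_simps power2_eq_square)
  have "(norm (cross3 (a + s *\<^sub>R c) (b + t *\<^sub>R c)))\<^sup>2 = 1 + s\<^sup>2 + t\<^sup>2"
    using norm_cross_dot[of "a + s *\<^sub>R c" "b + t *\<^sub>R c"] unfolding power_mult_distrib 1
    by (simp add: algebra_simps)
  then show ?thesis by (metis norm_ge_zero real_sqrt_unique)
qed

context graph_surface
begin

lemma D_pos: "y \<in> D \<Longrightarrow> y $ 2 > 0"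
  using positive[of "plane_point p a b y"] plane_point_inner(2)[of y 0] by (auto simp: D_def)

lemma D_half_plane: "D \<inter> half_plane = D"
  using D_pos by (auto simp: half_plane_def less_imp_le)

lemma smooth_graph: "smooth_on D (graph_over p a b \<nu> u)"
proof -
  have "smooth_on D (\<lambda>y. p + y $ 1 *\<^sub>R a + y $ 2 *\<^sub>R b + u y *\<^sub>R \<nu>)"
    by (intro smooth_on_add open_D smooth_on_const smooth_on_bounded_linear
        smooth_on_compose_linear[OF open_D bounded_linear_scaleR_left smooth_u]
        bounded_linear_scaleR_const bounded_linear_vec_nth)
  then show ?thesis by (simp add: graph_over_def[abs_def])
qed

lemma graph_derivative:
  assumes "y \<in> D"
  shows "frechet_derivative (graph_over p a b \<nu> u) (at y) = (\<lambda>v. v $ 1 *\<^sub>R a + v $ 2 *\<^sub>R b + frechet_derivative u (at y) v *\<^sub>R \<nu>)"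
  by (rule frechet_derivative_at[OF graph_over_derivative[OF smooth_on_has_derivative[OF smooth_u assms]], symmetric])

text \<open>The graph parametrization of the whole part above the plane is one chart, which makes a single piece
  sufficient for the lower bound of the area.\<close>

lemma graph_chart: "surface_chart M D (graph_over p a b \<nu> u)"
proof -
  let ?\<Gamma> = "graph_over p a b \<nu> u"
  have inj: "inj (frechet_derivative ?\<Gamma> (at y))" if "y \<in> D" for y
  proof (rule injI)
    fix v w :: "real^2" assume eq: "frechet_derivative ?\<Gamma> (at y) v = frechet_derivative ?\<Gamma> (at y) w"
    have "frechet_derivative ?\<Gamma> (at y) v \<bullet> a = v $ 1" "frechet_derivative ?\<Gamma> (at y) v \<bullet> b = v $ 2" for v
      unfolding graph_derivative[OF that] using fi by (simp_all add: inner_simps)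
    then have "v $ 1 = w $ 1" "v $ 2 = w $ 2" using eq by metis+
    then show "v = w" by (simp add: vec_eq_iff forall_2)
  qed
  have image: "?\<Gamma> ` D = M \<inter> {x. 0 < (x - p) \<bullet> \<nu>}"
  proof (intro equalityI subsetI)
    fix x assume "x \<in> ?\<Gamma> ` D"
    then obtain y where y: "y \<in> D" "x = ?\<Gamma> y" by auto
    moreover have "?\<Gamma> y \<in> M" using y graph_in_M_iff[of u y] by (simp add: D_def)
    moreover have "(?\<Gamma> y - p) \<bullet> \<nu> = u y" unfolding graph_over_plane_point by (rule plane_point_inner(3))
    ultimately show "x \<in> M \<inter> {x. 0 < (x - p) \<bullet> \<nu>}" by (simp add: D_def)
  next
    fix x assume "x \<in> M \<inter> {x. 0 < (x - p) \<bullet> \<nu>}"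
    then show "x \<in> ?\<Gamma> ` D" using above_plane[of x] by (metis IntD1 IntD2 imageI mem_Collect_eq)
  qed
  have "open {x. 0 < (x - p) \<bullet> \<nu>}" by (intro open_Collect_less continuous_intros)
  then have "openin (top_of_set M) (?\<Gamma> ` D)" unfolding image by (rule openin_open_Int)
  moreover have "homeomorphism D (?\<Gamma> ` D) ?\<Gamma> (plane_coords p a b)"
  proof (rule homeomorphismI)
    show "continuous_on D ?\<Gamma>" by (rule smooth_on_continuous_on[OF smooth_graph])
    show "continuous_on (?\<Gamma> ` D) (plane_coords p a b)"
      unfolding plane_coords_def[abs_def] by (intro continuous_intros)
  qed (auto simp: graph_over_plane_point coords_plane_point)
  ultimately show ?thesis
    unfolding surface_chart_def D_half_plane using open_D smooth_graph inj by blast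
qed

lemma area_ge: "(\<integral>\<^sup>+y\<in>D. ennreal (slope_factor u y) \<partial>lborel) \<le> area M"
proof -
  let ?F = "{(graph_over p a b \<nu> u, D)}"
  have "(graph_over p a b \<nu> u, D) \<in> chart_pieces M"
    unfolding chart_pieces_def using graph_chart open_D D_half_plane by (auto intro!: exI[of _ D])
  then have F: "?F \<in> {F. finite F \<and> F \<subseteq> chart_pieces M \<and> disjoint_family_on (\<lambda>(X, B). X ` B) F}"
    by (simp add: disjoint_family_on_def)
  have ae: "area_element (graph_over p a b \<nu> u) y = slope_factor u y" if "y \<in> D" for y
  proof -
    have "area_element (graph_over p a b \<nu> u) y = norm (cross3 (a + pderiv2 1 u y *\<^sub>R \<nu>) (b + pderiv2 2 u y *\<^sub>R \<nu>))"
      unfolding area_element_def graph_derivative[OF that] pderiv2_def by (simp add: axis_def)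
    then show ?thesis unfolding norm_cross_graph_tangents[OF frame] slope_factor_def .
  qed
  have "(\<integral>\<^sup>+y\<in>D. ennreal (slope_factor u y) \<partial>lborel) = (\<integral>\<^sup>+y\<in>D. ennreal (area_element (graph_over p a b \<nu> u) y) \<partial>lborel)"
    by (rule nn_integral_cong) (auto simp: ae indicator_def)
  also have "\<dots> = (\<Sum>(X, B)\<in>?F. \<integral>\<^sup>+q\<in>B. ennreal (area_element X q) \<partial>lborel)" by simp
  also have "\<dots> \<le> area M" unfolding area_def by (rule SUP_upper[OF F])
  finally show ?thesis .
qed

lemma continuous_on_pderiv2_normalized_gradient:
  "continuous_on D (pderiv2 i (unit_slope j u))"
proof -
  have "continuous_on D (\<lambda>y. pderiv2 i (pderiv2 j u) y / slope_factor u y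
       - pderiv2 j u y * (pderiv2 1 u y * pderiv2 i (pderiv2 1 u) y + pderiv2 2 u y * pderiv2 i (pderiv2 2 u) y)
          / slope_factor u y ^ 3)"
    by (intro continuous_intros continuous_on_slope_factor smooth_u smooth_on_continuous_on[OF smooth_on_pderiv2]
        smooth_on_pderiv2; use slope_factor_pos[of u] in \<open>auto simp: less_imp_neq[symmetric]\<close>)
  then show ?thesis
    by (rule continuous_on_eq) (simp add: pderiv2_normalized_gradient[OF smooth_u])
qed

lemma height_bound:
  assumes q: "q \<in> A" "h q > 0"
  shows "ennreal (h q) \<le> ennreal K * area M / ennreal (2 * pi)"
proof -
  let ?\<iota> = pair_to_vec
  let ?D = "?\<iota> -` D"
  have comp: "continuous_on ?D (\<lambda>z. f (?\<iota> z))" if "continuous_on D f" for f :: "real^2 \<Rightarrow> real"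
    by (rule continuous_on_compose2[OF that continuous_on_pair_to_vec]) auto
  have line: "((\<lambda>s. f (?\<iota> (s, t))) has_real_derivative pderiv2 1 f (?\<iota> (s, t))) (at s)"
    "((\<lambda>t. f (?\<iota> (s, t))) has_real_derivative pderiv2 2 f (?\<iota> (s, t))) (at t)"
    if "f differentiable (at (?\<iota> (s, t)))" for f :: "real^2 \<Rightarrow> real" and s t
  proof -
    have d: "(f has_derivative frechet_derivative f (at (?\<iota> (s, t)))) (at (?\<iota> (s, t)))"
      using that frechet_derivative_works by blast
    have e: "?\<iota> (s, t) = t *\<^sub>R axis 2 1 + s *\<^sub>R axis 1 1" "?\<iota> (s, t) = s *\<^sub>R axis 1 1 + t *\<^sub>R axis 2 1" for s t
      by (simp_all add: pair_to_vec_def add.commute)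
    show "((\<lambda>s. f (?\<iota> (s, t))) has_real_derivative pderiv2 1 f (?\<iota> (s, t))) (at s)"
      using d unfolding pderiv2_def e(1) by (rule has_real_derivative_along_line)
    show "((\<lambda>t. f (?\<iota> (s, t))) has_real_derivative pderiv2 2 f (?\<iota> (s, t))) (at t)"
      using d unfolding pderiv2_def e(2) by (rule has_real_derivative_along_line)
  qed
  have ndiff: "(unit_slope j u) differentiable (at y)" if "y \<in> D" for j y
    using normalized_gradient_has_derivative[OF smooth_u that] unfolding differentiable_def by blast
  interpret G: mean_curvature_graph ?D "\<lambda>z. u (?\<iota> z)" "\<lambda>z. pderiv2 1 u (?\<iota> z)" "\<lambda>z. pderiv2 2 u (?\<iota> z)"
    "\<lambda>z. slope_factor u (?\<iota> z)" "\<lambda>z. pderiv2 1 (unit_slope 1 u) (?\<iota> z)"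
    "\<lambda>z. pderiv2 2 (unit_slope 2 u) (?\<iota> z)" K
  proof
    show "open ?D" by (rule open_vimage[OF open_D continuous_on_pair_to_vec])
    show "compact {z \<in> ?D. t \<le> u (?\<iota> z)}" if "t > 0" for t
    proof -
      have "continuous_on S (\<lambda>y::real^2. (y $ 1, y $ 2))" for S by (intro continuous_intros)
      from compact_continuous_image[OF this compact_superlevel[OF that]]
      have "compact ((\<lambda>y::real^2. (y $ 1, y $ 2)) ` {y \<in> D. t \<le> u y})" .
      moreover have "(\<lambda>y::real^2. (y $ 1, y $ 2)) ` {y \<in> D. t \<le> u y} = {z \<in> ?D. t \<le> u (?\<iota> z)}"
      proof (intro equalityI subsetI)
        fix z assume "z \<in> (\<lambda>y::real^2. (y $ 1, y $ 2)) ` {y \<in> D. t \<le> u y}"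
        then obtain y where y: "y \<in> D" "t \<le> u y" "z = (y $ 1, y $ 2)" by auto
        then have "?\<iota> z = y" by (simp add: pair_to_vec_def flip: real2_expand)
        then show "z \<in> {z \<in> ?D. t \<le> u (?\<iota> z)}" using y by simp
      next
        fix z assume "z \<in> {z \<in> ?D. t \<le> u (?\<iota> z)}"
        then have "?\<iota> z \<in> {y \<in> D. t \<le> u y}" by simp
        then have "(?\<iota> z $ 1, ?\<iota> z $ 2) \<in> (\<lambda>y::real^2. (y $ 1, y $ 2)) ` {y \<in> D. t \<le> u y}" by (rule imageI)
        then show "z \<in> (\<lambda>y::real^2. (y $ 1, y $ 2)) ` {y \<in> D. t \<le> u y}" by (simp add: pair_to_vec_nth)
      qed
      ultimately show ?thesis by simp
    qed
    show "continuous_on ?D (\<lambda>z. u (?\<iota> z))" by (intro comp smooth_on_continuous_on smooth_u)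
    show "continuous_on ?D (\<lambda>z. pderiv2 1 u (?\<iota> z))" "continuous_on ?D (\<lambda>z. pderiv2 2 u (?\<iota> z))"
      by (intro comp smooth_on_continuous_on smooth_on_pderiv2 smooth_u)+
    show "continuous_on ?D (\<lambda>z. pderiv2 1 (unit_slope 1 u) (?\<iota> z))"
      "continuous_on ?D (\<lambda>z. pderiv2 2 (unit_slope 2 u) (?\<iota> z))"
      by (intro comp continuous_on_pderiv2_normalized_gradient)+
    show "\<bar>pderiv2 1 (unit_slope 1 u) (?\<iota> z)
        + pderiv2 2 (unit_slope 2 u) (?\<iota> z)\<bar> \<le> 2 * K" if "z \<in> ?D" for z
      by (rule divergence_bound) (use that in simp)
    show "(\<lambda>z. slope_factor u (?\<iota> z)) = (\<lambda>z. sqrt (1 + (pderiv2 1 u (?\<iota> z))\<^sup>2 + (pderiv2 2 u (?\<iota> z))\<^sup>2))"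
      by (simp add: slope_factor_def)
    show "0 < u (?\<iota> z)" if "z \<in> ?D" for z using that by (simp add: D_def)
    show "((\<lambda>x. u (?\<iota> (x, y))) has_real_derivative pderiv2 1 u (?\<iota> (x, y))) (at x)"
      "((\<lambda>y. u (?\<iota> (x, y))) has_real_derivative pderiv2 2 u (?\<iota> (x, y))) (at y)"
      if "(x, y) \<in> ?D" for x y
      by (rule line[OF smooth_on_differentiable[OF smooth_u]], use that in simp)+
    show "((\<lambda>x. pderiv2 1 u (?\<iota> (x, y)) / slope_factor u (?\<iota> (x, y))) has_real_derivative
        pderiv2 1 (unit_slope 1 u) (?\<iota> (x, y))) (at x)"
      "((\<lambda>y. pderiv2 2 u (?\<iota> (x, y)) / slope_factor u (?\<iota> (x, y))) has_real_derivative
        pderiv2 2 (unit_slope 2 u) (?\<iota> (x, y))) (at y)"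
      if "(x, y) \<in> ?D" for x y
      using line(1)[OF ndiff[of "?\<iota> (x, y)" 1]] line(2)[OF ndiff[of "?\<iota> (x, y)" 2]] that by simp_all
  qed (rule K(1))
  define x where "x = q + h q *\<^sub>R \<nu>"
  have x: "x \<in> M" using q(1) by (auto simp: M x_def)
  have "(q - p) \<bullet> \<nu> = 0" using q(1) A by auto
  then have x\<nu>: "(x - p) \<bullet> \<nu> = h q" using fi by (simp add: x_def inner_simps)
  define y where "y = plane_coords p a b x"
  have y: "y \<in> D" "u y = h q" using above_plane[OF x] q(2) x\<nu> by (simp_all add: y_def)
  have \<iota>y: "?\<iota> (y $ 1, y $ 2) = y" by (simp add: pair_to_vec_def flip: real2_expand)
  have meas: "?\<iota> \<in> measurable lborel borel"
    using borel_measurable_continuous_onI[OF continuous_on_pair_to_vec] by simp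
  have "(\<lambda>y. indicator D y *\<^sub>R slope_factor u y) \<in> borel_measurable borel"
    by (rule borel_measurable_continuous_on_indicator[OF _ continuous_on_slope_factor[OF smooth_u]]) (use open_D in simp)
  then have "(\<lambda>y. ennreal (indicator D y *\<^sub>R slope_factor u y)) \<in> borel_measurable borel" by measurable
  moreover have "(\<lambda>y. ennreal (indicator D y *\<^sub>R slope_factor u y)) = (\<lambda>y. ennreal (slope_factor u y) * indicator D y)"
    by (auto simp: fun_eq_iff indicator_def)
  ultimately have bm: "(\<lambda>y. ennreal (slope_factor u y) * indicator D y) \<in> borel_measurable borel" by simp
  have "(\<integral>\<^sup>+y\<in>D. ennreal (slope_factor u y) \<partial>lborel) = (\<integral>\<^sup>+z. ennreal (slope_factor u (?\<iota> z)) * indicator D (?\<iota> z) \<partial>lborel)"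
    unfolding lborel_real2 by (subst nn_integral_distr[OF meas]) (use bm in simp_all)
  also have "\<dots> = (\<integral>\<^sup>+z\<in>?D. ennreal (slope_factor u (?\<iota> z)) \<partial>lborel)"
    by (rule nn_integral_cong) (simp add: indicator_def)
  finally have int: "(\<integral>\<^sup>+z\<in>?D. ennreal (slope_factor u (?\<iota> z)) \<partial>lborel) = (\<integral>\<^sup>+y\<in>D. ennreal (slope_factor u y) \<partial>lborel)" ..
  have "ennreal (u (?\<iota> (y $ 1, y $ 2))) \<le> ennreal K * (\<integral>\<^sup>+z\<in>?D. ennreal (slope_factor u (?\<iota> z)) \<partial>lborel) / ennreal (2 * pi)"
    by (rule G.height_le_area) (use y(1) \<iota>y in simp)
  also have "\<dots> \<le> ennreal K * area M / ennreal (2 * pi)"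
    unfolding int by (intro divide_right_mono_ennreal mult_left_mono area_ge) simp
  finally show ?thesis unfolding \<iota>y y(2) .
qed

end

section \<open>The height estimate\<close>

theorem theorem5p1:
  fixes H :: "real^3 \<Rightarrow> real"
    and M P :: "(real^3) set"
    and N :: "real^3 \<Rightarrow> real^3"
  assumes "C1_on_sphere H"
    and "\<forall>x\<in>sphere 0 1. H x > 0"
    and "is_plane P"
    and "compact_H_graph H M N P"
    and "surface_boundary M \<subseteq> P"
  shows "ennreal (height M P) \<le> ennreal (SUP x\<in>sphere 0 1. H x) * area M / ennreal (2 * pi)"
proof -
  let ?K = "SUP x\<in>sphere 0 1. H x"
  obtain \<Omega> \<nu> h where Hs: "H_surface H M N" and cM: "compact M" and \<Omega>: "openin (top_of_set P) \<Omega>" "\<Omega> \<noteq> {}" "bounded \<Omega>"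
    and \<nu>: "norm \<nu> = 1" "\<And>x y. x \<in> P \<Longrightarrow> y \<in> P \<Longrightarrow> \<nu> \<bullet> (x - y) = 0"
    and M: "M = (\<lambda>q. q + h q *\<^sub>R \<nu>) ` closure \<Omega>"
    using assms(4) unfolding compact_H_graph_def by blast
  have P: "affine P" "aff_dim P = 2" using assms(3) by (auto simp: is_plane_def)
  have \<Omega>P: "closure \<Omega> \<subseteq> P"
    by (rule closure_minimal[OF openin_imp_subset[OF \<Omega>(1)] affine_closed[OF P(1)]])
  obtain p0 where p0: "p0 \<in> \<Omega>" using \<Omega>(2) by auto
  then have p0P: "p0 \<in> P" using \<Omega>P closure_subset by blast
  have P_eq: "P = {x. \<nu> \<bullet> x = \<nu> \<bullet> p0}"
  proof (rule affine_dim_equal)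
    show "P \<subseteq> {x. \<nu> \<bullet> x = \<nu> \<bullet> p0}" using \<nu>(2)[OF _ p0P] by (auto simp: inner_diff_right)
    have "\<nu> \<noteq> 0" using \<nu>(1) by auto
    then show "aff_dim P = aff_dim {x. \<nu> \<bullet> x = \<nu> \<bullet> p0}" using P(2) by (simp add: aff_dim_hyperplane)
  qed (use P(1) p0P affine_hyperplane in auto)
  obtain a b where frame: "orthonormal_frame a b \<nu>"
  proof -
    obtain v where v: "v \<noteq> 0" "orthogonal \<nu> v" using orthogonal_to_vector_exists[of \<nu>] by auto
    define a where "a = v /\<^sub>R norm v"
    define b where "b = cross3 \<nu> a"
    have a: "norm a = 1" "\<nu> \<bullet> a = 0" using v by (simp_all add: a_def orthogonal_def)
    have "(norm b)\<^sup>2 = 1" using norm_cross_dot[of \<nu> a] \<nu>(1) a by (simp add: b_def)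
    then have "sqrt ((norm b)\<^sup>2) = 1" by simp
    then have "norm b = 1" by simp
    then have "orthonormal_frame a b \<nu>"
      using \<nu>(1) a by (simp add: orthonormal_frame_def b_def dot_cross_self inner_commute)
    then show thesis by (rule that)
  qed
  note fi = frame_inner[OF frame]
  have frame': "orthonormal_frame a b (- \<nu>)" using frame by (simp add: orthonormal_frame_def)
  have "bounded (closure \<Omega>)" using \<Omega>(3) by (rule bounded_closure)
  then obtain R where R: "\<And>q. q \<in> closure \<Omega> \<Longrightarrow> norm q \<le> R" unfolding bounded_iff by blast
  \<comment> \<open>The origin is moved along \<open>b\<close> until the bounded domain has positive second coordinate.\<close>
  define p where "p = p0 - (R + norm p0 + 1) *\<^sub>R b"
  have p\<nu>: "(x - p) \<bullet> \<nu> = \<nu> \<bullet> x - \<nu> \<bullet> p0" for x using fi by (simp add: p_def inner_simps inner_commute)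
  have P_eq': "P = {x. (x - p) \<bullet> \<nu> = 0}" unfolding P_eq p\<nu> by simp
  then have P_eq'': "P = {x. (x - p) \<bullet> (- \<nu>) = 0}" by simp
  have pos: "(q - p) \<bullet> b > 0" if "q \<in> closure \<Omega>" for q
  proof -
    have "norm b = 1" using frame by (simp add: orthonormal_frame_def)
    then have "\<bar>(q - p0) \<bullet> b\<bar> \<le> norm (q - p0)" using Cauchy_Schwarz_ineq2[of "q - p0" b] by simp
    also have "\<dots> \<le> R + norm p0" using norm_triangle_ineq4[of q p0] R[OF that] by linarith
    finally have "\<bar>(q - p0) \<bullet> b\<bar> \<le> R + norm p0" .
    moreover have "(q - p) \<bullet> b = (q - p0) \<bullet> b + (R + norm p0 + 1)"
      using fi by (simp add: p_def inner_simps)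
    ultimately show ?thesis by linarith
  qed
  have K: "\<bar>H x\<bar> \<le> ?K" if "x \<in> sphere 0 1" for x
  proof -
    obtain W G where WG: "open W \<and> sphere 0 1 \<subseteq> W \<and> Ck_on 1 W G \<and> (\<forall>x\<in>sphere 0 1. G x = H x)"
      using assms(1) unfolding C1_on_sphere_def by (elim exE) (rule that)
    then have "continuous_on W G" using Ck_on_SucD[of 0 W G] by simp
    then have "continuous_on (sphere 0 1) G" by (rule continuous_on_subset) (use WG in blast)
    then have "continuous_on (sphere 0 1) H" by (rule continuous_on_eq) (use WG in blast)
    then have "compact (H ` sphere 0 1)" by (intro compact_continuous_image compact_sphere)
    then have "bdd_above (H ` sphere 0 1)" by (intro bounded_imp_bdd_above compact_imp_bounded)
    then have "H x \<le> ?K" using that by (intro cSUP_upper)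
    then show ?thesis using assms(2) that by (simp add: less_imp_le)
  qed
  have K0: "?K > 0"
  proof -
    have "\<nu> \<in> sphere 0 1" using \<nu>(1) by simp
    then have "0 < H \<nu>" "\<bar>H \<nu>\<bar> \<le> ?K" using assms(2) K by blast+
    then show ?thesis by linarith
  qed
  have bound: "ennreal \<bar>h q\<bar> \<le> ennreal ?K * area M / ennreal (2 * pi)" if q: "q \<in> closure \<Omega>" for q
  proof -
    have M': "M = (\<lambda>q. q + (- h q) *\<^sub>R (- \<nu>)) ` closure \<Omega>" unfolding M by simp
    have up: "graph_surface H M N p a b \<nu> (closure \<Omega>) h ?K"
      by (intro graph_surface.intro Hs assms(1) cM frame M K0 K pos)
        (use assms(5) \<Omega>P P_eq' in auto)
    \<comment> \<open>Points below the plane lie above it for the opposite direction.\<close>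
    have down: "graph_surface H M N p a b (- \<nu>) (closure \<Omega>) (\<lambda>q. - h q) ?K"
      by (intro graph_surface.intro Hs assms(1) cM frame' M' K0 K pos)
        (use assms(5) \<Omega>P P_eq'' in auto)
    consider "h q > 0" | "- h q > 0" | "h q = 0" by linarith
    then show ?thesis
    proof cases
      case 1 then show ?thesis using graph_surface.height_bound[OF up q] by simp
    next
      case 2 then show ?thesis using graph_surface.height_bound[OF down q] by simp
    qed simp
  qed
  have infd: "infdist x P \<le> \<bar>h q\<bar>" if "x = q + h q *\<^sub>R \<nu>" "q \<in> closure \<Omega>" for x q
  proof -
    have "infdist x P \<le> dist x q" using that \<Omega>P by (intro infdist_le) auto
    then show ?thesis using that(1) \<nu>(1) by (simp add: dist_norm)
  qed
  show ?thesis
  proof (cases "ennreal ?K * area M / ennreal (2 * pi)")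
    case (real B)
    have "height M P \<le> B" unfolding height_def
    proof (rule cSUP_least)
      show "M \<noteq> {}" using M p0 closure_subset by blast
      fix x assume "x \<in> M"
      then obtain q where q: "q \<in> closure \<Omega>" "x = q + h q *\<^sub>R \<nu>" using M by auto
      have "\<bar>h q\<bar> \<le> B" using bound[OF q(1)] real by (simp add: ennreal_le_iff)
      then show "infdist x P \<le> B" using infd[OF q(2,1)] by linarith
    qed
    then show ?thesis using real by (simp add: ennreal_leI)
  next
    case top
    then show ?thesis by simp
  qed
qed

end
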